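(* Let $\alpha>0$, $0<p,q\le\infty$, $0<s<\infty$. Let $\delta_0=\delta_0(\alpha,p,q)\in(0,\frac12]$ be a number for which the atomic decomposition property (AD) of the context holds, fix $0<\delta<\delta_0$, and let $\mathcal P_\delta$ be a $\delta$-pocket tiling of $\mathbb C$ with centers $\zeta_Q$. Then, for every $R>C_{\mathrm{out}}\delta$, the following assertions are equivalent for a positive Borel measure $\mu$ on $\mathbb C$: (i) $\mu$ is an $s$-Carleson measure for $\mathcal F_\alpha^{p,q}$, i.e. the embedding $i_\mu:\mathcal F_\alpha^{p,q}\to L^s_\alpha(\mu)$, $i_\mu f=f$, is bounded. (ii) The sequence $u_{\mu,R}$ belongs to $\ell^{p_s^*,q_s^*}$. (iii) The function $U_{\mu,R}$ belongs to $L_{\mathrm{sh}}^{p_s^*,q_s^*}(\mathbb C)$. Moreover, $$\|i_\mu\|^s\asymp\|u_{\mu,R}\|_{\ell^{p_s^*,q_s^*}}\asymp\|U_{\mu,R}\|_{L_{\mathrm{sh}}^{p_s^*,q_s^*}},$$ where the implicit constants depend only on $\alpha,p,q,s,\delta$ and $R$.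
   Context: Convention: $\frac1\infty=0$; $X\asymp Y$ means $C^{-1}Y\le X\le CY$. Mixed-norm Fock spaces. For an entire function $f$ and $r\ge0$, $M_p(f,r):=\left(\frac1{2\pi}\int_0^{2\pi}|f(re^{i\theta})|^p\,d\theta\right)^{1/p}$ for $0<p<\infty$, and $M_\infty(f,r):=\sup_{\theta}|f(re^{i\theta})|$. Put $\|f\|_{\mathcal F_\alpha^{p,q}}:=\left(\int_0^\infty M_p(f,r)^q\,\alpha q\,e^{-\frac{\alpha q}{2}r^2}r\,dr\right)^{1/q}$ for $0<q<\infty$ and $\|f\|_{\mathcal F_\alpha^{p,\infty}}:=\sup_{r\ge0}M_p(f,r)e^{-\frac{\alpha}{2}r^2}$. $\mathcal F_\alpha^{p,q}$ is the set of entire $f$ with finite (quasi-)norm. Kernels: $\kappa_w(z):=e^{\alpha\overline w z-\frac{\alpha}{2}|w|^2}$. $\delta$-pocket tiling. Let $\delta\in(0,\frac12]$, $N_\delta:=\lceil\delta^{-1}\rceil$, $A_k:=\{z\in\mathbb C:k\le|z|<k+1\}$, $k\ge0$. For $k\ge0$, $0\le\nu\le N_\delta-1$ let $N_{\delta,0,\nu}:=2\nu+1$ and $N_{\delta,k,\nu}:=(2k+1)N_\delta$ if $k\ge1$; $\theta_{k,\nu,\mu}:=2\pi\mu/N_{\delta,k,\nu}$. For $0\le\nu\le N_\delta$ let $r_{0,\nu}:=\nu/N_\delta$ and $r_{k,\nu}:=\left(k^2+\frac{\nu}{N_\delta}(2k+1)\right)^{1/2}$ if $k\ge1$. The pockets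 are $Q_{k,\nu,\mu}:=\{re^{i\theta}:r\in[r_{k,\nu},r_{k,\nu+1}),\ \theta\in[\theta_{k,\nu,\mu},\theta_{k,\nu,\mu+1})\}$ ($k\ge0$, $0\le\nu\le N_\delta-1$, $0\le\mu\le N_{\delta,k,\nu}-1$), with centers $\zeta_{k,\nu,\mu}:=\frac{r_{k,\nu}+r_{k,\nu+1}}2\exp\left(i\,\frac{\theta_{k,\nu,\mu}+\theta_{k,\nu,\mu+1}}2\right)$. $\mathcal P_\delta$ is the family of all pockets $Q$, with centers $\zeta_Q$; $\mathcal P_{\delta,k}:=\{Q\in\mathcal P_\delta:Q\subset A_k\}$. Fix absolute constants $0<c_{\mathrm{in}}<C_{\mathrm{out}}<\infty$ (for instance $c_{\mathrm{in}}=\frac1{32}$, $C_{\mathrm{out}}=4$) with $B(\zeta_Q,c_{\mathrm{in}}\delta)\subset Q\subset B(\zeta_Q,C_{\mathrm{out}}\delta)$ for all $Q\in\mathcal P_\delta$, $\delta\in(0,\frac12]$; $B(z,R)$ is the open Euclidean disc. Property (AD) for $\delta_0$: for every $\delta\in(0,\delta_0)$, the map $c\mapsto\sum_{Q\in\mathcal P_\delta}c_Q\kappa_{\zeta_Q}$ is bounded from $\ell_w^{p,q}$ to $\mathcal F_\alpha^{p,q}$, is onto, and $\|f\|_{\mathcal F_\alpha^{p,q}}\asymp\inf\{\|c\|_{\ell_w^{p,q}}:f=\sum_Qc_Q\kappa_{\zeta_Q}\}$ with constants depending only on $\alpha,p,q,\delta$. Here $\ell_w^{p,q}$ is the space of $c=(c_Q)$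 for which $\left((1+k)^{\frac1q-\frac1p}\|(c_Q)_{Q\in\mathcal P_{\delta,k}}\|_{\ell^p}\right)_{k\ge0}\in\ell^q$, with the $\ell^q$-(quasi-)norm of that sequence. (Such a $\delta_0$ exists.) Measures. $L^s_\alpha(\mu)$ is the space of measurable $f$ with $\|f\|^s_{L^s_\alpha(\mu)}:=\int_{\mathbb C}|f(z)|^se^{-\frac{\alpha s}2|z|^2}d\mu(z)<\infty$. Ball masses: $U_{\mu,R}(\zeta):=\|\kappa_\zeta\|_{\mathcal F_\alpha^{p,q}}^{-s}\,\mu(B(\zeta,R))$ for $\zeta\in\mathbb C$, and $u_{\mu,R}(Q):=U_{\mu,R}(\zeta_Q)$ for $Q\in\mathcal P_\delta$. Exponents: $p_s^*:=\infty$ if $0<p\le s$, $p_s^*:=\frac p{p-s}$ if $s<p<\infty$, $p_s^*:=1$ if $p=\infty$; $q_s^*$ is defined from $q$ in the same way. Shell norms: $\|c\|_{\ell^{p_s^*,q_s^*}}:=\left\|\left(\|(c_Q)_{Q\in\mathcal P_{\delta,k}}\|_{\ell^{p_s^*}}\right)_{k\ge0}\right\|_{\ell^{q_s^*}}$ and $\|F\|_{L_{\mathrm{sh}}^{p_s^*,q_s^*}}:=\left\|\left(\|F\|_{L^{p_s^*}(A_k,dA)}\right)_{k\ge0}\right\|_{\ell^{q_s^*}}$, where $dA$ is Lebesgue area measure; the corresponding spaces consist of sequences/measurable functions with finite norm. *)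

theory Defs
  imports "HOL-Analysis.Analysis" "HOL-Probability.Essential_Supremum"
begin

text \<open>
  Exponents in \<open>(0,\<infinity>]\<close> are of type \<^typ>\<open>ennreal\<close>; since \<open>1 / \<infinity> = 0\<close> there,
  \<open>enn2real (1 / p)\<close> is the real number \<open>1/p\<close> with the convention \<open>1/\<infinity> = 0\<close>.
  All (quasi-)norms take values in \<^typ>\<open>ennreal\<close>.
\<close>

text \<open>Real power on \<open>[0,\<infinity>]\<close>; only used with exponents \<open>a > 0\<close>.\<close>

definition enn_powr :: "ennreal \<Rightarrow> real \<Rightarrow> ennreal" where
  "enn_powr x a = (if x = \<infinity> then \<infinity> else ennreal (enn2real x powr a))"

definition comparable :: "real \<Rightarrow> ennreal \<Rightarrow> ennreal \<Rightarrow> bool" where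
  "comparable C X Y \<longleftrightarrow> ennreal (1 / C) * Y \<le> X \<and> X \<le> ennreal C * Y"

text \<open>
  The \<open>L\<^sup>p(M)\<close> (quasi-)norm; for \<open>M = count_space I\<close> it is the \<open>\<ell>\<^sup>p(I)\<close> (quasi-)norm.
\<close>

definition Lp_norm :: "'a measure \<Rightarrow> ennreal \<Rightarrow> ('a \<Rightarrow> ennreal) \<Rightarrow> ennreal" where
  "Lp_norm M p f =
     (if p = \<infinity> then esssup M f
      else enn_powr (\<integral>\<^sup>+ x. enn_powr (f x) (enn2real p) \<partial>M) (1 / enn2real p))"


subsection \<open>Mixed-norm Fock spaces\<close>

definition int_mean :: "ennreal \<Rightarrow> (complex \<Rightarrow> complex) \<Rightarrow> real \<Rightarrow> ennreal" where
  "int_mean p f r =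
     (if p = \<infinity> then (SUP \<theta>. ennreal (norm (f (of_real r * cis \<theta>))))
      else enn_powr
        (ennreal (1 / (2 * pi)) *
          (\<integral>\<^sup>+ \<theta>\<in>{0..2 * pi}. ennreal (norm (f (of_real r * cis \<theta>)) powr enn2real p) \<partial>lborel))
        (1 / enn2real p))"

definition Fock_norm ::
    "real \<Rightarrow> ennreal \<Rightarrow> ennreal \<Rightarrow> (complex \<Rightarrow> complex) \<Rightarrow> ennreal" where
  "Fock_norm \<alpha> p q f =
     (if q = \<infinity> then (SUP r\<in>{0..}. int_mean p f r * ennreal (exp (- (\<alpha> / 2) * r\<^sup>2)))
      else enn_powr
        (\<integral>\<^sup>+ r\<in>{0..}. enn_powr (int_mean p f r) (enn2real q) *
            ennreal (\<alpha> * enn2real q * exp (- (\<alpha> * enn2real q / 2) * r\<^sup>2) * r) \<partial>lborel)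
        (1 / enn2real q))"

definition Fock_space :: "real \<Rightarrow> ennreal \<Rightarrow> ennreal \<Rightarrow> (complex \<Rightarrow> complex) set" where
  "Fock_space \<alpha> p q = {f. f holomorphic_on UNIV \<and> Fock_norm \<alpha> p q f < \<infinity>}"

definition kern :: "real \<Rightarrow> complex \<Rightarrow> complex \<Rightarrow> complex" where
  "kern \<alpha> w z = exp (of_real \<alpha> * cnj w * z - of_real (\<alpha> / 2 * (norm w)\<^sup>2))"


subsection \<open>Pocket tilings\<close>

definition annulus :: "nat \<Rightarrow> complex set" where
  "annulus k = {z. real k \<le> norm z \<and> norm z < real k + 1}"

definition Ndelta :: "real \<Rightarrow> nat" where
  "Ndelta \<delta> = nat \<lceil>1 / \<delta>\<rceil>"

definition Nang :: "real \<Rightarrow> nat \<Rightarrow> nat \<Rightarrow> nat" where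
  "Nang \<delta> k \<nu> = (if k = 0 then 2 * \<nu> + 1 else (2 * k + 1) * Ndelta \<delta>)"

definition ang :: "real \<Rightarrow> nat \<Rightarrow> nat \<Rightarrow> nat \<Rightarrow> real" where
  "ang \<delta> k \<nu> m = 2 * pi * real m / real (Nang \<delta> k \<nu>)"

definition rad :: "real \<Rightarrow> nat \<Rightarrow> nat \<Rightarrow> real" where
  "rad \<delta> k \<nu> =
     (if k = 0 then real \<nu> / real (Ndelta \<delta>)
      else sqrt ((real k)\<^sup>2 + real \<nu> / real (Ndelta \<delta>) * (2 * real k + 1)))"

text \<open>
  Pockets are represented by their index triples \<open>(k, \<nu>, m)\<close>. Distinct admissible triples
  give disjoint nonempty pockets, so families indexed by pockets are families indexed by triples.
\<close>

type_synonym pidx = "nat \<times> nat \<times> nat"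

definition pockets :: "real \<Rightarrow> pidx set" where
  "pockets \<delta> = {(k, \<nu>, m). \<nu> < Ndelta \<delta> \<and> m < Nang \<delta> k \<nu>}"

fun pocket :: "real \<Rightarrow> pidx \<Rightarrow> complex set" where
  "pocket \<delta> (k, \<nu>, m) =
     {of_real r * cis \<theta> | r \<theta>. rad \<delta> k \<nu> \<le> r \<and> r < rad \<delta> k (\<nu> + 1) \<and>
                               ang \<delta> k \<nu> m \<le> \<theta> \<and> \<theta> < ang \<delta> k \<nu> (m + 1)}"

fun center :: "real \<Rightarrow> pidx \<Rightarrow> complex" where
  "center \<delta> (k, \<nu>, m) =
     of_real ((rad \<delta> k \<nu> + rad \<delta> k (\<nu> + 1)) / 2) *
     cis ((ang \<delta> k \<nu> m + ang \<delta> k \<nu> (m + 1)) / 2)"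

definition shell_pockets :: "real \<Rightarrow> nat \<Rightarrow> pidx set" where
  "shell_pockets \<delta> k = {Q \<in> pockets \<delta>. pocket \<delta> Q \<subseteq> annulus k}"

definition pocket_constants :: "real \<Rightarrow> real \<Rightarrow> bool" where
  "pocket_constants c_in C_out \<longleftrightarrow>
     0 < c_in \<and> c_in < C_out \<and>
     (\<forall>\<delta>. 0 < \<delta> \<and> \<delta> \<le> 1 / 2 \<longrightarrow>
        (\<forall>Q\<in>pockets \<delta>. ball (center \<delta> Q) (c_in * \<delta>) \<subseteq> pocket \<delta> Q \<and>
                        pocket \<delta> Q \<subseteq> ball (center \<delta> Q) (C_out * \<delta>)))"


subsection \<open>Atomic decomposition\<close>

definition lw_norm :: "ennreal \<Rightarrow> ennreal \<Rightarrow> real \<Rightarrow> (pidx \<Rightarrow> complex) \<Rightarrow> ennreal" where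
  "lw_norm p q \<delta> c =
     Lp_norm (count_space UNIV) q
       (\<lambda>k::nat. ennreal ((1 + real k) powr (enn2real (1 / q) - enn2real (1 / p))) *
          Lp_norm (count_space (shell_pockets \<delta> k)) p (\<lambda>Q. ennreal (norm (c Q))))"

definition lw_space :: "ennreal \<Rightarrow> ennreal \<Rightarrow> real \<Rightarrow> (pidx \<Rightarrow> complex) set" where
  "lw_space p q \<delta> = {c. lw_norm p q \<delta> c < \<infinity>}"

text \<open>
  \<open>f = \<Sum>\<^sub>Q c\<^sub>Q \<kappa>\<^bsub>\<zeta>\<^sub>Q\<^esub>\<close>, the series converging unconditionally (equivalently, absolutely)
  at every point. For \<open>c\<close> in the weighted sequence space the convergence is automatically
  locally uniform; norm convergence cannot be asked for when \<open>p\<close> or \<open>q\<close> is \<open>\<infinity>\<close>.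
\<close>

definition synthesizes ::
    "real \<Rightarrow> real \<Rightarrow> (pidx \<Rightarrow> complex) \<Rightarrow> (complex \<Rightarrow> complex) \<Rightarrow> bool" where
  "synthesizes \<alpha> \<delta> c f \<longleftrightarrow>
     (\<forall>z. ((\<lambda>Q. c Q * kern \<alpha> (center \<delta> Q) z) has_sum f z) (pockets \<delta>))"

definition atomic_decomposition :: "real \<Rightarrow> ennreal \<Rightarrow> ennreal \<Rightarrow> real \<Rightarrow> bool" where
  "atomic_decomposition \<alpha> p q \<delta>0 \<longleftrightarrow>
     (\<forall>\<delta>. 0 < \<delta> \<and> \<delta> < \<delta>0 \<longrightarrow>
        (\<exists>C::real. \<forall>c\<in>lw_space p q \<delta>. \<exists>f\<in>Fock_space \<alpha> p q.
            synthesizes \<alpha> \<delta> c f \<and> Fock_norm \<alpha> p q f \<le> ennreal C * lw_norm p q \<delta> c) \<and>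
        (\<forall>f\<in>Fock_space \<alpha> p q. \<exists>c\<in>lw_space p q \<delta>. synthesizes \<alpha> \<delta> c f) \<and>
        (\<exists>C>0. \<forall>f\<in>Fock_space \<alpha> p q.
            comparable C (Fock_norm \<alpha> p q f)
              (INF c\<in>{c \<in> lw_space p q \<delta>. synthesizes \<alpha> \<delta> c f}. lw_norm p q \<delta> c)))"


subsection \<open>Carleson measures\<close>

definition Ls_norm :: "real \<Rightarrow> real \<Rightarrow> complex measure \<Rightarrow> (complex \<Rightarrow> complex) \<Rightarrow> ennreal" where
  "Ls_norm \<alpha> s \<mu> f =
     enn_powr (\<integral>\<^sup>+ z. ennreal (norm (f z) powr s * exp (- (\<alpha> * s / 2) * (norm z)\<^sup>2)) \<partial>\<mu>) (1 / s)"

definition Ls_space :: "real \<Rightarrow> real \<Rightarrow> complex measure \<Rightarrow> (complex \<Rightarrow> complex) set" where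
  "Ls_space \<alpha> s \<mu> = {f \<in> borel_measurable \<mu>. Ls_norm \<alpha> s \<mu> f < \<infinity>}"

definition Carleson ::
    "real \<Rightarrow> ennreal \<Rightarrow> ennreal \<Rightarrow> real \<Rightarrow> complex measure \<Rightarrow> bool" where
  "Carleson \<alpha> p q s \<mu> \<longleftrightarrow>
     (\<exists>C::real. \<forall>f\<in>Fock_space \<alpha> p q.
        f \<in> Ls_space \<alpha> s \<mu> \<and> Ls_norm \<alpha> s \<mu> f \<le> ennreal C * Fock_norm \<alpha> p q f)"

definition embedding_norm ::
    "real \<Rightarrow> ennreal \<Rightarrow> ennreal \<Rightarrow> real \<Rightarrow> complex measure \<Rightarrow> ennreal" where
  "embedding_norm \<alpha> p q s \<mu> =
     (SUP f\<in>{f \<in> Fock_space \<alpha> p q. Fock_norm \<alpha> p q f \<le> 1}. Ls_norm \<alpha> s \<mu> f)"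

definition star_exp :: "real \<Rightarrow> ennreal \<Rightarrow> ennreal" where
  "star_exp s p =
     (if p \<le> ennreal s then \<infinity>
      else if p = \<infinity> then 1
      else ennreal (enn2real p / (enn2real p - s)))"

definition ball_mass ::
    "real \<Rightarrow> ennreal \<Rightarrow> ennreal \<Rightarrow> real \<Rightarrow> complex measure \<Rightarrow> real \<Rightarrow> complex \<Rightarrow> ennreal" where
  "ball_mass \<alpha> p q s \<mu> R \<zeta> =
     emeasure \<mu> (ball \<zeta> R) / enn_powr (Fock_norm \<alpha> p q (kern \<alpha> \<zeta>)) s"

definition pocket_mass ::
    "real \<Rightarrow> ennreal \<Rightarrow> ennreal \<Rightarrow> real \<Rightarrow> real \<Rightarrow> complex measure \<Rightarrow> real \<Rightarrow> pidx \<Rightarrow> ennreal" where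
  "pocket_mass \<alpha> p q s \<delta> \<mu> R Q = ball_mass \<alpha> p q s \<mu> R (center \<delta> Q)"

definition shell_seq_norm :: "ennreal \<Rightarrow> ennreal \<Rightarrow> real \<Rightarrow> (pidx \<Rightarrow> ennreal) \<Rightarrow> ennreal" where
  "shell_seq_norm a b \<delta> c =
     Lp_norm (count_space UNIV) b (\<lambda>k::nat. Lp_norm (count_space (shell_pockets \<delta> k)) a c)"

definition shell_seq_space :: "ennreal \<Rightarrow> ennreal \<Rightarrow> real \<Rightarrow> (pidx \<Rightarrow> ennreal) set" where
  "shell_seq_space a b \<delta> = {c. shell_seq_norm a b \<delta> c < \<infinity>}"

definition shell_fun_norm :: "ennreal \<Rightarrow> ennreal \<Rightarrow> (complex \<Rightarrow> ennreal) \<Rightarrow> ennreal" where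
  "shell_fun_norm a b F =
     Lp_norm (count_space UNIV) b (\<lambda>k::nat. Lp_norm (lebesgue_on (annulus k)) a F)"

definition shell_fun_space :: "ennreal \<Rightarrow> ennreal \<Rightarrow> (complex \<Rightarrow> ennreal) set" where
  "shell_fun_space a b = {F \<in> borel_measurable lebesgue. shell_fun_norm a b F < \<infinity>}"

end

theory Submission
  imports Defs "HOL-Probability.Distributions" "HOL-Real_Asymp.Real_Asymp"
begin

text \<open>
  Write \<open>v\<^sub>Q\<close> for the suitably weighted mass of a ball around \<open>\<zeta>\<^sub>Q\<close> of radius \<open>C_out * \<delta>\<close>.
  If \<open>f = \<Sum> c\<^sub>Q \<kappa>\<^sub>Q\<close>, then \<open>\<bar>f(z)\<bar>\<^sup>s e\<^bsup>-\<alpha>s\<bar>z\<bar>\<^sup>2/2\<^esup>\<close> is at most a Gaussian average of the \<open>\<bar>c\<^sub>Q\<bar>\<^sup>s\<close>, because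
  \<open>\<bar>\<kappa>\<^sub>w(z)\<bar> e\<^bsup>-\<alpha>\<bar>z\<bar>\<^sup>2/2\<^esup> = e\<^bsup>-\<alpha>\<bar>z-w\<bar>\<^sup>2/2\<^esup>\<close>. Integrating against \<open>\<mu>\<close> gives a bilinear form in \<open>\<bar>c\<bar>\<^sup>s\<close> and \<open>v\<close>
  with a Gaussian kernel, which a Schur test in the mixed norm bounds by \<open>\<parallel>c\<parallel>\<^sup>s \<parallel>v\<parallel>\<close>.
  Conversely, testing the embedding on \<open>\<Sum> \<plusminus>c\<^sub>Q \<kappa>\<^sub>Q\<close> and averaging over the signs bounds
  \<open>\<Sum> \<bar>c\<^sub>Q\<bar>\<^sup>s \<mu>(B(\<zeta>\<^sub>Q, R))\<close>, and duality recovers the mixed norm of the ball masses.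
  The continuous averages differ from \<open>v\<close> by the same Gaussian kernel operators.
\<close>

subsection \<open>Sequence norms, duality and the Schur test\<close>

text \<open>The radii make the estimates close into a cycle. Balls of radius \<open>\<rho>\<close> =
  \<open>C_out * \<delta>\<close> already cover the plane, so the embedding is bounded by their
  masses, while testing controls the masses of the larger balls of radius \<open>R\<close>. Since R
  > \<rho>, the first masses are at most the second, and all quantities become comparable. The
  strict inequality also lets the centre of an R-ball move a little while it still contains the
  \<rho>-ball; this brings in the continuous average.

  The obstacle is that p and q may lie below 1 and that \<mu> is an arbitrary Borel measure.
  Triangle inequalities and Banach duality give way to estimates in [0, \<infinity>] that cover all
  exponents: explicit finite extremisers, Young's inequality after normalisation, and Tonelli
  against countable sums. Between shells k and l the weights change by at most a power of 1 + |k -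
  l|, which a fraction of the Gaussian absorbs. Constants are chosen before \<mu>.\<close>

abbreviation gauss :: "real \<Rightarrow> 'a \<Rightarrow> 'a :: real_normed_vector \<Rightarrow> real" where
  "gauss b z w \<equiv> exp (- b * (norm (z - w))\<^sup>2)"

\<comment> \<open>Sums over arbitrary index sets are counting-measure integrals, so divergent sums
  are simply \<open>top\<close> and interchanging two of them is Tonelli's theorem.\<close>
syntax "_nnsum" :: "pttrn \<Rightarrow> 'a set \<Rightarrow> ennreal \<Rightarrow> ennreal"  ("(2\<Sum>\<^sup>+_\<in>_./ _)" [0, 51, 10] 10)
translations "\<Sum>\<^sup>+i\<in>I. f" == "CONST nn_integral (CONST count_space I) (\<lambda>i. f)"

section \<open>Powers on [0, \<infinity>] and exponents\<close>

lemma enn_powr_ennreal: "0 \<le> x \<Longrightarrow> enn_powr (ennreal x) a = ennreal (x powr a)"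
  by (simp add: enn_powr_def)

lemma enn_powr_top [simp]: "enn_powr top a = top"
  by (simp add: enn_powr_def)

lemma enn_powr_0 [simp]: "enn_powr 0 a = 0"
  by (simp add: enn_powr_def)

lemma enn_powr_1 [simp]: "enn_powr 1 a = 1"
  by (simp add: enn_powr_def)

lemma enn_powr_one [simp]: "enn_powr x 1 = x"
  by (cases x) (auto simp: enn_powr_def)

lemma enn_powr_mono: "x \<le> y \<Longrightarrow> 0 \<le> a \<Longrightarrow> enn_powr x a \<le> enn_powr y a"
  by (cases x; cases y) (auto simp: enn_powr_def top_unique intro!: ennreal_leI powr_mono2)

lemma enn_powr_mult: "0 < a \<Longrightarrow> enn_powr (x * y) a = enn_powr x a * enn_powr y a"
  by (cases x; cases y)
     (auto simp: enn_powr_def ennreal_mult[symmetric] powr_mult ennreal_mult_top ennreal_top_mult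
           simp del: ennreal_mult)

lemma enn_powr_powr: "enn_powr (enn_powr x a) b = enn_powr x (a * b)"
  by (cases x) (auto simp: enn_powr_def powr_powr)

lemma enn_powr_inverse: "0 < a \<Longrightarrow> enn_powr (enn_powr x a) (1 / a) = x"
                        "0 < a \<Longrightarrow> enn_powr (enn_powr x (1 / a)) a = x"
  by (simp_all add: enn_powr_powr)

lemma enn_powr_eq_0 [simp]: "enn_powr x a = 0 \<longleftrightarrow> x = 0"
  by (cases x) (auto simp: enn_powr_def)

lemma enn_powr_eq_top [simp]: "enn_powr x a = top \<longleftrightarrow> x = top"
  by (cases x) (auto simp: enn_powr_def)

lemma enn_powr_less_top [simp]: "enn_powr x a < top \<longleftrightarrow> x < top"
  by (simp add: less_top[symmetric] enn_powr_eq_top del: not_gr_zero)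

lemma enn_powr_le_iff: "0 < a \<Longrightarrow> enn_powr x (1 / a) \<le> y \<longleftrightarrow> x \<le> enn_powr y a"
  using enn_powr_mono[of "enn_powr x (1 / a)" y a] enn_powr_mono[of x "enn_powr y a" "1 / a"]
  by (auto simp: enn_powr_inverse)

lemma le_enn_powr_iff: "0 < a \<Longrightarrow> y \<le> enn_powr x (1 / a) \<longleftrightarrow> enn_powr y a \<le> x"
  using enn_powr_mono[of y "enn_powr x (1 / a)" a] enn_powr_mono[of "enn_powr y a" x "1 / a"]
  by (auto simp: enn_powr_inverse)

lemma enn_powr_measurable [measurable]:
  assumes [measurable]: "f \<in> borel_measurable M"
  shows "(\<lambda>x. enn_powr (f x) a) \<in> borel_measurable M"
  unfolding enn_powr_def infinity_ennreal_def by measurable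

lemma finite_exponent:
  assumes "p > 0" "p \<noteq> \<infinity>"
  shows "0 < enn2real p" "ennreal (enn2real p) = p"
  using assms by (cases p; simp)+

lemma inverse_exponent:
  assumes "p > 0" "p \<noteq> \<infinity>"
  shows "enn2real (1 / p) = 1 / enn2real p"
  using assms by (cases p) (auto simp: ennreal_divide_numeral divide_ennreal_def inverse_ennreal inverse_eq_divide)

lemma star_exp_eq:
  assumes "0 < s" "\<not> p \<le> ennreal s" "p \<noteq> \<infinity>"
  defines "P \<equiv> enn2real p"
  shows "s < P" "star_exp s p = ennreal (P / (P - s))" "star_exp s p \<noteq> \<infinity>"
    "enn2real (star_exp s p) = P / (P - s)"
  using assms by (cases p; auto simp: star_exp_def P_def ennreal_le_iff)+

lemma star_exp_pos: "0 < s \<Longrightarrow> 0 < star_exp s p"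
  by (cases p) (auto simp: star_exp_def ennreal_le_iff)

section \<open>Sequence norms as norms of counting measure\<close>

lemma esssup_count_space: "esssup (count_space I) f = (SUP i\<in>I. f i)"
  for f :: "'a \<Rightarrow> ennreal"
proof (rule antisym)
  show "esssup (count_space I) f \<le> (SUP i\<in>I. f i)"
    by (rule esssup_I) (auto simp: AE_count_space intro: SUP_upper)
  show "(SUP i\<in>I. f i) \<le> esssup (count_space I) f"
    using esssup_AE[of f "count_space I"] by (auto simp: AE_count_space intro: SUP_least)
qed

lemma lp_norm_top: "Lp_norm (count_space I) top f = (SUP i\<in>I. f i)"
  by (simp add: Lp_norm_def esssup_count_space)

lemma Lp_norm_le_iff:
  assumes "p > 0" "p \<noteq> \<infinity>"
  shows "Lp_norm M p f \<le> B \<longleftrightarrow> (\<integral>\<^sup>+ x. enn_powr (f x) (enn2real p) \<partial>M) \<le> enn_powr B (enn2real p)"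
  using finite_exponent[OF assms] assms by (simp add: Lp_norm_def enn_powr_le_iff)

lemma nn_integral_count_space_mono_set:
  assumes "J \<subseteq> I"
  shows "(\<Sum>\<^sup>+i\<in>J. f i) \<le> (\<Sum>\<^sup>+i\<in>I. f i)"
proof -
  have "(\<Sum>\<^sup>+i\<in>J. f i) = (\<Sum>\<^sup>+i\<in>J. f i * indicator J i)"
    by (intro nn_integral_cong) auto
  also have "\<dots> = (\<Sum>\<^sup>+i\<in>I. f i * indicator J i)"
    using assms by (intro nn_integral_count_space_eq) auto
  also have "\<dots> \<le> (\<Sum>\<^sup>+i\<in>I. f i)"
    by (intro nn_integral_mono) (auto split: split_indicator)
  finally show ?thesis .
qed

lemma lp_norm_mono:
  assumes "p > 0" "\<And>i. i \<in> I \<Longrightarrow> f i \<le> g i"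
  shows "Lp_norm (count_space I) p f \<le> Lp_norm (count_space I) p g"
proof (cases "p = \<infinity>")
  case True then show ?thesis using assms by (auto simp: lp_norm_top intro!: SUP_mono)
next
  case False
  then show ?thesis
    using assms finite_exponent[OF assms(1) False]
    by (auto simp: Lp_norm_def intro!: enn_powr_mono nn_integral_mono)
qed

lemma lp_norm_cong:
  assumes "\<And>i. i \<in> I \<Longrightarrow> f i = g i"
  shows "Lp_norm (count_space I) p f = Lp_norm (count_space I) p g"
  using assms by (auto simp: Lp_norm_def esssup_count_space intro!: arg_cong2[where f=enn_powr] nn_integral_cong)

lemma lp_norm_cmult:
  assumes "p > 0"
  shows "Lp_norm (count_space I) p (\<lambda>i. c * f i) = c * Lp_norm (count_space I) p f"
proof (cases "p = \<infinity>")
  case True then show ?thesis by (simp add: lp_norm_top SUP_mult_left_ennreal)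
next
  case False
  note P = finite_exponent[OF assms False]
  show ?thesis
    using P False by (simp add: Lp_norm_def enn_powr_mult nn_integral_cmult enn_powr_inverse)
qed

lemma lp_norm_eq_0:
  assumes "p > 0" "Lp_norm (count_space I) p f = 0" "i \<in> I"
  shows "f i = 0"
proof (cases "p = \<infinity>")
  case True then show ?thesis using assms by (simp add: lp_norm_top bot_ennreal[symmetric] SUP_bot_conv)
next
  case False
  then show ?thesis using assms finite_exponent[OF assms(1) False]
    by (auto simp: Lp_norm_def nn_integral_0_iff_AE AE_count_space)
qed

lemma lp_norm_ge:
  assumes "p > 0" "i \<in> I"
  shows "f i \<le> Lp_norm (count_space I) p f"
proof (cases "p = \<infinity>")
  case True then show ?thesis using assms by (auto simp: lp_norm_top intro: SUP_upper)
next
  case False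
  note P = finite_exponent[OF assms(1) False]
  have "enn_powr (f i) (enn2real p) \<le> (\<Sum>\<^sup>+x\<in>I. enn_powr (f x) (enn2real p))"
    by (rule nn_integral_ge_point[OF assms(2)])
  then show ?thesis using P False by (simp add: Lp_norm_def le_enn_powr_iff)
qed

text \<open>Partial norms suffice because their supremum is the full norm; the duality argument
  below produces test sequences only on finite sets.\<close>

lemma lp_norm_nat_le:
  assumes "p > 0" "\<And>n. Lp_norm (count_space {..<n}) p f \<le> B"
  shows "Lp_norm (count_space (UNIV :: nat set)) p f \<le> B"
proof (cases "p = \<infinity>")
  case True
  have "f i \<le> B" for i
    using lp_norm_ge[of p i "{..<Suc i}" f] assms order_trans by blast
  then show ?thesis using True by (auto simp: lp_norm_top intro: SUP_least)
next
  case False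
  have "(\<Sum>i<n. enn_powr (f i) (enn2real p)) \<le> enn_powr B (enn2real p)" for n
    using assms(2)[of n] by (simp add: Lp_norm_le_iff[OF assms(1) False] nn_integral_count_space_finite)
  then show ?thesis
    by (simp add: Lp_norm_le_iff[OF assms(1) False] nn_integral_count_space_nat suminf_le_const)
qed

text \<open>Young's inequality with the conjugate exponents P / s and P / (P - s), whose
  coefficients s / P and (P - s) / P are bounded by 1.\<close>

lemma Young_enn:
  assumes "0 < s" "s < P"
  shows "enn_powr x s * y \<le> enn_powr x P + enn_powr y (P / (P - s))"
proof (cases "x = top \<or> y = top")
  case False
  then obtain a b where ab: "x = ennreal a" "y = ennreal b" "a \<ge> 0" "b \<ge> 0"
    by (cases x; cases y) auto
  have "(a powr s) * b \<le> (a powr s) powr (P / s) / (P / s) + b powr (P / (P - s)) / (P / (P - s))"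
    using assms ab by (intro Youngs_inequality) (auto simp: field_simps)
  also have "\<dots> \<le> (a powr s) powr (P / s) + b powr (P / (P - s))"
    using assms by (intro add_mono) (auto simp: field_simps intro!: mult_right_mono)
  also have "(a powr s) powr (P / s) = a powr P" using assms by (simp add: powr_powr)
  finally show ?thesis using ab
    by (simp add: enn_powr_ennreal ennreal_mult[symmetric] ennreal_plus[symmetric] ennreal_leI del: ennreal_plus)
qed auto

text \<open>
  With both norms at most \<open>1\<close>, Young's inequality splits the bilinear form into a row sum and a
  column sum of the kernel, so no Hoelder inequality is needed.
\<close>

lemma Schur_normalised:
  fixes x :: "'i \<Rightarrow> ennreal" and y :: "'j \<Rightarrow> ennreal"
  assumes "p > 0" "s > 0" "countable I" "countable J"
    and rows: "\<And>i. i \<in> I \<Longrightarrow> (\<Sum>\<^sup>+j\<in>J. K i j) \<le> A"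
    and cols: "\<And>j. j \<in> J \<Longrightarrow> (\<Sum>\<^sup>+i\<in>I. K i j) \<le> A"
    and x: "Lp_norm (count_space I) p x \<le> 1"
    and y: "Lp_norm (count_space J) (star_exp s p) y \<le> 1"
  shows "(\<Sum>\<^sup>+i\<in>I. (\<Sum>\<^sup>+j\<in>J. enn_powr (x i) s * y j * K i j)) \<le> 2 * A"
proof -
  have x1: "x i \<le> 1" if "i \<in> I" for i using lp_norm_ge[OF \<open>p > 0\<close> that, of x] x by (rule order_trans)
  have y1: "y j \<le> 1" if "j \<in> J" for j
    using lp_norm_ge[OF star_exp_pos[OF \<open>s > 0\<close>] that, of y p] y by (rule order_trans)
  have A2: "A \<le> 2 * A" by (simp add: mult_2 add_increasing)
  have swap: "(\<Sum>\<^sup>+i\<in>I. (\<Sum>\<^sup>+j\<in>J. f i j)) =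
      (\<Sum>\<^sup>+j\<in>J. (\<Sum>\<^sup>+i\<in>I. f i j))" for f :: "'i \<Rightarrow> 'j \<Rightarrow> ennreal"
    using assms by (intro nn_integral_count_space_nn_integral) auto
  \<comment> \<open>Mass on the \<open>I\<close> side is paid for by row sums; \<open>jbound\<close>
    is the mirror image with column sums.\<close>
  have ibound: "(\<Sum>\<^sup>+i\<in>I. (\<Sum>\<^sup>+j\<in>J. f i * K i j)) \<le> A"
    if "(\<Sum>\<^sup>+i\<in>I. f i) \<le> 1" for f
  proof -
    have "(\<Sum>\<^sup>+i\<in>I. (\<Sum>\<^sup>+j\<in>J. f i * K i j)) \<le> (\<Sum>\<^sup>+i\<in>I. f i * A)"
      by (intro nn_integral_mono) (auto simp: nn_integral_cmult intro!: mult_left_mono rows)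
    also have "\<dots> = (\<Sum>\<^sup>+i\<in>I. f i) * A" by (simp add: nn_integral_multc)
    also have "\<dots> \<le> A" using mult_right_mono[OF that, of A] by simp
    finally show ?thesis .
  qed
  have jbound: "(\<Sum>\<^sup>+i\<in>I. (\<Sum>\<^sup>+j\<in>J. f j * K i j)) \<le> A"
    if "(\<Sum>\<^sup>+j\<in>J. f j) \<le> 1" for f
  proof -
    have "(\<Sum>\<^sup>+j\<in>J. (\<Sum>\<^sup>+i\<in>I. f j * K i j)) \<le> (\<Sum>\<^sup>+j\<in>J. f j * A)"
      by (intro nn_integral_mono) (auto simp: nn_integral_cmult intro!: mult_left_mono cols)
    also have "\<dots> = (\<Sum>\<^sup>+j\<in>J. f j) * A" by (simp add: nn_integral_multc)
    also have "\<dots> \<le> A" using mult_right_mono[OF that, of A] by simp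
    finally show ?thesis by (simp add: swap)
  qed
  consider "p \<le> ennreal s" | "p = \<infinity>" | "\<not> p \<le> ennreal s" "p \<noteq> \<infinity>" by auto
  then show ?thesis
  proof cases
    case 1
    then have fin: "p \<noteq> \<infinity>" by (auto simp: top_unique)
    note P = finite_exponent[OF assms(1) fin]
    have Ps: "enn2real p \<le> s" using 1 \<open>s > 0\<close> by (subst (asm) P(2)[symmetric]) (simp add: ennreal_le_iff)
    \<comment> \<open>A norm at most 1 forces every \<open>x i\<close> to be at most 1, so raising
      the exponent from p to s only decreases the power; \<open>y\<close> is bounded by 1 in the
      supremum norm.\<close>
    have xs: "enn_powr (x i) s \<le> enn_powr (x i) (enn2real p)" if "i \<in> I" for i
    proof -
      obtain a where a: "x i = ennreal a" "0 \<le> a" "a \<le> 1" using x1[OF \<open>i \<in> I\<close>] by (cases "x i") (auto simp: top_unique)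
      then have "a powr s \<le> a powr enn2real p" using Ps P(1) \<open>s > 0\<close> by (cases "a = 0") (auto intro!: powr_mono')
      then show ?thesis using a by (simp add: enn_powr_ennreal ennreal_leI)
    qed
    have "(\<Sum>\<^sup>+i\<in>I. enn_powr (x i) (enn2real p)) \<le> 1"
      using x by (simp add: Lp_norm_le_iff[OF assms(1) fin])
    from ibound[OF this] have *: "(\<Sum>\<^sup>+i\<in>I. (\<Sum>\<^sup>+j\<in>J. enn_powr (x i) (enn2real p) * K i j)) \<le> A" .
    have "(\<Sum>\<^sup>+i\<in>I. (\<Sum>\<^sup>+j\<in>J. enn_powr (x i) s * y j * K i j))
        \<le> (\<Sum>\<^sup>+i\<in>I. (\<Sum>\<^sup>+j\<in>J. enn_powr (x i) (enn2real p) * K i j))"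
      using mult_mono[OF xs y1] by (intro nn_integral_mono mult_right_mono) auto
    with * A2 show ?thesis by (meson order_trans)
  next
    case 2
    have "star_exp s p = 1" using 2 by (simp add: star_exp_def top_unique)
    then have "(\<Sum>\<^sup>+j\<in>J. y j) \<le> 1"
      using y by (simp add: Lp_norm_le_iff)
    from jbound[OF this] have *: "(\<Sum>\<^sup>+i\<in>I. (\<Sum>\<^sup>+j\<in>J. y j * K i j)) \<le> A" .
    have "(\<Sum>\<^sup>+i\<in>I. (\<Sum>\<^sup>+j\<in>J. enn_powr (x i) s * y j * K i j))
        \<le> (\<Sum>\<^sup>+i\<in>I. (\<Sum>\<^sup>+j\<in>J. y j * K i j))"
      using mult_right_mono[OF enn_powr_mono[OF x1, of _ s]] \<open>s > 0\<close>
      by (intro nn_integral_mono mult_right_mono) auto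
    with * A2 show ?thesis by (meson order_trans)
  next
    case 3
    \<comment> \<open>Here Young's inequality separates the two variables into a row part and a
      column part; only this case produces the factor 2.\<close>
    note st = star_exp_eq[OF assms(2) 3]
    have "(\<Sum>\<^sup>+i\<in>I. enn_powr (x i) (enn2real p)) \<le> 1"
      using x by (simp add: Lp_norm_le_iff[OF assms(1) 3(2)])
    note * = ibound[OF this]
    have "(\<Sum>\<^sup>+j\<in>J. enn_powr (y j) (enn2real p / (enn2real p - s))) \<le> 1"
      using y unfolding Lp_norm_le_iff[OF star_exp_pos[OF \<open>s > 0\<close>] st(3)] st(4) by simp
    note ** = jbound[OF this]
    have "(\<Sum>\<^sup>+i\<in>I. (\<Sum>\<^sup>+j\<in>J. enn_powr (x i) s * y j * K i j))
        \<le> (\<Sum>\<^sup>+i\<in>I. (\<Sum>\<^sup>+j\<in>J. enn_powr (x i) (enn2real p) * K i j +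
              enn_powr (y j) (enn2real p / (enn2real p - s)) * K i j))"
      using st \<open>s > 0\<close> by (intro nn_integral_mono) (auto simp: distrib_right[symmetric] intro!: mult_right_mono Young_enn)
    also have "\<dots> \<le> A + A"
      using add_mono[OF * **] by (simp add: nn_integral_add)
    finally show ?thesis by (simp add: mult_2)
  qed
qed

text \<open>The form has degree s in \<open>x\<close> and degree 1 in \<open>y\<close>, so both can
  be scaled to norm 1. If a norm vanishes, the left side is zero; if one is infinite and the other
  nonzero, \<open>A \<noteq> 0\<close> makes the right side \<open>top\<close>, whereas 0 * top
  would be 0.\<close>

lemma Schur_bound:
  fixes x :: "'i \<Rightarrow> ennreal" and y :: "'j \<Rightarrow> ennreal"
  assumes "p > 0" "s > 0" "countable I" "countable J" "A \<noteq> 0"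
    and rows: "\<And>i. i \<in> I \<Longrightarrow> (\<Sum>\<^sup>+j\<in>J. K i j) \<le> A"
    and cols: "\<And>j. j \<in> J \<Longrightarrow> (\<Sum>\<^sup>+i\<in>I. K i j) \<le> A"
  shows "(\<Sum>\<^sup>+i\<in>I. (\<Sum>\<^sup>+j\<in>J. enn_powr (x i) s * y j * K i j))
     \<le> 2 * A * enn_powr (Lp_norm (count_space I) p x) s * Lp_norm (count_space J) (star_exp s p) y"
    (is "?L \<le> 2 * A * enn_powr ?X s * ?Y")
proof -
  note pos = \<open>p > 0\<close> star_exp_pos[OF \<open>s > 0\<close>, of p]
  consider "?X = 0" | "?Y = 0" | "?X \<noteq> 0" "?Y \<noteq> 0" "?X = top \<or> ?Y = top"
    | "?X \<noteq> 0" "?Y \<noteq> 0" "?X \<noteq> top" "?Y \<noteq> top" by blast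
  then show ?thesis
  proof cases
    case 1
    then have "?L = (\<Sum>\<^sup>+i\<in>I. (\<Sum>\<^sup>+j\<in>J. 0))"
      using lp_norm_eq_0[OF pos(1) 1] by (intro nn_integral_cong) auto
    then show ?thesis by simp
  next
    case 2
    then have "?L = (\<Sum>\<^sup>+i\<in>I. (\<Sum>\<^sup>+j\<in>J. 0))"
      using lp_norm_eq_0[OF pos(2) 2] by (intro nn_integral_cong) auto
    then show ?thesis by simp
  next
    case 3
    then show ?thesis using \<open>A \<noteq> 0\<close> by (auto simp: ennreal_mult_top ennreal_top_mult)
  next
    case 4
    define x' where "x' i = inverse ?X * x i" for i
    define y' where "y' i = inverse ?Y * y i" for i
    have inv: "?X * inverse ?X = 1" "?Y * inverse ?Y = 1"
      using 4 by (auto simp: less_top divide_ennreal_def[symmetric] ennreal_divide_self)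
    have "Lp_norm (count_space I) p x' \<le> 1" "Lp_norm (count_space J) (star_exp s p) y' \<le> 1"
      using inv unfolding x'_def y'_def lp_norm_cmult[OF pos(1)] lp_norm_cmult[OF pos(2)]
      by (metis mult.commute order_refl)+
    note N = Schur_normalised[OF assms(1-4) rows cols this]
    have x: "x i = ?X * x' i" and y: "y j = ?Y * y' j" for i j
      unfolding x'_def y'_def mult.assoc[symmetric] inv by (rule mult_1[symmetric])+
    have "?L = (\<Sum>\<^sup>+i\<in>I. (\<Sum>\<^sup>+j\<in>J. (enn_powr ?X s * ?Y) * (enn_powr (x' i) s * y' j * K i j)))"
    proof (intro nn_integral_cong)
      fix i j
      have "enn_powr (x i) s * y j = (enn_powr ?X s * enn_powr (x' i) s) * (?Y * y' j)"
        using x[of i] y[of j] enn_powr_mult[OF \<open>s > 0\<close>, of ?X "x' i"] by metis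
      then show "enn_powr (x i) s * y j * K i j = (enn_powr ?X s * ?Y) * (enn_powr (x' i) s * y' j * K i j)"
        by (simp only: mult_ac)
    qed
    also have "\<dots> = (enn_powr ?X s * ?Y) * (\<Sum>\<^sup>+i\<in>I. (\<Sum>\<^sup>+j\<in>J. (enn_powr (x' i) s * y' j * K i j)))"
      by (simp add: nn_integral_cmult)
    also have "\<dots> \<le> (enn_powr ?X s * ?Y) * (2 * A)"
      by (rule mult_left_mono[OF N]) auto
    finally show ?thesis by (simp add: mult_ac)
  qed
qed

text \<open>The converse of Hoelder's inequality for the pairing of \<open>X powr s\<close> with
  \<open>Y\<close>, by an explicit extremiser: the unit mass at a maximum of \<open>Y\<close> for p
  \<le> s, the constant 1 for p = \<infinity>, and a power of \<open>Y\<close> otherwise. On a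
  finite set the maximum exists and all sums are real.\<close>

lemma finite_duality:
  fixes Y :: "'i \<Rightarrow> real"
  assumes "p > 0" "s > 0" "finite F" "\<And>i. i \<in> F \<Longrightarrow> 0 \<le> Y i"
  shows "\<exists>X. (\<forall>i. 0 \<le> X i) \<and> Lp_norm (count_space F) p (\<lambda>i. ennreal (X i)) \<le> 1 \<and>
    Lp_norm (count_space F) (star_exp s p) (\<lambda>i. ennreal (Y i)) \<le> ennreal (\<Sum>i\<in>F. X i powr s * Y i)"
proof (cases "\<forall>i\<in>F. Y i = 0")
  case True
  have "Lp_norm (count_space F) q (\<lambda>i. ennreal (Y i)) \<le> 0" if "q > 0" for q
    using lp_norm_cmult[OF that, of F 0 "\<lambda>i. 1"] True by (subst lp_norm_cong[of _ _ "\<lambda>i. 0 * 1"]) auto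
  moreover have "Lp_norm (count_space F) p (\<lambda>i. ennreal 0) \<le> 1"
    using lp_norm_cmult[OF \<open>p > 0\<close>, of F 0 "\<lambda>i. 1"] by simp
  ultimately show ?thesis using star_exp_pos[OF \<open>s > 0\<close>, of p]
    by (intro exI[of _ "\<lambda>_. 0"]) (auto intro: order_trans)
next
  case False
  then obtain i1 where i1: "i1 \<in> F" "Y i1 > 0" using assms(4) by force
  consider "p \<le> ennreal s" | "p = \<infinity>" | "\<not> p \<le> ennreal s" "p \<noteq> \<infinity>" by auto
  then show ?thesis
  proof cases
    case 1
    then have st: "star_exp s p = \<infinity>" and fin: "p \<noteq> \<infinity>" by (auto simp: star_exp_def top_unique)
    have "Max (Y ` F) \<in> Y ` F" using i1(1) assms(3) by (intro Max_in) auto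
    then obtain i0 where i0: "i0 \<in> F" "Y i0 = Max (Y ` F)" by auto
    have i0': "Y i \<le> Y i0" if "i \<in> F" for i using that i0(2) assms(3) by simp
    define X :: "'i \<Rightarrow> real" where "X i = (if i = i0 then 1 else 0)" for i
    have *: "(\<Sum>i\<in>F. X i powr s * Y i) = Y i0"
      using i0(1) assms(3) by (simp add: X_def if_distrib[of "\<lambda>x. x powr s"] if_distrib[of "\<lambda>x. x * _"] cong: if_cong)
    have "(\<Sum>\<^sup>+i\<in>F. enn_powr (ennreal (X i)) (enn2real p)) =
       (\<Sum>i\<in>F. if i = i0 then 1 else 0)"
      by (subst nn_integral_count_space_finite[OF assms(3)]) (auto intro!: sum.cong simp: X_def)
    also have "\<dots> = 1" using i0(1) assms(3) by simp
    finally show ?thesis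
      using i0(1) i0' * by (intro exI[of _ X])
         (auto simp: X_def st lp_norm_top Lp_norm_le_iff[OF assms(1) fin] ennreal_leI intro!: SUP_least)
  next
    case 2
    have "star_exp s p = 1" using 2 by (simp add: star_exp_def top_unique)
    then show ?thesis using assms(3,4) 2
      by (intro exI[of _ "\<lambda>_. 1"]) (auto simp: lp_norm_top Lp_norm_le_iff nn_integral_count_space_finite intro!: SUP_least)
  next
    case 3
    note st = star_exp_eq[OF assms(2) 3] and P = finite_exponent[OF assms(1) 3(2)]
    define r where "r = enn2real p"
    \<comment> \<open>The conjugate exponent of r / s; \<open>N\<close> will be the norm of
      \<open>Y\<close> in that exponent.\<close>
    define t where "t = r / (r - s)"
    have r: "0 < s" "s < r" "1 < t" using st assms(2) by (auto simp: r_def t_def)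
    define S where "S = (\<Sum>i\<in>F. Y i powr t)"
    have "Y i1 powr t \<le> S" unfolding S_def using assms(3) i1 by (intro member_le_sum) auto
    then have S: "S > 0" using i1 r by (smt (verit) powr_gt_zero)
    define N where "N = S powr (1 / t)"
    have N: "N > 0" "N powr t = S" using S r by (auto simp: N_def powr_powr)
    \<comment> \<open>The exponent t / r makes \<open>X powr r\<close> proportional to
      \<open>Y powr t\<close>, and \<open>X powr s * Y\<close> as well, because t * s / r + 1 =
      t.\<close>
    define X where "X i = (Y i / N) powr (t / r)" for i
    have 1: "(\<Sum>i\<in>F. X i powr r) = 1"
    proof -
      have "(\<Sum>i\<in>F. X i powr r) = (\<Sum>i\<in>F. Y i powr t / S)"
        using r N assms(4) by (intro sum.cong) (auto simp: X_def powr_powr powr_divide)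
      also have "\<dots> = 1" using S by (simp add: sum_divide_distrib[symmetric] S_def[symmetric])
      finally show ?thesis .
    qed
    have 2: "(\<Sum>i\<in>F. X i powr s * Y i) = N"
    proof -
      have e: "t / r * s + 1 = t" using r by (simp add: t_def field_simps)
      have "(\<Sum>i\<in>F. X i powr s * Y i) = (\<Sum>i\<in>F. N * (Y i powr t / S))"
      proof (intro sum.cong refl)
        fix i assume "i \<in> F"
        then have Y: "Y i \<ge> 0" using assms(4) by auto
        show "X i powr s * Y i = N * (Y i powr t / S)"
        proof (cases "Y i = 0")
          case False
          have "X i powr s * Y i = N * ((Y i / N) powr (t / r * s) * (Y i / N) powr 1)"
            using Y N by (simp add: X_def powr_powr)
          also have "\<dots> = N * (Y i / N) powr t" by (simp only: powr_add[symmetric] e)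
          finally show ?thesis using Y N by (simp add: powr_divide)
        qed simp
      qed
      also have "\<dots> = N" using S by (simp add: sum_divide_distrib[symmetric] sum_distrib_left[symmetric] S_def[symmetric])
      finally show ?thesis .
    qed
    have "Lp_norm (count_space F) p (\<lambda>i. ennreal (X i)) \<le> 1"
      using 1 by (simp add: Lp_norm_le_iff[OF assms(1) 3(2)] nn_integral_count_space_finite assms(3)
         enn_powr_ennreal X_def r_def[symmetric])
    moreover have "Lp_norm (count_space F) (star_exp s p) (\<lambda>i. ennreal (Y i)) \<le> ennreal N"
    proof -
      have "(\<Sum>\<^sup>+i\<in>F. enn_powr (ennreal (Y i)) t) = ennreal (\<Sum>i\<in>F. Y i powr t)"
        using assms(4) by (subst nn_integral_count_space_finite[OF assms(3)])
           (simp add: enn_powr_ennreal)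
      also have "\<dots> = enn_powr (ennreal N) t" using N by (simp add: enn_powr_ennreal S_def)
      finally show ?thesis
        unfolding Lp_norm_le_iff[OF star_exp_pos[OF assms(2)] st(3)] st(4) r_def[symmetric] t_def[symmetric]
        by (simp only: order_refl)
    qed
    ultimately show ?thesis using 2 by (intro exI[of _ X]) (auto simp: X_def)
  qed
qed

section \<open>Restriction of supports and mixed norms over blocks\<close>

lemma lp_norm_restrict:
  assumes "p > 0" "J \<subseteq> I" "\<And>i. i \<in> I - J \<Longrightarrow> f i = 0"
  shows "Lp_norm (count_space I) p f = Lp_norm (count_space J) p f"
proof (cases "p = \<infinity>")
  case True
  have "(SUP i\<in>I. f i) = (SUP i\<in>J. f i)"
  proof (rule antisym)
    show "(SUP i\<in>I. f i) \<le> (SUP i\<in>J. f i)"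
      using assms(3) by (intro SUP_least) (metis DiffI SUP_upper zero_le)
    show "(SUP i\<in>J. f i) \<le> (SUP i\<in>I. f i)"
      using assms(2) by (rule SUP_subset_mono) auto
  qed
  then show ?thesis using True by (simp add: lp_norm_top)
next
  case False
  have "(\<Sum>\<^sup>+x\<in>I. enn_powr (f x) (enn2real p)) = (\<Sum>\<^sup>+x\<in>J. enn_powr (f x) (enn2real p))"
    using assms by (intro nn_integral_count_space_eq) auto
  then show ?thesis using False by (simp add: Lp_norm_def)
qed

lemma lp_norm_zero: "p > 0 \<Longrightarrow> (\<And>i. i \<in> I \<Longrightarrow> f i = 0) \<Longrightarrow> Lp_norm (count_space I) p f = 0"
  using lp_norm_cmult[of p I 0 "\<lambda>_. 1"] lp_norm_cong[of I f "\<lambda>_. 0 * 1" p] by simp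

lemma lp_norm_singleton: "p > 0 \<Longrightarrow> Lp_norm (count_space {i}) p f = f i"
proof (cases "p = \<infinity>")
  case False
  assume "p > 0"
  note P = finite_exponent[OF this False]
  then show ?thesis using False
    by (simp add: Lp_norm_def nn_integral_count_space_finite enn_powr_inverse)
qed (simp add: lp_norm_top)

lemma lp_norm_single:
  assumes "p > 0" "i \<in> I"
  shows "Lp_norm (count_space I) p (\<lambda>j. if j = i then c else 0) = c"
  using assms lp_norm_restrict[of p "{i}" I "\<lambda>j. if j = i then c else 0"]
  by (simp add: lp_norm_singleton)

text \<open>The blocks are abstract, so that one notion serves the weighted coefficient norm as well
  as the shell norm with starred exponents.\<close>

definition mix_norm :: "(nat \<Rightarrow> 'i set) \<Rightarrow> ennreal \<Rightarrow> ennreal \<Rightarrow> ('i \<Rightarrow> ennreal) \<Rightarrow> ennreal" where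
  "mix_norm S a b c = Lp_norm (count_space UNIV) b (\<lambda>k. Lp_norm (count_space (S k)) a c)"

lemma mix_norm_mono:
  assumes "a > 0" "b > 0" "\<And>k i. i \<in> S k \<Longrightarrow> f i \<le> g i"
  shows "mix_norm S a b f \<le> mix_norm S a b g"
  unfolding mix_norm_def using assms by (intro lp_norm_mono) auto

lemma mix_norm_cmult:
  assumes "a > 0" "b > 0"
  shows "mix_norm S a b (\<lambda>i. c * f i) = c * mix_norm S a b f"
  unfolding mix_norm_def using assms by (simp add: lp_norm_cmult)

text \<open>The one-index test is applied twice: inside a pair of blocks, where \<open>B k l\<close>
  bounds rows and columns, and then to \<open>B\<close> itself as a kernel between blocks. Each use
  costs a factor 2.\<close>

lemma mixed_Schur:
  fixes x y :: "'i \<Rightarrow> ennreal"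
  assumes "p > 0" "q > 0" "s > 0" "\<And>k. countable (S k)" "A \<noteq> 0" "\<And>k l. B k l \<noteq> 0"
    and rows: "\<And>k l i. i \<in> S k \<Longrightarrow> (\<Sum>\<^sup>+j\<in>S l. K i j) \<le> B k l"
    and cols: "\<And>k l j. j \<in> S l \<Longrightarrow> (\<Sum>\<^sup>+i\<in>S k. K i j) \<le> B k l"
    and Brows: "\<And>k. (\<Sum>\<^sup>+l\<in>UNIV. B k l) \<le> A"
    and Bcols: "\<And>l. (\<Sum>\<^sup>+k\<in>UNIV. B k l) \<le> A"
  shows "(\<Sum>\<^sup>+k\<in>UNIV. (\<Sum>\<^sup>+l\<in>UNIV. (\<Sum>\<^sup>+i\<in>S k. (\<Sum>\<^sup>+j\<in>S l. enn_powr (x i) s * y j * K i j))))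
     \<le> 4 * A * enn_powr (mix_norm S p q x) s * mix_norm S (star_exp s p) (star_exp s q) y" (is "?L \<le> _")
proof -
  define X where "X = (\<lambda>k. Lp_norm (count_space (S k)) p x)"
  define Y where "Y = (\<lambda>l. Lp_norm (count_space (S l)) (star_exp s p) y)"
  have "?L \<le> (\<Sum>\<^sup>+k\<in>UNIV. (\<Sum>\<^sup>+l\<in>UNIV. 2 * (enn_powr (X k) s * Y l * B k l)))"
  proof (intro nn_integral_mono)
    fix k l
    show "(\<Sum>\<^sup>+i\<in>S k. (\<Sum>\<^sup>+j\<in>S l. enn_powr (x i) s * y j * K i j))
       \<le> 2 * (enn_powr (X k) s * Y l * B k l)"
      using Schur_bound[OF assms(1,3,4,4,6) rows cols, of k l x y]
      by (simp add: X_def Y_def mult_ac)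
  qed
  also have "\<dots> = 2 * (\<Sum>\<^sup>+k\<in>UNIV. (\<Sum>\<^sup>+l\<in>UNIV. enn_powr (X k) s * Y l * B k l))"
    by (simp add: nn_integral_cmult)
  also have "\<dots> \<le> 2 * (2 * A * enn_powr (Lp_norm (count_space UNIV) q X) s *
      Lp_norm (count_space UNIV) (star_exp s q) Y)"
    using assms by (intro mult_left_mono Schur_bound) auto
  also have "\<dots> = 4 * A * enn_powr (mix_norm S p q x) s * mix_norm S (star_exp s p) (star_exp s q) y"
    by (simp add: mix_norm_def X_def Y_def mult.assoc[symmetric])
  finally show ?thesis .
qed

text \<open>Reduces a dual norm to pairings with finitely supported sequences. The test sequence is
  a product: an extremiser inside each block, times an extremiser for the sequence of block
  norms.\<close>

lemma mixed_dual_bound: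
  fixes y :: "'i \<Rightarrow> ennreal"
  assumes "p > 0" "q > 0" "s > 0" and fin: "\<And>k. finite (S k)" and disj: "disjoint_family S"
    and bound: "\<And>n X. (\<And>i. 0 \<le> X i) \<Longrightarrow> (\<And>i. i \<notin> (\<Union>k<n. S k) \<Longrightarrow> X i = 0) \<Longrightarrow>
        mix_norm S p q (\<lambda>i. ennreal (X i)) \<le> 1 \<Longrightarrow>
        (\<Sum>i\<in>(\<Union>k<n. S k). ennreal (X i powr s) * y i) \<le> B"
  shows "mix_norm S (star_exp s p) (star_exp s q) y \<le> B"
proof (cases "B = top")
  case False
  have uniq: "k = l" if "i \<in> S k" "i \<in> S l" for i k l
    using disj that by (auto simp: disjoint_family_on_def)
  \<comment> \<open>Testing with a unit mass bounds each \<open>y i\<close> by the finite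
    \<open>B\<close>, so that \<open>y\<close> may be treated as real in the finite duality.\<close>
  have yfin: "y i < top" if "i \<in> S k" for i k
  proof -
    define X :: "'i \<Rightarrow> real" where "X j = (if j = i then 1 else 0)" for j
    have e: "(\<lambda>j. ennreal (X j)) = (\<lambda>j. if j = i then 1 else 0)" by (auto simp: X_def)
    have "Lp_norm (count_space (S l)) p (\<lambda>j. ennreal (X j)) = (if l = k then 1 else 0)" for l
    proof (cases "l = k")
      case True
      then show ?thesis using that by (simp add: e lp_norm_single assms(1))
    next
      case False
      then have "i \<notin> S l" using uniq[OF that] by blast
      then have "Lp_norm (count_space (S l)) p (\<lambda>j. ennreal (X j)) = 0"
        by (intro lp_norm_zero assms(1)) (auto simp: X_def)
      then show ?thesis using False by simp
    qed
    then have "mix_norm S p q (\<lambda>j. ennreal (X j)) = 1"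
      by (simp add: mix_norm_def lp_norm_single assms(2))
    then have "(\<Sum>j\<in>(\<Union>k<Suc k. S k). ennreal (X j powr s) * y j) \<le> B"
      using that by (intro bound) (auto simp: X_def)
    moreover have "ennreal (X i powr s) * y i \<le> (\<Sum>j\<in>(\<Union>k<Suc k. S k). ennreal (X j powr s) * y j)"
      using that fin by (intro member_le_sum) auto
    ultimately show ?thesis using False by (auto simp: X_def less_top[symmetric] top_unique)
  qed
  define Y where "Y i = enn2real (y i)" for i
  have Y0: "0 \<le> Y i" for i by (simp add: Y_def)
  have yY: "y i = ennreal (Y i)" if "i \<in> S k" for i k
    using yfin[OF that] by (simp add: Y_def)
  define N where "N k = Lp_norm (count_space (S k)) (star_exp s p) y" for k
  have "\<exists>X. (\<forall>i. 0 \<le> X i) \<and> Lp_norm (count_space (S k)) p (\<lambda>i. ennreal (X i)) \<le> 1 \<and>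
      N k \<le> ennreal (\<Sum>i\<in>S k. X i powr s * Y i)" for k
    using finite_duality[OF assms(1,3) fin, of k Y] lp_norm_cong[of "S k" y "\<lambda>i. ennreal (Y i)", OF yY]
    by (auto simp: N_def Y_def)
  then obtain X where X: "\<And>k i. 0 \<le> X k i" "\<And>k. Lp_norm (count_space (S k)) p (\<lambda>i. ennreal (X k i)) \<le> 1"
      "\<And>k. N k \<le> ennreal (\<Sum>i\<in>S k. X k i powr s * Y i)" by metis
  have Nfin: "ennreal (enn2real (N k)) = N k" for k
    using X(3)[of k] by (simp add: le_less_trans)
  show ?thesis unfolding mix_norm_def N_def[symmetric]
  proof (rule lp_norm_nat_le[OF star_exp_pos[OF assms(3)]])
    fix n
    obtain Z where Z: "\<And>k. 0 \<le> Z k" "Lp_norm (count_space {..<n}) q (\<lambda>k. ennreal (Z k)) \<le> 1"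
      "Lp_norm (count_space {..<n}) (star_exp s q) N \<le> ennreal (\<Sum>k<n. Z k powr s * enn2real (N k))"
      using finite_duality[OF assms(2,3), of "{..<n}" "\<lambda>k. enn2real (N k)"] unfolding Nfin by auto
    \<comment> \<open>Disjointness makes the block of an index unique, so the block extremisers glue
      to one function \<open>V\<close>.\<close>
    define \<kappa> where "\<kappa> i = (SOME k. i \<in> S k)" for i
    have \<kappa>: "\<kappa> i = k" if "i \<in> S k" for i k
      unfolding \<kappa>_def using that uniq by (metis someI_ex)
    define V where "V i = (if i \<in> (\<Union>k<n. S k) then Z (\<kappa> i) * X (\<kappa> i) i else 0)" for i
    have V: "V i = (if k < n then Z k * X k i else 0)" if "i \<in> S k" for i k
      using that uniq by (auto simp: V_def \<kappa>[OF that])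
    have "Lp_norm (count_space (S k)) p (\<lambda>i. ennreal (V i)) \<le> (if k < n then ennreal (Z k) else 0)" for k
    proof (cases "k < n")
      case True
      have "Lp_norm (count_space (S k)) p (\<lambda>i. ennreal (V i)) =
         Lp_norm (count_space (S k)) p (\<lambda>i. ennreal (Z k) * ennreal (X k i))"
        using True Z X by (intro lp_norm_cong) (simp add: V ennreal_mult)
      also have "\<dots> \<le> ennreal (Z k) * 1"
        using mult_left_mono[OF X(2)[of k], of "ennreal (Z k)"] by (simp add: lp_norm_cmult assms(1))
      finally show ?thesis using True by simp
    qed (auto simp: V intro!: lp_norm_zero assms(1))
    then have "mix_norm S p q (\<lambda>i. ennreal (V i)) \<le>
        Lp_norm (count_space UNIV) q (\<lambda>k. if k < n then ennreal (Z k) else 0)"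
      unfolding mix_norm_def by (intro lp_norm_mono assms(2))
    also have "\<dots> = Lp_norm (count_space {..<n}) q (\<lambda>k. if k < n then ennreal (Z k) else 0)"
      by (intro lp_norm_restrict assms(2)) auto
    also have "\<dots> = Lp_norm (count_space {..<n}) q (\<lambda>k. ennreal (Z k))"
      by (intro lp_norm_cong) auto
    finally have "mix_norm S p q (\<lambda>i. ennreal (V i)) \<le> 1" using Z(2) by simp
    then have B: "(\<Sum>i\<in>(\<Union>k<n. S k). ennreal (V i powr s) * y i) \<le> B"
      using Z X by (intro bound) (auto simp: V_def)
    have "ennreal (\<Sum>k<n. Z k powr s * enn2real (N k)) = (\<Sum>k<n. ennreal (Z k powr s) * N k)"
      by (simp add: sum_ennreal[symmetric] ennreal_mult Nfin del: sum_ennreal)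
    also have "\<dots> \<le> (\<Sum>k<n. \<Sum>i\<in>S k. ennreal (V i powr s) * y i)"
    proof (rule sum_mono)
      fix k assume "k \<in> {..<n}"
      have "ennreal (Z k powr s) * N k \<le> ennreal (Z k powr s) * ennreal (\<Sum>i\<in>S k. X k i powr s * Y i)"
        by (intro mult_left_mono X(3)) auto
      also have "\<dots> = (\<Sum>i\<in>S k. ennreal (Z k powr s) * ennreal (X k i powr s * Y i))"
        by (simp add: sum_distrib_left Y_def sum_ennreal[symmetric] del: sum_ennreal)
      also have "\<dots> = (\<Sum>i\<in>S k. ennreal (V i powr s) * y i)"
        using \<open>k \<in> {..<n}\<close> Z X
        by (intro sum.cong refl) (simp add: V[where k=k] yY[where k=k] Y0 powr_mult ennreal_mult mult_ac)
      finally show "ennreal (Z k powr s) * N k \<le> (\<Sum>i\<in>S k. ennreal (V i powr s) * y i)" .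
    qed
    also have "\<dots> = (\<Sum>i\<in>(\<Union>k<n. S k). ennreal (V i powr s) * y i)"
      using fin uniq by (intro sum.UNION_disjoint[symmetric]) auto
    finally show "Lp_norm (count_space {..<n}) (star_exp s q) N \<le> B" using Z(3) B by (meson order_trans)
  qed
qed simp

subsection \<open>Pocket geometry\<close>

text \<open>A discrete intermediate value argument; it finds the radial and the angular index of a
  point.\<close>

lemma ex_bracket:
  fixes f :: "nat \<Rightarrow> real"
  assumes "f 0 \<le> x" "x < f N"
  shows "\<exists>n<N. f n \<le> x \<and> x < f (n + 1)"
  using assms
proof (induction N)
  case (Suc N)
  then show ?case by (cases "x < f N") (auto simp: less_Suc_eq)
qed simp

lemma bracket_unique:
  fixes f :: "nat \<Rightarrow> real"
  assumes "mono f" "f m \<le> x" "x < f (m + 1)" "f n \<le> x" "x < f (n + 1)"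
  shows "m = n"
proof -
  have "m \<le> n" if "f m \<le> x" "x < f (n + 1)" for m n
    using that monoD[OF assms(1), of "n + 1" m] by (cases "m \<le> n") auto
  then show ?thesis using assms by (metis antisym)
qed

section \<open>The pockets partition every shell\<close>

locale tiling =
  fixes \<delta> :: real
  assumes \<delta>: "0 < \<delta>" "\<delta> \<le> 1 / 2"
begin

lemma Ndelta_pos: "0 < Ndelta \<delta>"
  using \<delta> by (simp add: Ndelta_def)

lemma Nang_pos: "0 < Nang \<delta> k \<nu>"
  using Ndelta_pos by (simp add: Nang_def)

lemma rad_nonneg: "0 \<le> rad \<delta> k \<nu>"
  by (simp add: rad_def)

lemma rad_less: "rad \<delta> k \<nu> < rad \<delta> k (\<nu> + 1)"
  using Ndelta_pos by (auto simp: rad_def divide_strict_right_mono intro!: mult_strict_right_mono)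

lemma rad_mono: "mono (rad \<delta> k)"
  using rad_less[of k] by (simp add: mono_iff_le_Suc less_imp_le)

lemma rad_0: "rad \<delta> k 0 = real k"
  by (simp add: rad_def)

lemma rad_Ndelta: "rad \<delta> k (Ndelta \<delta>) = real k + 1"
proof -
  have "(real k)\<^sup>2 + (2 * real k + 1) = (real k + 1)\<^sup>2" by (simp add: power2_eq_square algebra_simps)
  then show ?thesis using Ndelta_pos by (simp add: rad_def)
qed

lemma ang_less: "ang \<delta> k \<nu> m < ang \<delta> k \<nu> (m + 1)"
  using Nang_pos[of k \<nu>] by (simp add: ang_def divide_strict_right_mono)

lemma ang_mono: "mono (ang \<delta> k \<nu>)"
  using ang_less[of k \<nu>] by (simp add: mono_iff_le_Suc less_imp_le)

lemma ang_0: "ang \<delta> k \<nu> 0 = 0"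
  by (simp add: ang_def)

lemma ang_Nang: "ang \<delta> k \<nu> (Nang \<delta> k \<nu>) = 2 * pi"
  using Nang_pos[of k \<nu>] by (simp add: ang_def)

lemma pocketI:
  assumes "rad \<delta> k \<nu> \<le> norm z" "norm z < rad \<delta> k (\<nu> + 1)"
    "ang \<delta> k \<nu> m \<le> Arg2pi z" "Arg2pi z < ang \<delta> k \<nu> (m + 1)"
  shows "z \<in> pocket \<delta> (k, \<nu>, m)"
proof -
  have "z = of_real (norm z) * cis (Arg2pi z)" using Arg2pi_eq[of z] by (simp add: cis_conv_exp mult.commute)
  then show ?thesis unfolding pocket.simps using assms by blast
qed

text \<open>Membership becomes a set of interval conditions on \<open>norm z\<close> and
  \<open>Arg2pi z\<close>: the angle in the definition lies in [0, 2 pi), so off the origin it is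
  \<open>Arg2pi z\<close>.\<close>

lemma pocketD:
  assumes "z \<in> pocket \<delta> (k, \<nu>, m)" "\<nu> < Ndelta \<delta>" "m < Nang \<delta> k \<nu>"
  shows "rad \<delta> k \<nu> \<le> norm z" "norm z < rad \<delta> k (\<nu> + 1)"
    "ang \<delta> k \<nu> m \<le> Arg2pi z" "Arg2pi z < ang \<delta> k \<nu> (m + 1)" "real k \<le> norm z" "norm z < real k + 1"
proof -
  obtain r \<theta> where z: "z = of_real r * cis \<theta>" and r: "rad \<delta> k \<nu> \<le> r" "r < rad \<delta> k (\<nu> + 1)"
    and \<theta>: "ang \<delta> k \<nu> m \<le> \<theta>" "\<theta> < ang \<delta> k \<nu> (m + 1)" using assms(1) by auto
  have "0 \<le> r" using r rad_nonneg by (meson order_trans)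
  then have norm: "norm z = r" by (simp add: z norm_mult)
  then show "rad \<delta> k \<nu> \<le> norm z" "norm z < rad \<delta> k (\<nu> + 1)" using r by auto
  show "real k \<le> norm z" using monoD[OF rad_mono, of 0 \<nu> k] r norm by (simp add: rad_0)
  show "norm z < real k + 1" using monoD[OF rad_mono, of "\<nu> + 1" "Ndelta \<delta>" k] assms(2) r norm by (simp add: rad_Ndelta)
  have "0 \<le> \<theta>" using \<theta>(1) monoD[OF ang_mono, of 0 m k \<nu>] by (simp add: ang_0)
  have "\<theta> < 2 * pi" using \<theta>(2) monoD[OF ang_mono, of "m + 1" "Nang \<delta> k \<nu>" k \<nu>] assms(3) by (simp add: ang_Nang)
  have "ang \<delta> k \<nu> m \<le> Arg2pi z \<and> Arg2pi z < ang \<delta> k \<nu> (m + 1)"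
  proof (cases "r = 0")
    \<comment> \<open>At the origin the angle is undetermined, but the only admissible pocket there
      has k = \<nu> = 0 and a single sector, and \<open>Arg2pi 0 = 0\<close> lies in it.\<close>
    case True
    then have "k = 0" using \<open>real k \<le> norm z\<close> norm by simp
    then have "\<nu> = 0" using True r(1) Ndelta_pos by (simp add: rad_def divide_le_0_iff)
    then have "m = 0" using assms(3) \<open>k = 0\<close> by (simp add: Nang_def)
    then show ?thesis using \<open>k = 0\<close> \<open>\<nu> = 0\<close> by (simp add: True z ang_def Nang_def Arg2pi_def)
  next
    case False
    then have "Arg2pi z = \<theta>" using \<open>0 \<le> r\<close> \<open>0 \<le> \<theta>\<close> \<open>\<theta> < 2 * pi\<close>
      by (intro Arg2pi_unique[of r]) (auto simp: z cis_conv_exp mult.commute)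
    then show ?thesis using \<theta> by simp
  qed
  then show "ang \<delta> k \<nu> m \<le> Arg2pi z" "Arg2pi z < ang \<delta> k \<nu> (m + 1)" by auto
qed

lemma center_in_pocket: "center \<delta> Q \<in> pocket \<delta> Q"
proof (cases Q)
  case (fields k \<nu> m)
  have "\<exists>r \<theta>. center \<delta> Q = of_real r * cis \<theta> \<and> rad \<delta> k \<nu> \<le> r \<and> r < rad \<delta> k (\<nu> + 1) \<and>
      ang \<delta> k \<nu> m \<le> \<theta> \<and> \<theta> < ang \<delta> k \<nu> (m + 1)"
    unfolding fields center.simps using rad_less[of k \<nu>] ang_less[of k \<nu> m]
    by (intro exI[of _ "(rad \<delta> k \<nu> + rad \<delta> k (\<nu> + 1)) / 2"] exI[of _ "(ang \<delta> k \<nu> m + ang \<delta> k \<nu> (m + 1)) / 2"]) auto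
  then show ?thesis unfolding fields pocket.simps by blast
qed

text \<open>Containment in a shell turns into a condition on the index: the centre lies in its own
  pocket, and the shells are disjoint.\<close>

lemma shell_pockets_eq: "shell_pockets \<delta> k = {Q \<in> pockets \<delta>. fst Q = k}"
proof (intro set_eqI iffI)
  fix Q assume Q: "Q \<in> shell_pockets \<delta> k"
  obtain l \<nu> m where e: "Q = (l, \<nu>, m)" by (cases Q)
  have v: "\<nu> < Ndelta \<delta>" "m < Nang \<delta> l \<nu>" "Q \<in> pockets \<delta>" using Q e by (auto simp: shell_pockets_def pockets_def)
  have "center \<delta> Q \<in> annulus k" using Q center_in_pocket[of Q] unfolding shell_pockets_def by blast
  moreover have "real l \<le> norm (center \<delta> Q)" "norm (center \<delta> Q) < real l + 1"
    using pocketD[of "center \<delta> Q" l \<nu> m] center_in_pocket[of Q] v e by auto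
  ultimately have "l = k" by (auto simp: annulus_def simp del: center.simps)
  then show "Q \<in> {Q \<in> pockets \<delta>. fst Q = k}" using v e by auto
next
  fix Q assume "Q \<in> {Q \<in> pockets \<delta>. fst Q = k}"
  then show "Q \<in> shell_pockets \<delta> k"
    using pocketD(5,6) by (cases Q) (auto simp: shell_pockets_def pockets_def annulus_def simp del: pocket.simps)
qed

lemma finite_shell: "finite (shell_pockets \<delta> k)"
proof -
  have "shell_pockets \<delta> k \<subseteq> Sigma {k} (\<lambda>_. Sigma {..<Ndelta \<delta>} (\<lambda>\<nu>. {..<Nang \<delta> k \<nu>}))"
    by (auto simp: shell_pockets_eq pockets_def)
  then show ?thesis by (rule finite_subset) auto
qed

lemma Union_shell: "(\<Union>k. shell_pockets \<delta> k) = pockets \<delta>"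
  by (auto simp: shell_pockets_eq)

lemma disjoint_shell: "disjoint_family (shell_pockets \<delta>)"
  by (auto simp: shell_pockets_eq disjoint_family_on_def)

lemma pocket_annulus: "Q \<in> shell_pockets \<delta> k \<Longrightarrow> z \<in> pocket \<delta> Q \<Longrightarrow> z \<in> annulus k"
  by (auto simp: shell_pockets_def)

text \<open>The norm of a common point determines k and then \<nu>, and its argument determines
  m.\<close>

lemma disjoint_pockets: "disjoint_family_on (pocket \<delta>) (pockets \<delta>)"
proof (unfold disjoint_family_on_def, intro ballI impI)
  fix Q Q' assume Q: "Q \<in> pockets \<delta>" "Q' \<in> pockets \<delta>" "Q \<noteq> Q'"
  obtain k \<nu> m where e: "Q = (k, \<nu>, m)" by (cases Q)
  obtain k' \<nu>' m' where e': "Q' = (k', \<nu>', m')" by (cases Q')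
  show "pocket \<delta> Q \<inter> pocket \<delta> Q' = {}"
  proof (rule ccontr)
    assume "pocket \<delta> Q \<inter> pocket \<delta> Q' \<noteq> {}"
    then obtain z where "z \<in> pocket \<delta> Q" "z \<in> pocket \<delta> Q'" by auto
    then have z: "z \<in> pocket \<delta> (k, \<nu>, m)" "z \<in> pocket \<delta> (k', \<nu>', m')" using e e' by auto
    have v: "\<nu> < Ndelta \<delta>" "m < Nang \<delta> k \<nu>" "\<nu>' < Ndelta \<delta>" "m' < Nang \<delta> k' \<nu>'"
      using Q e e' by (auto simp: pockets_def)
    note d = pocketD[OF z(1) v(1,2)] pocketD[OF z(2) v(3,4)]
    have "k = k'" using d by linarith
    with d have "\<nu> = \<nu>'" by (intro bracket_unique[OF rad_mono, of k _ "norm z"]) auto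
    with d \<open>k = k'\<close> have "m = m'" by (intro bracket_unique[OF ang_mono, of k \<nu> _ "Arg2pi z"]) auto
    with \<open>k = k'\<close> \<open>\<nu> = \<nu>'\<close> Q(3) e e' show False by simp
  qed
qed

lemma pockets_cover:
  assumes "z \<in> annulus k"
  shows "\<exists>Q\<in>shell_pockets \<delta> k. z \<in> pocket \<delta> Q"
proof -
  obtain \<nu> where \<nu>: "\<nu> < Ndelta \<delta>" "rad \<delta> k \<nu> \<le> norm z" "norm z < rad \<delta> k (\<nu> + 1)"
    using ex_bracket[of "rad \<delta> k" "norm z" "Ndelta \<delta>"] assms by (auto simp: rad_0 rad_Ndelta annulus_def)
  obtain m where m: "m < Nang \<delta> k \<nu>" "ang \<delta> k \<nu> m \<le> Arg2pi z" "Arg2pi z < ang \<delta> k \<nu> (m + 1)"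
    using ex_bracket[of "ang \<delta> k \<nu>" "Arg2pi z" "Nang \<delta> k \<nu>"] Arg2pi[of z] by (auto simp: ang_0 ang_Nang)
  have "z \<in> pocket \<delta> (k, \<nu>, m)" using \<nu> m by (intro pocketI)
  moreover have "(k, \<nu>, m) \<in> shell_pockets \<delta> k" using \<nu> m by (auto simp: shell_pockets_eq pockets_def)
  ultimately show ?thesis by blast
qed

lemma ex_annulus: "\<exists>k. z \<in> annulus k"
  by (rule exI[of _ "nat \<lfloor>norm z\<rfloor>"]) (simp add: annulus_def of_nat_floor)

lemma countable_pockets: "countable (pockets \<delta>)"
  by (rule countable_subset[OF subset_UNIV]) auto

end

section \<open>Gaussian integrals and Gaussian sums over separated points\<close>

lemma Gaussian_integral_bound:
  assumes "b > 0"
  shows "\<exists>A>0. \<forall>z :: complex. (\<integral>\<^sup>+ y. ennreal (gauss b z y) \<partial>lborel) \<le> ennreal A"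
proof -
  \<comment> \<open>Slicing by the integer part of the distance to \<open>z\<close> bounds the
    integral by a series of ball areas with Gaussian coefficients, the same for every
    \<open>z\<close>.\<close>
  define g where "g n = exp (- b * (real n)\<^sup>2) * (pi * (real n + 1)\<^sup>2)" for n :: nat
  have "summable g"
  proof (rule summable_comparison_test_bigo)
    show "summable (\<lambda>n. norm (1 / (real n)\<^sup>2))"
      using inverse_power_summable[of 2, where 'a=real] by (simp add: inverse_eq_divide)
    show "g \<in> O(\<lambda>n. 1 / (real n)\<^sup>2)" unfolding g_def using assms by real_asymp
  qed
  have g0: "g n \<ge> 0" for n by (simp add: g_def)
  have "(\<integral>\<^sup>+ y. ennreal (gauss b z y) \<partial>lborel) \<le> ennreal (suminf g + 1)" for z :: complex
  proof -
    have "(\<integral>\<^sup>+ y. ennreal (gauss b z y) \<partial>lborel) \<le>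
       (\<integral>\<^sup>+ y. (\<Sum>n. ennreal (exp (- b * (real n)\<^sup>2)) * indicator (ball z (real n + 1)) y) \<partial>lborel)"
    proof (rule nn_integral_mono)
      fix y
      define n where "n = nat \<lfloor>norm (z - y)\<rfloor>"
      have n: "real n \<le> norm (z - y)" "norm (z - y) < real n + 1" by (auto simp: n_def)
      have "ennreal (gauss b z y) \<le> ennreal (exp (- b * (real n)\<^sup>2)) * indicator (ball z (real n + 1)) y"
        using n assms by (auto simp: dist_norm intro!: ennreal_leI power_mono)
      also have "\<dots> \<le> (\<Sum>n. ennreal (exp (- b * (real n)\<^sup>2)) * indicator (ball z (real n + 1)) y)"
        using sum_le_suminf[of "\<lambda>n. ennreal (exp (- b * (real n)\<^sup>2)) * indicator (ball z (real n + 1)) y" "{n}"] by (simp only: sum.insert sum.empty finite.intros empty_iff not_False_eq_True add_0_right summableI zero_le simp_thms)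
      finally show "ennreal (gauss b z y) \<le> \<dots>" .
    qed
    also have "\<dots> = (\<Sum>n. ennreal (exp (- b * (real n)\<^sup>2)) * emeasure lborel (ball z (real n + 1)))"
      by (subst nn_integral_suminf) (auto simp: nn_integral_cmult_indicator intro!: borel_measurable_times_ennreal borel_measurable_indicator)
    also have "\<dots> = (\<Sum>n. ennreal (g n))"
    proof (intro suminf_cong)
      fix n
      have "emeasure lborel (ball z (real n + 1)) = ennreal (pi * (real n + 1)\<^sup>2)"
        by (subst emeasure_ball) (auto simp: unit_ball_vol_2)
      then show "ennreal (exp (- b * (real n)\<^sup>2)) * emeasure lborel (ball z (real n + 1)) = ennreal (g n)"
        by (simp add: g_def ennreal_mult)
    qed
    also have "\<dots> = ennreal (suminf g)" by (rule suminf_ennreal2[OF g0 \<open>summable g\<close>])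
    also have "\<dots> \<le> ennreal (suminf g + 1)" by (simp add: ennreal_leI)
    finally show ?thesis .
  qed
  moreover have "suminf g + 1 > 0" using suminf_nonneg[OF \<open>summable g\<close> g0] by linarith
  ultimately show ?thesis by blast
qed

lemma norm_square_shift: "(norm (x + y :: 'a :: real_normed_vector))\<^sup>2 \<le> 2 * (norm x)\<^sup>2 + 2 * (norm y)\<^sup>2"
proof -
  have "(norm (x + y))\<^sup>2 \<le> (norm x + norm y)\<^sup>2" by (intro power_mono norm_triangle_ineq) auto
  also have "\<dots> \<le> 2 * (norm x)\<^sup>2 + 2 * (norm y)\<^sup>2"
    using zero_le_power2[of "norm x - norm y"] by (simp add: power2_eq_square algebra_simps)
  finally show ?thesis .
qed

text \<open>Moving the centre by at most e halves the Gaussian rate and costs a constant factor. In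
  this way a point is exchanged for a nearby centre.\<close>

lemma exp_norm_square_shift:
  assumes "b \<ge> 0" "norm (y - w) \<le> e"
  shows "gauss b z w \<le> exp (b * e\<^sup>2) * exp (- (b / 2) * (norm (z - y :: 'a :: real_normed_vector))\<^sup>2)"
proof -
  have "(norm (z - y))\<^sup>2 \<le> 2 * (norm (z - w))\<^sup>2 + 2 * (norm (w - y))\<^sup>2"
    using norm_square_shift[of "z - w" "w - y"] by simp
  also have "(norm (w - y))\<^sup>2 \<le> e\<^sup>2" using assms by (intro power_mono) (auto simp: norm_minus_commute)
  finally have "b / 2 * (norm (z - y))\<^sup>2 \<le> b / 2 * (2 * (norm (z - w))\<^sup>2 + 2 * e\<^sup>2)"
    using assms by (intro mult_left_mono) auto
  then show ?thesis by (simp add: exp_add[symmetric] algebra_simps)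
qed

text \<open>Each term is at most a constant times the integral of a wider Gaussian over its own
  ball. The balls are disjoint, so the sum is bounded by the integral over the plane.\<close>

lemma Gaussian_sum_bound:
  fixes \<zeta> :: "'i \<Rightarrow> complex"
  assumes "a > 0" "\<epsilon> > 0" "countable I" "disjoint_family_on (\<lambda>i. ball (\<zeta> i) \<epsilon>) I"
  shows "\<exists>A>0. \<forall>z. (\<Sum>\<^sup>+i\<in>I. ennreal (gauss a z (\<zeta> i))) \<le> ennreal A"
proof -
  define v where "v = pi * \<epsilon>\<^sup>2"
  have v: "v > 0" using assms by (simp add: v_def)
  \<comment> \<open>The shift factor from \<open>exp_norm_square_shift\<close> divided by the area
    of a ball.\<close>
  define D where "D = exp (a * \<epsilon>\<^sup>2) / v"
  have D: "D > 0" using v by (simp add: D_def)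
  obtain A where A: "A > 0" "\<And>z :: complex. (\<integral>\<^sup>+ y. ennreal (gauss (a / 2) z y) \<partial>lborel) \<le> ennreal A"
    using Gaussian_integral_bound[of "a / 2"] assms by auto
  have "(\<Sum>\<^sup>+i\<in>I. ennreal (gauss a z (\<zeta> i))) \<le> ennreal (D * A)" for z
  proof -
    define h where "h y = ennreal (gauss (a / 2) z y)" for y
    have [measurable]: "h \<in> borel_measurable lborel" unfolding h_def by measurable
    have "ennreal (gauss a z (\<zeta> i)) \<le> ennreal D * (\<integral>\<^sup>+ y. h y * indicator (ball (\<zeta> i) \<epsilon>) y \<partial>lborel)" for i
    proof -
      have "ennreal (gauss a z (\<zeta> i)) * ennreal v =
         (\<integral>\<^sup>+ y. ennreal (gauss a z (\<zeta> i)) * indicator (ball (\<zeta> i) \<epsilon>) y \<partial>lborel)"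
        using assms(2) by (subst nn_integral_cmult_indicator) (auto simp: emeasure_ball unit_ball_vol_2 v_def)
      also have "\<dots> \<le> (\<integral>\<^sup>+ y. ennreal (exp (a * \<epsilon>\<^sup>2)) * (h y * indicator (ball (\<zeta> i) \<epsilon>) y) \<partial>lborel)"
      proof (rule nn_integral_mono)
        fix y
        show "ennreal (gauss a z (\<zeta> i)) * indicator (ball (\<zeta> i) \<epsilon>) y
          \<le> ennreal (exp (a * \<epsilon>\<^sup>2)) * (h y * indicator (ball (\<zeta> i) \<epsilon>) y)"
          using exp_norm_square_shift[of a y "\<zeta> i" \<epsilon> z] assms(1)
          by (auto simp: h_def dist_norm norm_minus_commute ennreal_mult[symmetric] intro!: ennreal_leI split: split_indicator)
      qed
      also have "\<dots> = ennreal (exp (a * \<epsilon>\<^sup>2)) * (\<integral>\<^sup>+ y. h y * indicator (ball (\<zeta> i) \<epsilon>) y \<partial>lborel)"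
        by (rule nn_integral_cmult) (intro borel_measurable_times_ennreal borel_measurable_indicator, auto)
      finally have "(ennreal (gauss a z (\<zeta> i)) * ennreal v) * ennreal (1 / v) \<le>
          (ennreal (exp (a * \<epsilon>\<^sup>2)) * (\<integral>\<^sup>+ y. h y * indicator (ball (\<zeta> i) \<epsilon>) y \<partial>lborel)) * ennreal (1 / v)"
        by (rule mult_right_mono) simp
      moreover have "(X * ennreal v) * ennreal (1 / v) = X" for X
        using v by (simp add: mult.assoc ennreal_mult[symmetric])
      moreover have "(ennreal (exp (a * \<epsilon>\<^sup>2)) * X) * ennreal (1 / v) = ennreal D * X" for X
        using v by (simp add: D_def ennreal_mult[symmetric] mult_ac divide_inverse)
      ultimately show ?thesis by metis
    qed
    then have "(\<Sum>\<^sup>+i\<in>I. ennreal (gauss a z (\<zeta> i))) \<le>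
      (\<Sum>\<^sup>+i\<in>I. ennreal D * (\<integral>\<^sup>+ y. h y * indicator (ball (\<zeta> i) \<epsilon>) y \<partial>lborel))"
      by (intro nn_integral_mono) auto
    also have "\<dots> = ennreal D * (\<Sum>\<^sup>+i\<in>I. (\<integral>\<^sup>+ y. h y * indicator (ball (\<zeta> i) \<epsilon>) y \<partial>lborel))"
      by (simp add: nn_integral_cmult)
    also have "(\<Sum>\<^sup>+i\<in>I. (\<integral>\<^sup>+ y. h y * indicator (ball (\<zeta> i) \<epsilon>) y \<partial>lborel)) =
      (\<integral>\<^sup>+ y. (\<Sum>\<^sup>+i\<in>I. h y * indicator (ball (\<zeta> i) \<epsilon>) y) \<partial>lborel)"
      using assms(3)
      by (intro nn_integral_count_space_nn_integral[symmetric] borel_measurable_times_ennreal borel_measurable_indicator) auto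
    also have "\<dots> \<le> (\<integral>\<^sup>+ y. h y \<partial>lborel)"
    proof (rule nn_integral_mono)
      fix y
      show "(\<Sum>\<^sup>+i\<in>I. h y * indicator (ball (\<zeta> i) \<epsilon>) y) \<le> h y"
      proof (cases "\<exists>i0\<in>I. y \<in> ball (\<zeta> i0) \<epsilon>")
        case True
        then obtain i0 where i0: "i0 \<in> I" "y \<in> ball (\<zeta> i0) \<epsilon>" by blast
        have iff: "y \<in> ball (\<zeta> i) \<epsilon> \<longleftrightarrow> i = i0" if "i \<in> I" for i
          using assms(4) i0 that unfolding disjoint_family_on_def by blast
        have "(\<Sum>\<^sup>+i\<in>I. h y * indicator (ball (\<zeta> i) \<epsilon>) y) = (\<Sum>\<^sup>+i\<in>I. h y * indicator {i0} i)"
          by (intro nn_integral_cong) (simp add: indicator_def iff del: mem_ball)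
        also have "\<dots> = h y" using i0 by (subst nn_integral_indicator_singleton) auto
        finally show ?thesis by simp
      next
        case False
        then have "(\<Sum>\<^sup>+i\<in>I. h y * indicator (ball (\<zeta> i) \<epsilon>) y) = (\<Sum>\<^sup>+i\<in>I. 0)"
          by (intro nn_integral_cong) (auto split: split_indicator)
        then show ?thesis by simp
      qed
    qed
    also have "\<dots> \<le> ennreal A" unfolding h_def by (rule A(2))
    finally show ?thesis using D A(1) by (simp add: ennreal_mult mult_left_mono)
  qed
  moreover have "D * A > 0" using D A by simp
  ultimately show ?thesis by blast
qed

subsection \<open>Norms of the kernels\<close>

lemma one_minus_cos_le: "1 - cos u \<le> u\<^sup>2 / 2"
    and one_minus_cos_ge: "\<bar>u\<bar> \<le> pi \<Longrightarrow> u\<^sup>2 / 8 \<le> 1 - cos (u :: real)"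
proof -
  have half: "1 - cos u = 2 * (sin (u / 2))\<^sup>2" for u :: real
    using cos_double_sin[of "u / 2"] by simp
  have "\<bar>sin (u / 2)\<bar>\<^sup>2 \<le> \<bar>u / 2\<bar>\<^sup>2" by (intro power_mono abs_sin_x_le_abs_x) auto
  then show "1 - cos u \<le> u\<^sup>2 / 2" by (simp add: half power_divide)
  assume u: "\<bar>u\<bar> \<le> pi"
  \<comment> \<open>A quarter of the angle lies in [0, pi / 4], where \<open>sin v\<close> is at
    least sqrt 2 / 2 * v and \<open>cos v\<close> at least sqrt 2 / 2. Hence sin (2 * v) is at least
    v, and 1 - cos u, being twice its square, is at least 2 * v^2.\<close>
  define v where "v = \<bar>u\<bar> / 4"
  have v: "0 \<le> v" "v \<le> pi / 4" using u by (auto simp: v_def)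
  have cv: "sqrt 2 / 2 \<le> cos x" if "0 \<le> x" "x \<le> v" for x
    using cos_monotone_0_pi_le[of x "pi / 4"] that v by (simp add: cos_45)
  have sv: "sqrt 2 / 2 * v \<le> sin v"
  proof (cases "v = 0")
    case False
    then have "0 < v" using v by simp
    then obtain x where x: "0 < x" "x < v" "sin v - sin 0 = (v - 0) * cos x"
      using MVT2[of 0 v sin cos] by (auto intro: DERIV_sin)
    then have "sin v = v * cos x" by simp
    then show ?thesis using cv[of x] x v by (simp add: mult.commute mult_left_mono)
  qed simp
  have "(sqrt 2 / 2 * v)\<^sup>2 \<le> (sin v)\<^sup>2" using sv v by (intro power_mono) auto
  moreover have "(sqrt 2 / 2)\<^sup>2 \<le> (cos v)\<^sup>2" using cv[of v] v by (intro power_mono) auto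
  ultimately have "(sqrt 2 / 2 * v)\<^sup>2 * (sqrt 2 / 2)\<^sup>2 \<le> (sin v)\<^sup>2 * (cos v)\<^sup>2"
    by (intro mult_mono) auto
  then have "v\<^sup>2 \<le> 4 * ((sin v)\<^sup>2 * (cos v)\<^sup>2)" by (simp add: power_mult_distrib power_divide)
  also have "\<dots> = (sin (2 * v))\<^sup>2" by (simp add: sin_double power_mult_distrib)
  finally have "v\<^sup>2 \<le> (sin (2 * v))\<^sup>2" .
  then have "2 * v\<^sup>2 \<le> 1 - cos (4 * v)" using half[of "4 * v"] by simp
  also have "cos (4 * v) = cos u" by (simp add: v_def)
  finally show "u\<^sup>2 / 8 \<le> 1 - cos u" by (simp add: v_def power_divide)
qed

lemma nn_integral_Gaussian:
  assumes "c > 0"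
  shows "(\<integral>\<^sup>+ x. ennreal (exp (- c * (x - a)\<^sup>2)) \<partial>lborel) = ennreal (sqrt (pi / c))"
proof -
  \<comment> \<open>The standard deviation for which the integrand is a multiple of a normal
    density.\<close>
  define \<sigma> where "\<sigma> = sqrt (1 / (2 * c))"
  have \<sigma>: "\<sigma> > 0" "2 * \<sigma>\<^sup>2 = 1 / c" using assms by (auto simp: \<sigma>_def)
  have e: "exp (- c * (x - a)\<^sup>2) = sqrt (pi / c) * normal_density a \<sigma> x" for x
  proof -
    have "2 * pi * \<sigma>\<^sup>2 = pi / c" using \<sigma>(2) by (simp add: mult.assoc mult.left_commute[of 2])
    then show ?thesis using assms \<sigma> by (simp add: normal_density_def)
  qed
  have "(\<integral>\<^sup>+ x. ennreal (normal_density a \<sigma> x) \<partial>lborel) = 1"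
    using prob_space.emeasure_space_1[OF prob_space_normal_density[OF \<sigma>(1), of a]]
    by (simp add: emeasure_density)
  then have "(\<integral>\<^sup>+ x. ennreal (sqrt (pi / c)) * ennreal (normal_density a \<sigma> x) \<partial>lborel) = ennreal (sqrt (pi / c))"
    by (simp add: nn_integral_cmult)
  then show ?thesis using assms unfolding e by (simp add: ennreal_mult)
qed

text \<open>For y > 1 the quadratic lower bound on 1 - cos u gives a Gaussian of width comparable to
  1 / sqrt y. For y \<le> 1 the integrand is at most exp y and the factor (1 + y) powr (- 1 / 2) is
  bounded below. The constant 100 is a generous common bound.\<close>

lemma circle_integral_upper:
  assumes "0 \<le> y" "0 \<le> \<phi>" "\<phi> \<le> 2 * pi"
  shows "(\<integral>\<^sup>+ \<theta>\<in>{0..2 * pi}. ennreal (exp (y * cos (\<theta> - \<phi>))) \<partial>lborel)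
     \<le> ennreal (100 * (exp y * (1 + y) powr (- 1 / 2)))"
proof (cases "y \<le> 1")
  case True
  have "(\<integral>\<^sup>+ \<theta>\<in>{0..2 * pi}. ennreal (exp (y * cos (\<theta> - \<phi>))) \<partial>lborel) \<le>
      (\<integral>\<^sup>+ \<theta>\<in>{0..2 * pi}. ennreal (exp y) \<partial>lborel)"
    using assms by (intro nn_integral_mono mult_right_mono ennreal_leI) (auto simp: mult_left_le)
  also have "\<dots> = ennreal (exp y * (2 * pi))"
    by (simp add: nn_integral_cmult_indicator ennreal_mult)
  also have "\<dots> \<le> ennreal (100 * (exp y * (1 + y) powr (- 1 / 2)))"
  proof (rule ennreal_leI)
    have "2 powr (- 1 / 2) \<le> (1 + y) powr (- 1 / 2)" using True assms by (intro powr_mono2') auto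
    moreover have "2 powr (- 1 / 2) \<ge> (2 :: real) powr (- 1)" by (intro powr_mono) auto
    moreover have "(2 :: real) powr (- 1) = 1 / 2" by (simp add: powr_minus_divide)
    ultimately have "1 / 2 \<le> (1 + y) powr (- 1 / 2)" by linarith
    then have "exp y * (2 * pi) \<le> exp y * (100 * (1 + y) powr (- 1 / 2))"
      using pi_less_4 by (intro mult_left_mono) auto
    then show "exp y * (2 * pi) \<le> 100 * (exp y * (1 + y) powr (- 1 / 2))" by simp
  qed
  finally show ?thesis .
next
  case False
  \<comment> \<open>The difference of the two angles ranges over [- 2 pi, 2 pi], so the nearest peak
    is \<phi> or one of its two neighbouring periods; three Gaussians cover all cases.\<close>
  define g where "g j \<theta> = ennreal (exp y) * ennreal (exp (- (y / 8) * (\<theta> - (\<phi> + 2 * pi * j))\<^sup>2))" for j \<theta>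
  have g_meas: "g j \<in> borel_measurable lborel" for j unfolding g_def by measurable
  have g_int: "(\<integral>\<^sup>+ \<theta>. g j \<theta> \<partial>lborel) = ennreal (exp y * sqrt (8 * pi / y))" for j
    using False nn_integral_Gaussian[of "y / 8" "\<phi> + 2 * pi * j"] unfolding g_def
    by (subst nn_integral_cmult) (auto simp: ennreal_mult mult.commute)
  have "(\<integral>\<^sup>+ \<theta>\<in>{0..2 * pi}. ennreal (exp (y * cos (\<theta> - \<phi>))) \<partial>lborel) \<le>
      (\<integral>\<^sup>+ \<theta>. g (-1) \<theta> + (g 0 \<theta> + g 1 \<theta>) \<partial>lborel)"
  proof (rule nn_integral_mono)
    fix \<theta> :: real
    show "ennreal (exp (y * cos (\<theta> - \<phi>))) * indicator {0..2 * pi} \<theta> \<le> g (-1) \<theta> + (g 0 \<theta> + g 1 \<theta>)"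
    proof (cases "\<theta> \<in> {0..2 * pi}")
      case True
      have key: "ennreal (exp (y * cos (\<theta> - \<phi>))) \<le> g j \<theta>"
        if "cos (\<theta> - (\<phi> + 2 * pi * j)) = cos (\<theta> - \<phi>)" "\<bar>\<theta> - (\<phi> + 2 * pi * j)\<bar> \<le> pi" for j
      proof -
        have "y * cos (\<theta> - \<phi>) \<le> y * (1 - (\<theta> - (\<phi> + 2 * pi * j))\<^sup>2 / 8)"
          using one_minus_cos_ge[OF that(2)] that(1) assms(1) by (intro mult_left_mono) auto
        then have "exp (y * cos (\<theta> - \<phi>)) \<le> exp (y + - (y / 8) * (\<theta> - (\<phi> + 2 * pi * j))\<^sup>2)"
          by (simp add: algebra_simps)
        then show ?thesis unfolding g_def by (simp only: exp_add ennreal_mult[symmetric] exp_ge_zero ennreal_leI)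
      qed
      consider "\<theta> - \<phi> < - pi" | "\<bar>\<theta> - \<phi>\<bar> \<le> pi" | "pi < \<theta> - \<phi>" by linarith
      then have "\<exists>j\<in>{-1,0,1}. ennreal (exp (y * cos (\<theta> - \<phi>))) \<le> g j \<theta>"
      proof cases
        case 1
        have "cos (\<theta> - (\<phi> + 2 * pi * (-1))) = cos (\<theta> - \<phi> + 2 * pi)" by (simp add: algebra_simps)
        then have "ennreal (exp (y * cos (\<theta> - \<phi>))) \<le> g (-1) \<theta>" using 1 True assms by (intro key) auto
        then show ?thesis by blast
      next
        case 2
        then have "ennreal (exp (y * cos (\<theta> - \<phi>))) \<le> g 0 \<theta>" by (intro key) auto
        then show ?thesis by blast
      next
        case 3
        have "cos (\<theta> - (\<phi> + 2 * pi * 1)) = cos (\<theta> - \<phi>)"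
          using cos_periodic[of "\<theta> - (\<phi> + 2 * pi * 1)"] by simp
        then have "ennreal (exp (y * cos (\<theta> - \<phi>))) \<le> g 1 \<theta>" using 3 True assms by (intro key) auto
        then show ?thesis by blast
      qed
      moreover have "g (-1) \<theta> \<le> g (-1) \<theta> + (g 0 \<theta> + g 1 \<theta>)" "g 0 \<theta> \<le> g (-1) \<theta> + (g 0 \<theta> + g 1 \<theta>)"
        "g 1 \<theta> \<le> g (-1) \<theta> + (g 0 \<theta> + g 1 \<theta>)"
        by (simp_all add: add_increasing add_increasing2)
      ultimately show ?thesis using True by (auto intro: order_trans)
    qed simp
  qed
  also have "\<dots> = ennreal (exp y * sqrt (8 * pi / y)) + (ennreal (exp y * sqrt (8 * pi / y)) + ennreal (exp y * sqrt (8 * pi / y)))"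
    by (simp only: nn_integral_add g_meas borel_measurable_add g_int)
  also have "\<dots> = ennreal (3 * (exp y * sqrt (8 * pi / y)))"
    using False by (simp add: ennreal_plus[symmetric] del: ennreal_plus)
  also have "\<dots> \<le> ennreal (100 * (exp y * (1 + y) powr (- 1 / 2)))"
  proof (rule ennreal_leI)
    have "8 * pi / y \<le> 32 / y" using False pi_less_4 by (intro divide_right_mono) auto
    also have "\<dots> = 64 / (2 * y)" by simp
    also have "\<dots> \<le> 64 / (1 + y)" using False by (intro divide_left_mono) auto
    finally have "8 * pi / y \<le> 64 / (1 + y)" .
    then have "sqrt (8 * pi / y) \<le> sqrt (64 / (1 + y))" by simp
    also have "\<dots> = 8 * (1 + y) powr (- 1 / 2)"
      using False by (simp add: real_sqrt_divide powr_minus_divide powr_half_sqrt)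
    finally have "sqrt (8 * pi / y) \<le> 8 * (1 + y) powr (- 1 / 2)" .
    then have "exp y * sqrt (8 * pi / y) \<le> exp y * (8 * (1 + y) powr (- 1 / 2))" by (rule mult_left_mono) simp
    moreover have "0 \<le> exp y * (1 + y) powr (- 1 / 2)" by simp
    ultimately show "3 * (exp y * sqrt (8 * pi / y)) \<le> 100 * (exp y * (1 + y) powr (- 1 / 2))" by linarith
  qed
  finally show ?thesis .
qed

text \<open>On an arc of length h next to the peak the exponent loses at most 1, because y * h^2
  \<le> 1.\<close>

lemma circle_integral_lower:
  assumes "0 \<le> y" "0 \<le> \<phi>" "\<phi> \<le> 2 * pi"
  shows "ennreal (exp (- 1) * (exp y * (1 + y) powr (- 1 / 2)))
    \<le> (\<integral>\<^sup>+ \<theta>\<in>{0..2 * pi}. ennreal (exp (y * cos (\<theta> - \<phi>))) \<partial>lborel)"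
proof -
  define h where "h = (1 + y) powr (- 1 / 2)"
  have h: "0 \<le> h" "h \<le> 1" "h\<^sup>2 = 1 / (1 + y)"
    using assms(1) by (auto simp: h_def powr_le_one_le powr_minus_divide powr_half_sqrt power_divide)
  have yh: "y * h\<^sup>2 \<le> 1" using assms(1) by (simp add: h(3))
  \<comment> \<open>The arc is taken to the right or to the left of \<phi>, so that it stays inside
    [0, 2 pi].\<close>
  obtain a where a: "{a..a + h} \<subseteq> {0..2 * pi}" "{a..a + h} \<subseteq> {\<phi> - h..\<phi> + h}"
  proof (cases "\<phi> \<le> pi")
    case True
    then show ?thesis using that[of \<phi>] assms h pi_gt3 by auto
  next
    case False
    then show ?thesis using that[of "\<phi> - h"] assms h pi_gt3 by auto
  qed
  have "ennreal (exp (- 1) * (exp y * h)) \<le> ennreal (exp (y - 1) * h)"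
    by (simp add: exp_diff exp_minus field_simps)
  also have "\<dots> = (\<integral>\<^sup>+ \<theta>\<in>{a..a + h}. ennreal (exp (y - 1)) \<partial>lborel)"
    using h by (simp add: nn_integral_cmult_indicator ennreal_mult)
  also have "\<dots> \<le> (\<integral>\<^sup>+ \<theta>\<in>{0..2 * pi}. ennreal (exp (y * cos (\<theta> - \<phi>))) \<partial>lborel)"
  proof (rule nn_integral_mono)
    fix \<theta> :: real
    have "exp (y - 1) \<le> exp (y * cos (\<theta> - \<phi>))" if "\<theta> \<in> {a..a + h}"
    proof -
      have "\<bar>\<theta> - \<phi>\<bar> \<le> h" using that a(2) by force
      then have "(\<theta> - \<phi>)\<^sup>2 \<le> h\<^sup>2" by (metis abs_ge_zero power2_abs power_mono)
      then have "y * (1 - cos (\<theta> - \<phi>)) \<le> y * h\<^sup>2"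
        using one_minus_cos_le[of "\<theta> - \<phi>"] zero_le_power2[of h] assms(1)
        by (intro mult_left_mono) linarith+
      then show ?thesis using yh by (simp add: algebra_simps)
    qed
    then show "ennreal (exp (y - 1)) * indicator {a..a + h} \<theta> \<le> ennreal (exp (y * cos (\<theta> - \<phi>))) * indicator {0..2 * pi} \<theta>"
      using a(1) by (auto split: split_indicator intro!: ennreal_leI)
  qed
  finally show ?thesis by (simp add: h_def)
qed

section \<open>Circle means of the kernels\<close>

lemma norm_kern: "norm (kern \<alpha> w z) = exp (\<alpha> * Re (cnj w * z) - \<alpha> / 2 * (norm w)\<^sup>2)"
  by (simp add: kern_def mult.assoc)

lemma norm_kern_weighted:
  "norm (kern \<alpha> w z) * exp (- (\<alpha> / 2) * (norm z)\<^sup>2) = gauss (\<alpha> / 2) z w"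
proof -
  have eq: "(norm (z - w))\<^sup>2 = (norm z)\<^sup>2 + (norm w)\<^sup>2 - 2 * Re (cnj w * z)"
    unfolding cmod_power2 by (simp add: power2_eq_square algebra_simps)
  show ?thesis unfolding norm_kern exp_add[symmetric] eq by (simp add: field_simps)
qed

lemma norm_kern_polar:
  assumes "0 \<le> r"
  shows "norm (kern \<alpha> w (of_real r * cis \<theta>)) =
    exp (\<alpha> * r * norm w * cos (\<theta> - Arg2pi w)) * exp (- \<alpha> / 2 * (norm w)\<^sup>2)"
proof -
  have "cnj w * (of_real r * cis \<theta>) = of_real (r * norm w) * cis (\<theta> - Arg2pi w)"
  proof -
    have "w = of_real (norm w) * cis (Arg2pi w)" using Arg2pi_eq[of w] by (simp add: cis_conv_exp mult.commute)
    then have "cnj w = of_real (norm w) * cis (- Arg2pi w)" by (metis cis_cnj complex_cnj_complex_of_real complex_cnj_mult)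
    then show ?thesis by (simp add: cis_mult[symmetric] diff_conv_add_uminus del: add_uminus_conv_diff)
  qed
  then have "Re (cnj w * (of_real r * cis \<theta>)) = r * norm w * cos (\<theta> - Arg2pi w)"
    by (metis Re_rcis rcis_def)
  then show ?thesis unfolding norm_kern by (simp add: exp_add[symmetric] mult.assoc)
qed

text \<open>The size of the mean of order p over the circle of radius r of a kernel with |w| = t:
  its maximum there, times the power 1 / p of the angular width (1 + r * t) powr (- 1 / 2) of the
  peak. For p = \<infinity> the second factor is 1.\<close>

definition kern_profile :: "real \<Rightarrow> ennreal \<Rightarrow> real \<Rightarrow> real \<Rightarrow> real" where
  "kern_profile \<alpha> p t r = exp (\<alpha> * r * t - \<alpha> / 2 * t\<^sup>2) * (1 + r * t) powr (- enn2real (1 / p) / 2)"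

text \<open>The maximum over the circle is attained at the argument of \<open>w\<close>.\<close>

lemma int_mean_kern_infinite:
  assumes "0 \<le> r"
  assumes "\<alpha> > 0"
  shows "int_mean \<infinity> (kern \<alpha> w) r = ennreal (kern_profile \<alpha> \<infinity> (norm w) r)"
proof -
  have c: "cos (\<theta> - Arg2pi w) * (\<alpha> * r * norm w) \<le> \<alpha> * r * norm w" for \<theta>
    using assms mult_right_mono[OF cos_le_one, of "\<alpha> * r * norm w" "\<theta> - Arg2pi w"] by simp
  have rt: "1 + r * norm w > 0" using assms by (simp add: add_pos_nonneg)
  have k: "kern_profile \<alpha> \<infinity> (norm w) r = exp (\<alpha> * r * norm w) * exp (- \<alpha> / 2 * (norm w)\<^sup>2)"
    using rt by (simp add: kern_profile_def exp_add[symmetric] less_imp_neq)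
  have "(SUP \<theta>. ennreal (norm (kern \<alpha> w (of_real r * cis \<theta>)))) = ennreal (kern_profile \<alpha> \<infinity> (norm w) r)"
  proof (rule antisym)
    show "(SUP \<theta>. ennreal (norm (kern \<alpha> w (of_real r * cis \<theta>)))) \<le> ennreal (kern_profile \<alpha> \<infinity> (norm w) r)"
      using c by (intro SUP_least ennreal_leI)
        (simp only: norm_kern_polar[OF assms(1)] k, intro mult_right_mono, auto simp: mult.commute)
    show "ennreal (kern_profile \<alpha> \<infinity> (norm w) r) \<le> (SUP \<theta>. ennreal (norm (kern \<alpha> w (of_real r * cis \<theta>))))"
      by (rule order_trans[OF _ SUP_upper[of "Arg2pi w"]]) (simp_all only: norm_kern_polar[OF assms(1)] k, simp_all)
  qed
  then show ?thesis by (simp add: int_mean_def)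
qed

lemma int_mean_kern_finite:
  assumes "\<alpha> > 0" "p > 0" "p \<noteq> \<infinity>"
  shows "\<exists>C>0. \<forall>w. \<forall>r\<ge>0. ennreal (1 / C * kern_profile \<alpha> p (norm w) r) \<le> int_mean p (kern \<alpha> w) r \<and>
      int_mean p (kern \<alpha> w) r \<le> ennreal (C * kern_profile \<alpha> p (norm w) r)"
proof -
  define P where "P = enn2real p"
  have P: "P > 0" "enn2real (1 / p) = 1 / P"
    using finite_exponent[OF assms(2,3)] inverse_exponent[OF assms(2,3)] by (auto simp: P_def)
  \<comment> \<open>These compare 1 + \<alpha> * P * x with 1 + x: the circle integrals produce the
    former, the profile uses the latter.\<close>
  define a b where "a = max 1 (\<alpha> * P)" and "b = min 1 (\<alpha> * P)"
  have ab: "a \<ge> 1" "0 < b" "b \<le> 1" using assms P by (auto simp: a_def b_def)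
  define L where "L = (1 / (2 * pi)) * (exp (- 1) * a powr (- 1 / 2))"
  define U where "U = (1 / (2 * pi)) * (100 * b powr (- 1 / 2))"
  have LU: "L > 0" "U > 0" using ab by (auto simp: L_def U_def)
  \<comment> \<open>One constant for both directions; \<open>U\<close> and \<open>L\<close> are the
    upper and lower factors before the root of order P.\<close>
  define C where "C = max (U powr (1 / P)) (1 / L powr (1 / P))"
  have C: "C > 0" "U powr (1 / P) \<le> C" "1 / C \<le> L powr (1 / P)"
  proof -
    have l: "L powr (1 / P) > 0" using LU by simp
    then show "C > 0" by (simp add: C_def less_max_iff_disj)
    show "U powr (1 / P) \<le> C" by (simp add: C_def)
    have "C > 0" using l by (simp add: C_def less_max_iff_disj)
    have "1 / L powr (1 / P) \<le> C" by (simp add: C_def)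
    with \<open>C > 0\<close> have "1 / C \<le> 1 / (1 / L powr (1 / P))" using l \<open>C > 0\<close> by (intro divide_left_mono mult_pos_pos divide_pos_pos) auto
    then show "1 / C \<le> L powr (1 / P)" by simp
  qed
  have "ennreal (1 / C * kern_profile \<alpha> p (norm w) r) \<le> int_mean p (kern \<alpha> w) r \<and>
      int_mean p (kern \<alpha> w) r \<le> ennreal (C * kern_profile \<alpha> p (norm w) r)" if "r \<ge> 0" for w r
  proof -
    define x where "x = r * norm w"
    have x: "x \<ge> 0" using that by (simp add: x_def)
    define y where "y = \<alpha> * P * x"
    have y: "y \<ge> 0" using assms P x by (simp add: y_def)
    define d where "d = exp (- \<alpha> / 2 * (norm w)\<^sup>2)"
    define J where "J = (\<integral>\<^sup>+ \<theta>\<in>{0..2 * pi}. ennreal (exp (y * cos (\<theta> - Arg2pi w))) \<partial>lborel)"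
    define M where "M = exp y * (1 + x) powr (- 1 / 2)"
    have ineq: "a powr (- 1 / 2) * (1 + x) powr (- 1 / 2) \<le> (1 + y) powr (- 1 / 2)"
         "(1 + y) powr (- 1 / 2) \<le> b powr (- 1 / 2) * (1 + x) powr (- 1 / 2)"
    proof -
      have "\<alpha> * P * x \<le> a * x" "b * x \<le> \<alpha> * P * x" using x by (auto simp: a_def b_def intro!: mult_right_mono)
      then have "1 + y \<le> a * (1 + x)" "b * (1 + x) \<le> 1 + y" using ab unfolding y_def by (auto simp: algebra_simps)
      then show "a powr (- 1 / 2) * (1 + x) powr (- 1 / 2) \<le> (1 + y) powr (- 1 / 2)"
         "(1 + y) powr (- 1 / 2) \<le> b powr (- 1 / 2) * (1 + x) powr (- 1 / 2)"
        using ab x y by (auto simp: powr_mult[symmetric] intro!: powr_mono2')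
    qed
    have JM: "ennreal (exp (- 1) * a powr (- 1 / 2) * M) \<le> J" "J \<le> ennreal (100 * b powr (- 1 / 2) * M)"
    proof -
      have "ennreal (exp (- 1) * a powr (- 1 / 2) * M) \<le> ennreal (exp (- 1) * (exp y * (1 + y) powr (- 1 / 2)))"
        using mult_left_mono[OF ineq(1), of "exp (-1) * exp y"] by (intro ennreal_leI) (simp add: M_def mult_ac)
      also have "\<dots> \<le> J" unfolding J_def using Arg2pi[of w] y by (intro circle_integral_lower) auto
      finally show "ennreal (exp (- 1) * a powr (- 1 / 2) * M) \<le> J" .
      have "J \<le> ennreal (100 * (exp y * (1 + y) powr (- 1 / 2)))"
        unfolding J_def using Arg2pi[of w] y by (intro circle_integral_upper) auto
      also have "\<dots> \<le> ennreal (100 * b powr (- 1 / 2) * M)"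
        using mult_left_mono[OF ineq(2), of "100 * exp y"] by (intro ennreal_leI) (simp add: M_def mult_ac)
      finally show "J \<le> ennreal (100 * b powr (- 1 / 2) * M)" .
    qed
    have int: "int_mean p (kern \<alpha> w) r = enn_powr (ennreal (1 / (2 * pi)) * (ennreal (d powr P) * J)) (1 / P)"
    proof -
      have "(\<integral>\<^sup>+ \<theta>\<in>{0..2 * pi}. ennreal (norm (kern \<alpha> w (of_real r * cis \<theta>)) powr P) \<partial>lborel) =
         (\<integral>\<^sup>+ \<theta>. ennreal (d powr P) * (ennreal (exp (y * cos (\<theta> - Arg2pi w))) * indicator {0..2 * pi} \<theta>) \<partial>lborel)"
      proof (intro nn_integral_cong)
        fix \<theta> :: real
        have "norm (kern \<alpha> w (of_real r * cis \<theta>)) powr P = d powr P * exp (y * cos (\<theta> - Arg2pi w))"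
          unfolding norm_kern_polar[OF that] d_def y_def x_def by (simp add: powr_def exp_add[symmetric] algebra_simps)
        then show "ennreal (norm (kern \<alpha> w (of_real r * cis \<theta>)) powr P) * indicator {0..2 * pi} \<theta> =
          ennreal (d powr P) * (ennreal (exp (y * cos (\<theta> - Arg2pi w))) * indicator {0..2 * pi} \<theta>)"
          by (simp add: ennreal_mult mult.assoc)
      qed
      also have "\<dots> = ennreal (d powr P) * J" unfolding J_def by (rule nn_integral_cmult) measurable
      finally show ?thesis using assms by (simp add: int_mean_def P_def[symmetric])
    qed
    have root: "enn_powr (ennreal (1 / (2 * pi)) * (ennreal (d powr P) * ennreal (c * M))) (1 / P) =
        ennreal (((1 / (2 * pi)) * c) powr (1 / P) * kern_profile \<alpha> p (norm w) r)" if "c \<ge> 0" for c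
    proof -
      have M0: "M \<ge> 0" by (simp add: M_def)
      have "enn_powr (ennreal (1 / (2 * pi)) * (ennreal (d powr P) * ennreal (c * M))) (1 / P) =
          ennreal ((((1 / (2 * pi)) * c) * (d powr P * M)) powr (1 / P))"
        using that M0 by (simp add: ennreal_mult[symmetric] enn_powr_ennreal mult_ac)
      also have "\<dots> = ennreal (((1 / (2 * pi)) * c) powr (1 / P) * (d powr P * M) powr (1 / P))"
        using that M0 by (subst powr_mult) auto
      also have "(d powr P * M) powr (1 / P) = kern_profile \<alpha> p (norm w) r"
      proof -
        have 1: "(exp y) powr (1 / P) = exp (\<alpha> * r * norm w)" using P by (simp add: powr_def y_def x_def)
        have "(d powr P * M) powr (1 / P) = d * (exp y) powr (1 / P) * ((1 + x) powr (- 1 / 2)) powr (1 / P)"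
          using P x by (simp add: M_def powr_mult powr_powr d_def)
        also have "\<dots> = d * exp (\<alpha> * r * norm w) * (1 + r * norm w) powr (- enn2real (1 / p) / 2)"
          unfolding 1 powr_powr P(2) by (simp add: x_def mult.commute[of 2])
        also have "\<dots> = kern_profile \<alpha> p (norm w) r"
          by (simp add: kern_profile_def d_def exp_add[symmetric] add.commute)
        finally show ?thesis .
      qed
      finally show ?thesis .
    qed
    have k0: "kern_profile \<alpha> p (norm w) r \<ge> 0" by (simp add: kern_profile_def)
    have "ennreal (1 / C * kern_profile \<alpha> p (norm w) r) \<le> ennreal (L powr (1 / P) * kern_profile \<alpha> p (norm w) r)"
      using C k0 by (intro ennreal_leI mult_right_mono) auto
    also have "\<dots> = enn_powr (ennreal (1 / (2 * pi)) * (ennreal (d powr P) * ennreal (exp (- 1) * a powr (- 1 / 2) * M))) (1 / P)"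
      unfolding L_def by (rule root[symmetric]) simp
    also have "\<dots> \<le> int_mean p (kern \<alpha> w) r"
      unfolding int using P by (intro enn_powr_mono mult_left_mono JM) auto
    finally have 1: "ennreal (1 / C * kern_profile \<alpha> p (norm w) r) \<le> int_mean p (kern \<alpha> w) r" .
    have "int_mean p (kern \<alpha> w) r \<le> enn_powr (ennreal (1 / (2 * pi)) * (ennreal (d powr P) * ennreal (100 * b powr (- 1 / 2) * M))) (1 / P)"
      unfolding int using P by (intro enn_powr_mono mult_left_mono JM) auto
    also have "\<dots> = ennreal (U powr (1 / P) * kern_profile \<alpha> p (norm w) r)"
      unfolding U_def by (rule root) simp
    also have "\<dots> \<le> ennreal (C * kern_profile \<alpha> p (norm w) r)"
      using C k0 by (intro ennreal_leI mult_right_mono) auto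
    finally show ?thesis using 1 by simp
  qed
  then show ?thesis using C(1) by blast
qed

lemma int_mean_kern:
  assumes "\<alpha> > 0" "p > 0"
  shows "\<exists>C>0. \<forall>w. \<forall>r\<ge>0. ennreal (1 / C * kern_profile \<alpha> p (norm w) r) \<le> int_mean p (kern \<alpha> w) r \<and>
      int_mean p (kern \<alpha> w) r \<le> ennreal (C * kern_profile \<alpha> p (norm w) r)"
proof (cases "p = \<infinity>")
  case True
  then show ?thesis using assms int_mean_kern_infinite by (intro exI[of _ 1]) auto
qed (rule int_mean_kern_finite[OF assms])

text \<open>From ln (1 + u) \<le> u by completing the square. Polynomial losses are absorbed in this
  way into part of a Gaussian.\<close>

lemma polynomial_times_Gaussian_bounded:
  fixes a b u :: real
  assumes "a > 0" "u \<ge> 0"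
  shows "(1 + u) powr b * exp (- a * u\<^sup>2) \<le> exp (b\<^sup>2 / (4 * a))"
proof -
  have "ln (1 + u) \<le> u" using ln_add_one_self_le_self[of u] assms by (simp add: add.commute)
  then have "b * ln (1 + u) \<le> \<bar>b\<bar> * u"
    using assms by (intro mult_mono) auto
  moreover have "\<bar>b\<bar> * u - a * u\<^sup>2 \<le> b\<^sup>2 / (4 * a)"
  proof -
    have "0 \<le> (2 * a * u - \<bar>b\<bar>)\<^sup>2" by simp
    then have "4 * a * (\<bar>b\<bar> * u - a * u\<^sup>2) \<le> b\<^sup>2" by (simp add: power2_eq_square algebra_simps)
    then show ?thesis using assms by (simp add: field_simps)
  qed
  ultimately have "exp (b * ln (1 + u) - a * u\<^sup>2) \<le> exp (b\<^sup>2 / (4 * a))" by simp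
  then show ?thesis using assms by (simp add: powr_def exp_add[symmetric])
qed

text \<open>Trades 1 + r * t for (1 + t)^2 at the price of a polynomial in |r - t|, which the radial
  Gaussian absorbs. If t \<le> 2 * r then t^2 is at most 2 * r * t; otherwise |r - t| exceeds t /
  2.\<close>

lemma quasi_triangle:
  assumes "0 \<le> r" "0 \<le> (t :: real)"
  shows "(1 + t)\<^sup>2 \<le> 4 * (1 + r * t) * (1 + \<bar>r - t\<bar>)\<^sup>2"
proof (cases "t \<le> 2 * r")
  case True
  have "(1 + t)\<^sup>2 \<le> 2 + 2 * t\<^sup>2" using zero_le_power2[of "1 - t"] by (simp add: power2_eq_square algebra_simps)
  also have "t\<^sup>2 \<le> 2 * r * t" using True assms by (simp add: power2_eq_square mult_right_mono)
  finally have "(1 + t)\<^sup>2 \<le> 4 * (1 + r * t)" by simp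
  also have "\<dots> \<le> 4 * (1 + r * t) * (1 + \<bar>r - t\<bar>)\<^sup>2"
    using assms mult_left_mono[OF one_le_power[of "1 + \<bar>r - t\<bar>" 2], of "4 * (1 + r * t)"] by simp
  finally show ?thesis .
next
  case False
  have "(1 + t)\<^sup>2 \<le> (2 * (1 + \<bar>r - t\<bar>))\<^sup>2" using False assms by (intro power_mono) auto
  also have "\<dots> = 4 * (1 + \<bar>r - t\<bar>)\<^sup>2" unfolding power_mult_distrib by simp
  also have "\<dots> \<le> 4 * (1 + r * t) * (1 + \<bar>r - t\<bar>)\<^sup>2"
    using assms by (intro mult_right_mono) auto
  finally show ?thesis .
qed

section \<open>Radial integration: Fock norms of the kernels\<close>

lemma kern_profile_weighted:
  "kern_profile \<alpha> p t r * exp (- (\<alpha> / 2) * r\<^sup>2) = exp (- (\<alpha> / 2) * (r - t)\<^sup>2) * (1 + r * t) powr (- enn2real (1 / p) / 2)"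
  by (simp add: kern_profile_def exp_add[symmetric] power2_eq_square field_simps)

lemma profile_upper:
  fixes r t b :: real
  assumes "0 \<le> r" "0 \<le> t" "0 \<le> b"
  shows "(1 + r * t) powr (- b / 2) \<le> 4 powr (b / 2) * ((1 + t) powr (- b) * (1 + \<bar>r - t\<bar>) powr b)"
proof -
  have pos: "0 < 1 + r * t" "0 < 1 + t" "0 < 1 + \<bar>r - t\<bar>"
    using assms mult_nonneg_nonneg[OF assms(1,2)] by linarith+
  have sq: "(x\<^sup>2) powr (c / 2) = x powr c" if "x > 0" for x c :: real
    using that powr_realpow[OF that, of 2] by (simp add: powr_powr flip: powr_numeral)
  have "(1 + t) powr b = ((1 + t)\<^sup>2) powr (b / 2)" using sq[of "1 + t" b] pos by simp
  also have "\<dots> \<le> (4 * (1 + r * t) * (1 + \<bar>r - t\<bar>)\<^sup>2) powr (b / 2)"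
    using assms by (intro powr_mono2 quasi_triangle) auto
  also have "\<dots> = 4 powr (b / 2) * (1 + r * t) powr (b / 2) * (1 + \<bar>r - t\<bar>) powr b"
    by (simp only: powr_mult sq pos)
  finally show ?thesis using pos by (simp add: powr_minus field_simps)
qed

text \<open>The order of magnitude of the Fock norm of a kernel with |w| = t; at t = k it is also
  the weight in the coefficient norm. The radial mass sits near r = t: the measure r dr contributes
  the power 1 / q, and the angular concentration the power - 1 / p.\<close>

definition kern_weight :: "ennreal \<Rightarrow> ennreal \<Rightarrow> real \<Rightarrow> real" where
  "kern_weight p q t = (1 + t) powr (enn2real (1 / q) - enn2real (1 / p))"

lemma Fock_norm_kern_infinite:
  assumes "\<alpha> > 0" "p > 0"
  shows "\<exists>C>0. \<forall>w. comparable C (Fock_norm \<alpha> p \<infinity> (kern \<alpha> w)) (ennreal (kern_weight p \<infinity> (norm w)))"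
proof -
  obtain C where C: "C > 0" "\<And>w r. r \<ge> 0 \<Longrightarrow> ennreal (1 / C * kern_profile \<alpha> p (norm w) r) \<le> int_mean p (kern \<alpha> w) r"
    "\<And>w r. r \<ge> 0 \<Longrightarrow> int_mean p (kern \<alpha> w) r \<le> ennreal (C * kern_profile \<alpha> p (norm w) r)"
    using int_mean_kern[OF assms] by blast
  define b where "b = enn2real (1 / p)"
  have b: "b \<ge> 0" by (simp add: b_def)
  \<comment> \<open>Factors from \<open>profile_upper\<close> and from the polynomial bound at rate
    \<alpha> / 2.\<close>
  define D where "D = 4 powr (b / 2) * exp (b\<^sup>2 / (4 * (\<alpha> / 2)))"
  have D: "D \<ge> 1"
  proof -
    have "1 * 1 \<le> 4 powr (b / 2) * exp (b\<^sup>2 / (4 * (\<alpha> / 2)))"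
      using assms b by (intro mult_mono ge_one_powr_ge_zero) auto
    then show ?thesis by (simp add: D_def)
  qed
  have "comparable (C * D) (Fock_norm \<alpha> p \<infinity> (kern \<alpha> w)) (ennreal (kern_weight p \<infinity> (norm w)))" for w
  proof -
    define t where "t = norm w"
    have t: "t \<ge> 0" by (simp add: t_def)
    have W: "kern_weight p \<infinity> t = (1 + t) powr (- b)" by (simp add: kern_weight_def b_def)
    have up: "int_mean p (kern \<alpha> w) r * ennreal (exp (- (\<alpha> / 2) * r\<^sup>2)) \<le> ennreal (C * D * (1 + t) powr (- b))"
      if "r \<ge> 0" for r
    proof -
      have "int_mean p (kern \<alpha> w) r * ennreal (exp (- (\<alpha> / 2) * r\<^sup>2)) \<le>
          ennreal (C * kern_profile \<alpha> p t r) * ennreal (exp (- (\<alpha> / 2) * r\<^sup>2))"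
        using C(3)[OF that] by (intro mult_right_mono) (auto simp: t_def)
      also have "\<dots> = ennreal (C * (kern_profile \<alpha> p t r * exp (- (\<alpha> / 2) * r\<^sup>2)))"
        using C(1) by (simp add: ennreal_mult[symmetric] kern_profile_def mult.assoc)
      also have "\<dots> \<le> ennreal (C * (D * (1 + t) powr (- b)))"
      proof (intro ennreal_leI mult_left_mono)
        have "kern_profile \<alpha> p t r * exp (- (\<alpha> / 2) * r\<^sup>2) \<le>
           exp (- (\<alpha> / 2) * (r - t)\<^sup>2) * (4 powr (b / 2) * ((1 + t) powr (- b) * (1 + \<bar>r - t\<bar>) powr b))"
          unfolding kern_profile_weighted b_def[symmetric]
          using profile_upper[OF that t b] by (intro mult_left_mono) auto
        also have "\<dots> = 4 powr (b / 2) * (1 + t) powr (- b) * ((1 + \<bar>r - t\<bar>) powr b * exp (- (\<alpha> / 2) * \<bar>r - t\<bar>\<^sup>2))"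
          by simp
        also have "\<dots> \<le> 4 powr (b / 2) * (1 + t) powr (- b) * exp (b\<^sup>2 / (4 * (\<alpha> / 2)))"
          using assms by (intro mult_left_mono polynomial_times_Gaussian_bounded) auto
        finally show "kern_profile \<alpha> p t r * exp (- (\<alpha> / 2) * r\<^sup>2) \<le> D * (1 + t) powr (- b)"
          by (simp add: D_def mult_ac)
      qed (use C in auto)
      finally show ?thesis by (simp add: mult.assoc)
    qed
    have "Fock_norm \<alpha> p \<infinity> (kern \<alpha> w) \<le> ennreal (C * D * (1 + t) powr (- b))"
      using up by (auto simp: Fock_norm_def intro!: SUP_least)
    moreover have "ennreal (1 / (C * D) * (1 + t) powr (- b)) \<le> Fock_norm \<alpha> p \<infinity> (kern \<alpha> w)"
    proof -
      \<comment> \<open>For the lower bound the supremum is tested at r = t, where the Gaussian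
        factor is 1.\<close>
      have "(1 + t) powr (- b) \<le> (1 + t * t) powr (- b / 2)"
      proof -
        have "1 + t * t \<le> (1 + t)\<^sup>2" using t by (simp add: power2_eq_square algebra_simps)
        then have "((1 + t)\<^sup>2) powr (- b / 2) \<le> (1 + t * t) powr (- b / 2)"
          using t b by (intro powr_mono2') (auto simp: add_pos_nonneg)
        moreover have "((1 + t)\<^sup>2) powr (- b / 2) = (1 + t) powr (- b)"
          using t by (simp add: powr_powr flip: powr_numeral)
        ultimately show ?thesis by simp
      qed
      also have "\<dots> = kern_profile \<alpha> p t t * exp (- (\<alpha> / 2) * t\<^sup>2)"
        unfolding kern_profile_weighted b_def by simp
      finally have "1 / (C * D) * (1 + t) powr (- b) \<le> 1 / C * (kern_profile \<alpha> p t t * exp (- (\<alpha> / 2) * t\<^sup>2))"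
        using C(1) D by (intro mult_mono) (auto simp: frac_le)
      then have "ennreal (1 / (C * D) * (1 + t) powr (- b)) \<le> ennreal (1 / C * kern_profile \<alpha> p t t) * ennreal (exp (- (\<alpha> / 2) * t\<^sup>2))"
        using C(1) by (simp add: ennreal_mult[symmetric] kern_profile_def ennreal_leI mult.assoc)
      also have "\<dots> \<le> int_mean p (kern \<alpha> w) t * ennreal (exp (- (\<alpha> / 2) * t\<^sup>2))"
        using C(2)[OF t, of w] by (intro mult_right_mono) (auto simp: t_def)
      also have "\<dots> \<le> (SUP r\<in>{0..}. int_mean p (kern \<alpha> w) r * ennreal (exp (- (\<alpha> / 2) * r\<^sup>2)))"
        using t by (intro SUP_upper) auto
      finally show ?thesis by (simp add: Fock_norm_def)
    qed
    ultimately show ?thesis unfolding comparable_def t_def[symmetric] W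
      using C(1) D by (simp add: ennreal_mult[symmetric])
  qed
  moreover have "C * D > 0" using C(1) D by simp
  ultimately show ?thesis by blast
qed

lemma Fock_norm_kern_finite:
  assumes "\<alpha> > 0" "p > 0" "q > 0" "q \<noteq> \<infinity>"
  shows "\<exists>C>0. \<forall>w. comparable C (Fock_norm \<alpha> p q (kern \<alpha> w)) (ennreal (kern_weight p q (norm w)))"
proof -
  let ?M = "\<lambda>w. int_mean p (kern \<alpha> w)"
  obtain C where C: "C > 0" "\<And>w r. r \<ge> 0 \<Longrightarrow> ennreal (1 / C * kern_profile \<alpha> p (norm w) r) \<le> ?M w r"
    "\<And>w r. r \<ge> 0 \<Longrightarrow> ?M w r \<le> ennreal (C * kern_profile \<alpha> p (norm w) r)"
    using int_mean_kern[OF assms(1,2)] by blast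
  define b where "b = enn2real (1 / p)"
  have b: "b \<ge> 0" by (simp add: b_def)
  define \<eta> where "\<eta> = enn2real q"
  have q: "\<eta> > 0" "enn2real (1 / q) = 1 / \<eta>"
    using finite_exponent[OF assms(3,4)] inverse_exponent[OF assms(3,4)] by (auto simp: \<eta>_def)
  let ?d = "\<lambda>r. \<alpha> * \<eta> * exp (- (\<alpha> * \<eta> / 2) * r\<^sup>2) * r"
  define a where "a = \<alpha> * \<eta>"
  have a: "a > 0" using assms q by (simp add: a_def)
  have W: "kern_weight p q t powr \<eta> = (1 + t) powr (1 - b * \<eta>)" for t
    using q by (simp add: kern_weight_def b_def powr_powr left_diff_distrib)
  \<comment> \<open>The radial integrand for the profile after taking the power \<eta> = q: the
    exponentials combine into a Gaussian in r - t of rate a / 2.\<close>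
  define H where "H t r = exp (- (a / 2) * (r - t)\<^sup>2) * (1 + r * t) powr (- (b * \<eta>) / 2) * (a * r)" for t r
  have H0: "H t r \<ge> 0" if "r \<ge> 0" for t r using that a by (simp add: H_def)
  have pr: "kern_profile \<alpha> p t r powr \<eta> * (?d r) = H t r"
    if "r \<ge> 0" "t \<ge> 0" for t r
  proof -
    have "kern_profile \<alpha> p t r powr \<eta> * (?d r) =
        (kern_profile \<alpha> p t r powr \<eta> * exp (- (\<alpha> / 2) * r\<^sup>2) powr \<eta>) * (a * r)"
      by (simp add: powr_def[of "exp _"] a_def mult_ac)
    also have "kern_profile \<alpha> p t r powr \<eta> * exp (- (\<alpha> / 2) * r\<^sup>2) powr \<eta> = (kern_profile \<alpha> p t r * exp (- (\<alpha> / 2) * r\<^sup>2)) powr \<eta>"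
      by (simp only: powr_mult)
    also have "\<dots> = exp (- (\<alpha> / 2) * (r - t)\<^sup>2) powr \<eta> * ((1 + r * t) powr (- b / 2)) powr \<eta>"
      unfolding kern_profile_weighted b_def by (simp only: powr_mult)
    also have "\<dots> = exp (- (a / 2) * (r - t)\<^sup>2) * (1 + r * t) powr (- (b * \<eta>) / 2)"
      by (simp add: powr_def[of "exp _"] powr_powr a_def mult_ac)
    finally show ?thesis by (simp add: H_def)
  qed
  define F where "F w = (\<integral>\<^sup>+ r\<in>{0..}. enn_powr (?M w r) \<eta> *
            ennreal (?d r) \<partial>lborel)" for w
  have Fock: "Fock_norm \<alpha> p q (kern \<alpha> w) = enn_powr (F w) (1 / \<eta>)" for w
    using assms(4) by (simp add: Fock_norm_def F_def \<eta>_def)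
  \<comment> \<open>Half of the Gaussian rate a / 2 absorbs the polynomial in |r - t|; the other
    half is integrated exactly, giving sqrt (pi / (a / 4)).\<close>
  define D where "D = 4 powr (b * \<eta> / 2) * a * exp ((b * \<eta> + 1)\<^sup>2 / (4 * (a / 4))) * sqrt (pi / (a / 4))"
  define L where "L = exp (- (a / 2)) * a / 4"
  have DL: "D > 0" "L > 0" using a by (auto simp: D_def L_def)
  have up: "F w \<le> ennreal (C powr \<eta> * (D * (1 + norm w) powr (1 - b * \<eta>)))" for w
  proof -
    define t where "t = norm w"
    have t: "t \<ge> 0" by (simp add: t_def)
    define E where "E = C powr \<eta> * (4 powr (b * \<eta> / 2) * a * exp ((b * \<eta> + 1)\<^sup>2 / (4 * (a / 4))) * (1 + t) powr (1 - b * \<eta>))"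
    have E: "E \<ge> 0" using a by (simp add: E_def)
    have "F w \<le> (\<integral>\<^sup>+ r. ennreal E * ennreal (exp (- (a / 4) * (r - t)\<^sup>2)) \<partial>lborel)"
      unfolding F_def
    proof (rule nn_integral_mono)
      fix r :: real
      show "enn_powr (?M w r) \<eta> * ennreal (?d r) * indicator {0..} r
         \<le> ennreal E * ennreal (exp (- (a / 4) * (r - t)\<^sup>2))"
      proof (cases "r \<ge> 0")
        case True
        define u where "u = \<bar>r - t\<bar>"
        have u: "u \<ge> 0" "u\<^sup>2 = (r - t)\<^sup>2" by (auto simp: u_def)
        have k0: "kern_profile \<alpha> p t r \<ge> 0" by (simp add: kern_profile_def)
        have "enn_powr (?M w r) \<eta> * ennreal (?d r)
           \<le> enn_powr (ennreal (C * kern_profile \<alpha> p t r)) \<eta> * ennreal (?d r)"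
          using C(3)[OF True, of w] q by (intro mult_right_mono enn_powr_mono) (auto simp: t_def)
        also have "\<dots> = ennreal (C powr \<eta> * (kern_profile \<alpha> p t r powr \<eta> * (?d r)))"
          using C(1) k0 True q assms by (simp add: enn_powr_ennreal ennreal_mult[symmetric] powr_mult mult.assoc)
        also have "\<dots> = ennreal (C powr \<eta> * H t r)" unfolding pr[OF True t] ..
        also have "\<dots> \<le> ennreal (E * exp (- (a / 4) * (r - t)\<^sup>2))"
        proof (rule ennreal_leI)
          have r: "r \<le> (1 + t) * (1 + u)"
          proof -
            have "(1 + t) * (1 + u) = 1 + t + u + t * u" by (simp add: algebra_simps)
            moreover have "t * u \<ge> 0" "r \<le> t + u" using t u by (auto simp: u_def)
            ultimately show ?thesis by linarith
          qed
          have "(1 + r * t) powr (- (b * \<eta>) / 2) * (a * r) \<le>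
             (4 powr (b * \<eta> / 2) * ((1 + t) powr (- (b * \<eta>)) * (1 + u) powr (b * \<eta>))) * (a * ((1 + t) * (1 + u)))"
            using profile_upper[OF True t, of "b * \<eta>"] r b q a True unfolding u_def
            by (intro mult_mono) auto
          also have "\<dots> = (4 powr (b * \<eta> / 2) * a * (1 + t) powr (1 - b * \<eta>)) * (1 + u) powr (b * \<eta> + 1)"
          proof -
            have "(1 + t) powr (1 - b * \<eta>) = (1 + t) powr (- (b * \<eta>)) * (1 + t)"
              using t powr_add[of "1 + t" "- (b * \<eta>)" 1] by simp
            moreover have "(1 + u) powr (b * \<eta> + 1) = (1 + u) powr (b * \<eta>) * (1 + u)"
              using u powr_add[of "1 + u" "b * \<eta>" 1] by simp
            ultimately show ?thesis by simp
          qed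
          finally have "exp (- (a / 2) * u\<^sup>2) * ((1 + r * t) powr (- (b * \<eta>) / 2) * (a * r)) \<le> exp (- (a / 2) * u\<^sup>2) * \<dots>"
            by (rule mult_left_mono) simp
          then have "H t r \<le> (4 powr (b * \<eta> / 2) * a * (1 + t) powr (1 - b * \<eta>)) *
             ((1 + u) powr (b * \<eta> + 1) * exp (- (a / 4) * u\<^sup>2)) * exp (- (a / 4) * u\<^sup>2)"
            by (simp add: H_def u(2) mult_ac exp_add[symmetric])
          also have "\<dots> \<le> (4 powr (b * \<eta> / 2) * a * (1 + t) powr (1 - b * \<eta>)) *
             (exp ((b * \<eta> + 1)\<^sup>2 / (4 * (a / 4)))) * exp (- (a / 4) * u\<^sup>2)"
            using a u by (intro mult_right_mono mult_left_mono polynomial_times_Gaussian_bounded) auto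
          finally have "C powr \<eta> * H t r \<le> C powr \<eta> * ((4 powr (b * \<eta> / 2) * a * (1 + t) powr (1 - b * \<eta>)) *
             (exp ((b * \<eta> + 1)\<^sup>2 / (4 * (a / 4)))) * exp (- (a / 4) * u\<^sup>2))"
            by (rule mult_left_mono) simp
          then show "C powr \<eta> * H t r \<le> E * exp (- (a / 4) * (r - t)\<^sup>2)"
            by (simp add: E_def u(2) mult_ac)
        qed
        also have "\<dots> = ennreal E * ennreal (exp (- (a / 4) * (r - t)\<^sup>2))" using E by (simp add: ennreal_mult)
        finally show ?thesis using True by simp
      qed simp
    qed
    also have "\<dots> = ennreal E * ennreal (sqrt (pi / (a / 4)))"
      using nn_integral_Gaussian[of "a / 4" t] a by (subst nn_integral_cmult) auto
    also have "\<dots> = ennreal (C powr \<eta> * (D * (1 + t) powr (1 - b * \<eta>)))"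
      using E a by (simp add: ennreal_mult[symmetric] E_def D_def mult_ac)
    finally show ?thesis by (simp add: t_def)
  qed
  have lo: "ennreal ((1 / C) powr \<eta> * (L * (1 + norm w) powr (1 - b * \<eta>))) \<le> F w" for w
  proof -
    define t where "t = norm w"
    have t: "t \<ge> 0" by (simp add: t_def)
    \<comment> \<open>The lower bound uses only r in [t + 1 / 2, t + 1]. There |r - t| \<le> 1 and r
      \<ge> (1 + t) / 2, so the factor r of the measure does no harm even for t = 0. The length 1 /
      2 of the interval turns the constant here into \<open>L\<close>.\<close>
    define E where "E = (1 / C) powr \<eta> * (exp (- (a / 2)) * a / 2 * (1 + t) powr (1 - b * \<eta>))"
    have "ennreal ((1 / C) powr \<eta> * (L * (1 + t) powr (1 - b * \<eta>))) = (\<integral>\<^sup>+ r\<in>{t + 1 / 2..t + 1}. ennreal E \<partial>lborel)"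
    proof -
      have "(\<integral>\<^sup>+ r\<in>{t + 1 / 2..t + 1}. ennreal E \<partial>lborel) = ennreal E * emeasure lborel {t + 1 / 2..t + 1}"
        by (rule nn_integral_cmult_indicator) simp
      also have "emeasure lborel {t + 1 / 2..t + 1} = ennreal (1 / 2)" by (subst emeasure_lborel_Icc) auto
      also have "ennreal E * ennreal (1 / 2) = ennreal (E * (1 / 2))"
        using a by (intro ennreal_mult[symmetric]) (auto simp: E_def)
      also have "E * (1 / 2) = (1 / C) powr \<eta> * (L * (1 + t) powr (1 - b * \<eta>))" by (simp add: E_def L_def)
      finally show ?thesis ..
    qed
    also have "\<dots> \<le> F w" unfolding F_def
    proof (rule nn_integral_mono)
      fix r :: real
      show "ennreal E * indicator {t + 1 / 2..t + 1} r \<le> enn_powr (?M w r) \<eta> *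
            ennreal (?d r) * indicator {0..} r"
      proof (cases "r \<in> {t + 1 / 2..t + 1}")
        case True
        then have r: "r \<ge> 0" "r \<ge> (1 + t) / 2" "(r - t)\<^sup>2 \<le> 1" using t
          by (auto simp: field_simps abs_square_le_1)
        have k0: "kern_profile \<alpha> p t r \<ge> 0" by (simp add: kern_profile_def)
        have "E \<le> (1 / C) powr \<eta> * H t r"
        proof -
          have "1 + r * t \<le> (1 + t)\<^sup>2" using True t mult_right_mono[of r "t + 1" t] by (simp add: power2_eq_square algebra_simps)
          then have "((1 + t)\<^sup>2) powr (- (b * \<eta>) / 2) \<le> (1 + r * t) powr (- (b * \<eta>) / 2)"
            using t b r q by (intro powr_mono2') (auto simp: add_pos_nonneg)
          moreover have "((1 + t)\<^sup>2) powr (- (b * \<eta>) / 2) = (1 + t) powr (- (b * \<eta>))"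
            using t by (simp add: powr_powr flip: powr_numeral)
          ultimately have p1: "(1 + t) powr (- (b * \<eta>)) \<le> (1 + r * t) powr (- (b * \<eta>) / 2)" by simp
          have p2: "exp (- (a / 2)) \<le> exp (- (a / 2) * (r - t)\<^sup>2)" using r(3) a by (simp add: mult_left_le)
          have "exp (- (a / 2)) * (1 + t) powr (- (b * \<eta>)) * (a * ((1 + t) / 2)) \<le> H t r"
            unfolding H_def using p1 p2 r a t by (intro mult_mono) auto
          moreover have "(1 + t) powr (1 - b * \<eta>) = (1 + t) powr (- (b * \<eta>)) * (1 + t)"
              using t powr_add[of "1 + t" "- (b * \<eta>)" 1] by simp
          ultimately have "exp (- (a / 2)) * a / 2 * (1 + t) powr (1 - b * \<eta>) \<le> H t r" by (simp add: mult_ac)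
          then show ?thesis unfolding E_def by (rule mult_left_mono) simp
        qed
        then have "ennreal E \<le> ennreal ((1 / C) powr \<eta> * (kern_profile \<alpha> p t r powr \<eta> * (?d r)))"
          unfolding pr[OF r(1) t] by (rule ennreal_leI)
        also have "\<dots> = enn_powr (ennreal (1 / C * kern_profile \<alpha> p t r)) \<eta> * ennreal (?d r)"
          using C(1) k0 r(1) q assms by (subst enn_powr_ennreal) (auto simp: ennreal_mult[symmetric] powr_mult[symmetric] mult.assoc)
        also have "\<dots> \<le> enn_powr (?M w r) \<eta> * ennreal (?d r)"
          using C(2)[OF r(1), of w] q by (intro mult_right_mono enn_powr_mono) (auto simp: t_def)
        finally show ?thesis using True r by simp
      qed simp
    qed
    finally show ?thesis by (simp add: t_def)
  qed
  define K where "K = max ((C powr \<eta> * D) powr (1 / \<eta>)) (1 / ((1 / C) powr \<eta> * L) powr (1 / \<eta>))"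
  have K: "K > 0" "(C powr \<eta> * D) powr (1 / \<eta>) \<le> K" "1 / K \<le> ((1 / C) powr \<eta> * L) powr (1 / \<eta>)"
  proof -
    have l: "((1 / C) powr \<eta> * L) powr (1 / \<eta>) > 0" using DL C(1) by simp
    then show "K > 0" by (simp add: K_def less_max_iff_disj)
    show "(C powr \<eta> * D) powr (1 / \<eta>) \<le> K" by (simp add: K_def)
    have "K > 0" using l by (simp add: K_def less_max_iff_disj)
    have "1 / ((1 / C) powr \<eta> * L) powr (1 / \<eta>) \<le> K" by (simp add: K_def)
    with \<open>K > 0\<close> have "1 / K \<le> 1 / (1 / ((1 / C) powr \<eta> * L) powr (1 / \<eta>))" using l \<open>K > 0\<close> by (intro divide_left_mono mult_pos_pos divide_pos_pos) auto
    then show "1 / K \<le> ((1 / C) powr \<eta> * L) powr (1 / \<eta>)" by simp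
  qed
  have root: "enn_powr (ennreal (c * (1 + norm w) powr (1 - b * \<eta>))) (1 / \<eta>) = ennreal (c powr (1 / \<eta>) * kern_weight p q (norm w))"
    if "c \<ge> 0" for c w
  proof -
    have "(kern_weight p q (norm w) powr \<eta>) powr (1 / \<eta>) = kern_weight p q (norm w)"
      using q by (simp add: powr_powr kern_weight_def)
    then show ?thesis using that unfolding W[symmetric] by (simp add: enn_powr_ennreal powr_mult kern_weight_def)
  qed
  have "comparable K (Fock_norm \<alpha> p q (kern \<alpha> w)) (ennreal (kern_weight p q (norm w)))" for w
    unfolding comparable_def Fock
  proof
    have W0: "kern_weight p q (norm w) \<ge> 0" by (simp add: kern_weight_def)
    have "enn_powr (F w) (1 / \<eta>) \<le> enn_powr (ennreal ((C powr \<eta> * D) * (1 + norm w) powr (1 - b * \<eta>))) (1 / \<eta>)"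
      using up[of w] q by (intro enn_powr_mono) (auto simp: mult.assoc)
    also have "\<dots> = ennreal ((C powr \<eta> * D) powr (1 / \<eta>) * kern_weight p q (norm w))"
      using DL by (intro root) auto
    also have "\<dots> \<le> ennreal (K * kern_weight p q (norm w))" using K W0 by (intro ennreal_leI mult_right_mono) auto
    finally show "enn_powr (F w) (1 / \<eta>) \<le> ennreal K * ennreal (kern_weight p q (norm w))"
      using K W0 by (simp add: ennreal_mult)
    have "ennreal (1 / K) * ennreal (kern_weight p q (norm w)) = ennreal (1 / K * kern_weight p q (norm w))"
      using K W0 by (simp add: ennreal_mult[symmetric])
    also have "\<dots> \<le> ennreal (((1 / C) powr \<eta> * L) powr (1 / \<eta>) * kern_weight p q (norm w))"
      using K W0 by (intro ennreal_leI mult_right_mono) auto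
    also have "\<dots> = enn_powr (ennreal (((1 / C) powr \<eta> * L) * (1 + norm w) powr (1 - b * \<eta>))) (1 / \<eta>)"
      using DL by (intro root[symmetric]) auto
    also have "\<dots> \<le> enn_powr (F w) (1 / \<eta>)"
      using lo[of w] q by (intro enn_powr_mono) (auto simp: mult.assoc)
    finally show "ennreal (1 / K) * ennreal (kern_weight p q (norm w)) \<le> enn_powr (F w) (1 / \<eta>)" .
  qed
  then show ?thesis using K(1) by blast
qed

lemma Fock_norm_kern:
  assumes "\<alpha> > 0" "p > 0" "q > 0"
  shows "\<exists>C>0. \<forall>w. comparable C (Fock_norm \<alpha> p q (kern \<alpha> w)) (ennreal (kern_weight p q (norm w)))"
  using Fock_norm_kern_infinite[OF assms(1,2)] Fock_norm_kern_finite[OF assms] by (cases "q = \<infinity>") auto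

section \<open>Borel measurability of the ball masses\<close>

lemma kern_measurable [measurable]:
  assumes [measurable]: "f \<in> borel_measurable M" "g \<in> borel_measurable M"
  shows "(\<lambda>x. norm (kern \<alpha> (f x) (g x))) \<in> borel_measurable M"
proof -
  have [measurable]: "(\<lambda>x. Re (f x)) \<in> borel_measurable M" "(\<lambda>x. Im (f x)) \<in> borel_measurable M"
    "(\<lambda>x. Re (g x)) \<in> borel_measurable M" "(\<lambda>x. Im (g x)) \<in> borel_measurable M"
    by (auto intro!: borel_measurable_continuous_on[OF _ assms(1)] borel_measurable_continuous_on[OF _ assms(2)] continuous_intros)
  have "norm (kern \<alpha> (f x) (g x)) = exp (\<alpha> * (Re (f x) * Re (g x) + Im (f x) * Im (g x)) - \<alpha> / 2 * (norm (f x))\<^sup>2)" for x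
    by (simp add: norm_kern)
  then show ?thesis by simp
qed

lemma polar_measurable [measurable]:
  assumes [measurable]: "f \<in> borel_measurable M" "g \<in> borel_measurable M"
  shows "(\<lambda>x. complex_of_real (f x) * cis (g x)) \<in> borel_measurable M"
proof -
  have "(\<lambda>x. cis (g x)) \<in> borel_measurable M"
    by (rule borel_measurable_continuous_on[OF _ assms(2)]) (intro continuous_intros)
  moreover have "(\<lambda>x. complex_of_real (f x)) \<in> borel_measurable M"
    by (rule borel_measurable_continuous_on[OF _ assms(1)]) (intro continuous_intros)
  ultimately show ?thesis by simp
qed

text \<open>Joint measurability permits integration in r with \<open>w\<close> as a parameter. For p
  = \<infinity> the uncountable supremum is replaced by its closed form, which holds for r \<ge> 0;
  hence the indicator.\<close>

lemma int_mean_kern_measurable: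
  assumes "\<alpha> > 0"
  shows "(\<lambda>(w, r). int_mean p (kern \<alpha> w) r * indicator {0..} r) \<in> borel_measurable (borel \<Otimes>\<^sub>M borel)"
proof (cases "p = \<infinity>")
  case True
  have e: "int_mean p (kern \<alpha> w) r * indicator {0..} r = ennreal (kern_profile \<alpha> p (norm w) r) * indicator {0..} r" for w r
    using assms True int_mean_kern_infinite[of r \<alpha> w] by (cases "r \<ge> 0") auto
  show ?thesis unfolding e kern_profile_def by measurable
next
  case False
  define P where "P = enn2real p"
  have e: "int_mean p (kern \<alpha> w) r =
      enn_powr (ennreal (1 / (2 * pi)) *
        (\<integral>\<^sup>+ \<theta>. ennreal (norm (kern \<alpha> w (of_real r * cis \<theta>)) powr P) * indicator {0..2 * pi} \<theta> \<partial>lborel)) (1 / P)" for w r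
    using False by (simp add: int_mean_def P_def)
  have [measurable]: "(\<lambda>(v, \<theta>). ennreal (norm (kern \<alpha> (fst v) (of_real (snd v) * cis \<theta>)) powr P) * indicator {0..2 * pi} \<theta>)
      \<in> borel_measurable ((borel \<Otimes>\<^sub>M borel) \<Otimes>\<^sub>M lborel)"
    by measurable
  have [measurable]: "(\<lambda>v. \<integral>\<^sup>+ \<theta>. ennreal (norm (kern \<alpha> (fst v) (of_real (snd v) * cis \<theta>)) powr P) * indicator {0..2 * pi} \<theta> \<partial>lborel)
      \<in> borel_measurable (borel \<Otimes>\<^sub>M borel)"
    by (rule lborel.borel_measurable_nn_integral) simp
  show ?thesis unfolding e split_beta' by measurable
qed

text \<open>On a fixed circle the modulus of the kernel at \<open>w\<close> is at least a factor
  times that of the kernel at \<open>v\<close>, and the factor tends to 1 as w tends to v. This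
  yields lower semicontinuity in \<open>w\<close>, needed for a supremum over uncountably many
  radii.\<close>

lemma int_mean_kern_dominates:
  assumes "\<alpha> > 0" "p > 0" "r \<ge> 0"
  shows "ennreal (exp (- \<alpha> * norm (w - v) * r - \<alpha> / 2 * ((norm w)\<^sup>2 - (norm v)\<^sup>2))) * int_mean p (kern \<alpha> v) r
    \<le> int_mean p (kern \<alpha> w) r"
proof -
  define c where "c = exp (- \<alpha> * norm (w - v) * r - \<alpha> / 2 * ((norm w)\<^sup>2 - (norm v)\<^sup>2))"
  have c: "c > 0" by (simp add: c_def)
  have le: "c * norm (kern \<alpha> v (of_real r * cis \<theta>)) \<le> norm (kern \<alpha> w (of_real r * cis \<theta>))" for \<theta>
  proof -
    define z where "z = of_real r * cis \<theta>"
    have "Re (cnj (v - w) * z) \<le> norm (cnj (v - w) * z)" by (rule complex_Re_le_cmod)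
    also have "\<dots> = norm (v - w) * norm z" by (simp only: norm_mult complex_mod_cnj)
    also have "\<dots> = norm (w - v) * r" using assms by (simp add: norm_mult z_def norm_minus_commute)
    finally have "\<alpha> * (Re (cnj v * z) - Re (cnj w * z)) \<le> \<alpha> * (norm (w - v) * r)"
      using assms by (intro mult_left_mono) (auto simp: algebra_simps)
    then show ?thesis unfolding z_def[symmetric] norm_kern c_def
      by (simp add: exp_add[symmetric] algebra_simps diff_divide_distrib)
  qed
  have "ennreal c * int_mean p (kern \<alpha> v) r \<le> int_mean p (kern \<alpha> w) r"
  proof (cases "p = \<infinity>")
    case True
    have "ennreal c * (SUP \<theta>. ennreal (norm (kern \<alpha> v (of_real r * cis \<theta>))))
        = (SUP \<theta>. ennreal c * ennreal (norm (kern \<alpha> v (of_real r * cis \<theta>))))"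
      by (rule SUP_mult_left_ennreal)
    also have "\<dots> \<le> (SUP \<theta>. ennreal (norm (kern \<alpha> w (of_real r * cis \<theta>))))"
    proof (rule SUP_subset_mono[OF subset_refl])
      fix \<theta>
      show "ennreal c * ennreal (norm (kern \<alpha> v (of_real r * cis \<theta>))) \<le> ennreal (norm (kern \<alpha> w (of_real r * cis \<theta>)))"
        using le[of \<theta>] c by (simp add: ennreal_mult[symmetric] ennreal_leI)
    qed
    finally show ?thesis using True by (simp add: int_mean_def)
  next
    case False
    note P = finite_exponent[OF assms(2) False]
    define P where "P = enn2real p"
    have [simp]: "P > 0" "P \<noteq> 0" "P \<ge> 0" using P by (auto simp: P_def)
    have "ennreal c = enn_powr (ennreal (c powr P)) (1 / P)" using c by (simp add: enn_powr_ennreal powr_powr)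
    moreover have "ennreal (c powr P) * (\<integral>\<^sup>+ \<theta>\<in>{0..2 * pi}. ennreal (norm (kern \<alpha> v (of_real r * cis \<theta>)) powr P) \<partial>lborel)
       \<le> (\<integral>\<^sup>+ \<theta>\<in>{0..2 * pi}. ennreal (norm (kern \<alpha> w (of_real r * cis \<theta>)) powr P) \<partial>lborel)"
    proof (subst nn_integral_cmult[symmetric], measurable, intro nn_integral_mono)
      fix \<theta> :: real
      have "(c * norm (kern \<alpha> v (of_real r * cis \<theta>))) powr P \<le> norm (kern \<alpha> w (of_real r * cis \<theta>)) powr P"
        using c by (intro powr_mono2 le) auto
      then show "ennreal (c powr P) * (ennreal (norm (kern \<alpha> v (of_real r * cis \<theta>)) powr P) * indicator {0..2 * pi} \<theta>)
         \<le> ennreal (norm (kern \<alpha> w (of_real r * cis \<theta>)) powr P) * indicator {0..2 * pi} \<theta>"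
        by (simp add: powr_mult ennreal_mult[symmetric] mult.assoc[symmetric] ennreal_leI mult_right_mono)
    qed
    ultimately show ?thesis using False unfolding int_mean_def P_def[symmetric]
      by (simp add: enn_powr_mult[symmetric] mult.left_commute[of "ennreal (c powr P)"])
         (intro enn_powr_mono mult_left_mono, auto)
  qed
  then show ?thesis by (simp add: c_def)
qed

text \<open>Lower semicontinuity survives arbitrary suprema, which Borel measurability does
  not.\<close>

lemma open_superlevel_measurable:
  fixes f :: "'a :: topological_space \<Rightarrow> ennreal"
  assumes "\<And>c x. c < f x \<Longrightarrow> eventually (\<lambda>y. c < f y) (nhds x)"
  shows "f \<in> borel_measurable borel"
proof (rule borel_measurableI_greater)
  fix c
  have "open {x. c < f x}"
  proof (rule open_subopen[THEN iffD2], intro ballI)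
    fix x assume "x \<in> {x. c < f x}"
    then show "\<exists>T. open T \<and> x \<in> T \<and> T \<subseteq> {x. c < f x}"
      using assms[of c x] unfolding eventually_nhds by blast
  qed
  then show "{x \<in> space borel. c < f x} \<in> sets borel" by simp
qed

lemma Fock_norm_kern_measurable:
  assumes "\<alpha> > 0" "p > 0" "q > 0"
  shows "(\<lambda>w. Fock_norm \<alpha> p q (kern \<alpha> w)) \<in> borel_measurable borel"
proof (cases "q = \<infinity>")
  case True
  define E where "E w r = int_mean p (kern \<alpha> w) r * ennreal (exp (- (\<alpha> / 2) * r\<^sup>2))" for w r
  have F: "Fock_norm \<alpha> p q (kern \<alpha> w) = (SUP r\<in>{0..}. E w r)" for w
    using True by (simp add: Fock_norm_def E_def)
  show ?thesis unfolding F
  proof (rule open_superlevel_measurable)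
    fix c v assume "c < (SUP r\<in>{0..}. E v r)"
    then obtain r where r: "r \<ge> 0" "c < E v r" by (auto simp: less_SUP_iff)
    obtain x where "int_mean p (kern \<alpha> v) r \<le> ennreal x" using int_mean_kern[OF assms(1,2)] r(1) by blast
    then have "int_mean p (kern \<alpha> v) r < top" by (rule le_less_trans) simp
    then have fin: "E v r < top" by (simp add: E_def ennreal_mult_less_top)
    \<comment> \<open>A single radius that beats \<open>c\<close> at \<open>v\<close> still beats it
      at all nearby \<open>w\<close>, since this factor is continuous and equals 1 at
      \<open>v\<close>.\<close>
    define \<rho> where "\<rho> w = exp (- \<alpha> * norm (w - v) * r - \<alpha> / 2 * ((norm w)\<^sup>2 - (norm v)\<^sup>2))" for w
    define e where "e = enn2real (E v r)"
    have e: "E v r = ennreal e" "e \<ge> 0" using fin by (auto simp: e_def)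
    have "isCont (\<lambda>w. \<rho> w * e) v" unfolding \<rho>_def by (intro continuous_intros)
    then have "((\<lambda>w. ennreal (\<rho> w * e)) \<longlongrightarrow> ennreal (\<rho> v * e)) (nhds v)"
      unfolding isCont_def tendsto_at_iff_tendsto_nhds[where g="\<lambda>w. \<rho> w * e"] by (rule tendsto_ennrealI)
    moreover have "c < ennreal (\<rho> v * e)" using r e by (simp add: \<rho>_def)
    ultimately have "eventually (\<lambda>w. c < ennreal (\<rho> w * e)) (nhds v)" by (rule order_tendstoD)
    then show "eventually (\<lambda>w. c < (SUP r\<in>{0..}. E w r)) (nhds v)"
    proof (rule eventually_mono)
      fix w assume "c < ennreal (\<rho> w * e)"
      also have "ennreal (\<rho> w * e) = ennreal (\<rho> w) * E v r" using e by (simp add: ennreal_mult \<rho>_def)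
      also have "\<dots> \<le> E w r" unfolding E_def \<rho>_def mult.assoc[symmetric]
        using int_mean_kern_dominates[OF assms(1,2) r(1)] by (intro mult_right_mono) auto
      also have "\<dots> \<le> (SUP r\<in>{0..}. E w r)" using r(1) by (intro SUP_upper) auto
      finally show "c < (SUP r\<in>{0..}. E w r)" .
    qed
  qed
next
  case False
  define \<eta> where "\<eta> = enn2real q"
  have \<eta>: "\<eta> > 0" using finite_exponent[OF assms(3) False] by (simp add: \<eta>_def)
  note [measurable] = int_mean_kern_measurable[OF assms(1), of p]
  have F: "Fock_norm \<alpha> p q (kern \<alpha> w) = enn_powr
        (\<integral>\<^sup>+ r. enn_powr (case (w, r) of (w, r) \<Rightarrow> int_mean p (kern \<alpha> w) r * indicator {0..} r) \<eta> *
            ennreal (\<alpha> * \<eta> * exp (- (\<alpha> * \<eta> / 2) * r\<^sup>2) * r) \<partial>lborel) (1 / \<eta>)" for w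
  proof -
    have "(\<integral>\<^sup>+ r\<in>{0..}. enn_powr (int_mean p (kern \<alpha> w) r) \<eta> * ennreal (\<alpha> * \<eta> * exp (- (\<alpha> * \<eta> / 2) * r\<^sup>2) * r) \<partial>lborel) =
       (\<integral>\<^sup>+ r. enn_powr (case (w, r) of (w, r) \<Rightarrow> int_mean p (kern \<alpha> w) r * indicator {0..} r) \<eta> *
            ennreal (\<alpha> * \<eta> * exp (- (\<alpha> * \<eta> / 2) * r\<^sup>2) * r) \<partial>lborel)"
      by (intro nn_integral_cong) (auto split: split_indicator)
    then show ?thesis using False by (simp add: Fock_norm_def \<eta>_def)
  qed
  show ?thesis unfolding F by measurable
qed

text \<open>The ball is exhausted from inside by smaller concentric balls, and each of these is
  contained in every ball of radius \<open>R\<close> whose centre is close enough. Continuity from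
  below then gives lower semicontinuity.\<close>

lemma ball_emeasure_measurable:
  fixes \<mu> :: "'a :: metric_space measure"
  assumes "sets \<mu> = sets borel"
  shows "(\<lambda>\<zeta>. emeasure \<mu> (ball \<zeta> R)) \<in> borel_measurable borel"
proof (rule open_superlevel_measurable)
  fix c \<zeta> assume c: "c < emeasure \<mu> (ball \<zeta> R)"
  define B where "B n = ball \<zeta> (R - 1 / (real n + 1))" for n :: nat
  have "(\<Union>n. B n) = ball \<zeta> R"
  proof (intro equalityI subsetI)
    fix x assume "x \<in> ball \<zeta> R"
    then have "0 < R - dist \<zeta> x" by simp
    then obtain n where "inverse (real (Suc n)) < R - dist \<zeta> x" using reals_Archimedean by blast
    then show "x \<in> (\<Union>n. B n)" by (auto simp: B_def inverse_eq_divide add.commute intro!: exI[of _ n])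
  qed (auto simp: B_def intro: less_le_trans)
  moreover have "incseq B"
    unfolding incseq_def B_def
  proof (intro allI impI subset_ball)
    fix m n :: nat assume "m \<le> n"
    then have "1 / (real n + 1) \<le> 1 / (real m + 1)" by (intro divide_left_mono) auto
    then show "R - 1 / (real m + 1) \<le> R - 1 / (real n + 1)" by simp
  qed
  moreover have "range B \<subseteq> sets \<mu>"
  proof -
    have "B n \<in> sets borel" for n unfolding B_def by (rule borel_open) (rule open_ball)
    then show ?thesis unfolding assms by blast
  qed
  ultimately have "emeasure \<mu> (ball \<zeta> R) = (SUP n. emeasure \<mu> (B n))"
    using SUP_emeasure_incseq[of B \<mu>] by simp
  then obtain n where n: "c < emeasure \<mu> (B n)" using c by (auto simp: less_SUP_iff)
  have "eventually (\<lambda>y. y \<in> ball \<zeta> (1 / (real n + 1))) (nhds \<zeta>)"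
    by (intro eventually_nhds_in_open) auto
  then show "eventually (\<lambda>y. c < emeasure \<mu> (ball y R)) (nhds \<zeta>)"
  proof (rule eventually_mono)
    fix y assume y: "y \<in> ball \<zeta> (1 / (real n + 1))"
    have "B n \<subseteq> ball y R"
    proof
      fix x assume "x \<in> B n"
      then show "x \<in> ball y R" using y dist_triangle[of y x \<zeta>] by (simp add: B_def dist_commute)
    qed
    then have "emeasure \<mu> (B n) \<le> emeasure \<mu> (ball y R)" using assms by (intro emeasure_mono) auto
    with n show "c < emeasure \<mu> (ball y R)" by (rule less_le_trans)
  qed
qed

lemma ball_mass_measurable:
  assumes "\<alpha> > 0" "p > 0" "q > 0" "sets \<mu> = sets borel"
  shows "ball_mass \<alpha> p q s \<mu> R \<in> borel_measurable borel"
proof -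
  note [measurable] = ball_emeasure_measurable[OF assms(4)] Fock_norm_kern_measurable[OF assms(1-3)]
  show ?thesis unfolding ball_mass_def[abs_def] divide_ennreal_def by measurable
qed

subsection \<open>Absolute sums and random signs\<close>

text \<open>The bound holds for finite subsums and passes to the limit; the right-hand side may be
  \<open>top\<close>.\<close>

lemma has_sum_norm_le:
  fixes g :: "'i \<Rightarrow> 'a :: real_normed_vector"
  assumes "(g has_sum x) A"
  shows "ennreal (norm x) \<le> (\<Sum>\<^sup>+i\<in>A. ennreal (norm (g i)))"
proof (rule tendsto_upperbound)
  have "(sum g \<longlongrightarrow> x) (finite_subsets_at_top A)" using assms by (simp add: has_sum_def)
  then show "((\<lambda>F. ennreal (norm (sum g F))) \<longlongrightarrow> ennreal (norm x)) (finite_subsets_at_top A)"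
    by (intro tendsto_ennrealI tendsto_norm)
  show "eventually (\<lambda>F. ennreal (norm (sum g F)) \<le> (\<Sum>\<^sup>+i\<in>A. ennreal (norm (g i)))) (finite_subsets_at_top A)"
  proof (rule eventually_finite_subsets_at_top_weakI)
    fix F assume F: "finite F" "F \<subseteq> A"
    have "ennreal (norm (sum g F)) \<le> ennreal (\<Sum>i\<in>F. norm (g i))" by (intro ennreal_leI norm_sum)
    also have "\<dots> = (\<Sum>\<^sup>+i\<in>F. ennreal (norm (g i)))"
      using F by (simp add: nn_integral_count_space_finite)
    also have "\<dots> \<le> (\<Sum>\<^sup>+i\<in>A. ennreal (norm (g i)))"
      by (rule nn_integral_count_space_mono_set[OF F(2)])
    finally show "ennreal (norm (sum g F)) \<le> \<dots>" .
  qed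
qed simp

text \<open>
  After normalising the right-hand side to \<open>1\<close>, each term obeys \<open>a * G \<le> G + a\<^sup>s * G\<close> if \<open>s \<ge> 1\<close>,
  and \<open>a * G \<le> (a * G)\<^sup>s\<close> if \<open>s \<le> 1\<close>.
\<close>

lemma power_of_sum_le:
  fixes a G :: "'i \<Rightarrow> ennreal"
  assumes s: "0 < s" and A: "(\<Sum>\<^sup>+i\<in>I. G i) \<le> A"
  shows "enn_powr (\<Sum>\<^sup>+i\<in>I. a i * G i) s
    \<le> enn_powr (A + 1) s * (\<Sum>\<^sup>+i\<in>I. enn_powr (a i) s * enn_powr (G i) (min 1 s))"
    (is "enn_powr ?L s \<le> _ * ?R")
proof -
  consider "?R = 0" | "?R = top" | "?R \<noteq> 0" "?R \<noteq> top" by blast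
  then show ?thesis
  proof cases
    case 1
    then have "a i * G i = 0" if "i \<in> I" for i
      using that by (auto simp: nn_integral_0_iff_AE AE_count_space)
    then have "?L = (\<Sum>\<^sup>+i\<in>I. 0)" by (intro nn_integral_cong) auto
    then show ?thesis by simp
  next
    case 2
    have "enn_powr (A + 1) s \<noteq> 0" by simp
    then show ?thesis using 2 by (simp add: ennreal_mult_top)
  next
    case 3
    define r where "r = ?R"
    have r: "r \<noteq> 0" "r \<noteq> top" using 3 by (auto simp: r_def)
    \<comment> \<open>Dividing \<open>a\<close> by \<open>T\<close> scales the right-hand sum to 1.
      The rescaled left sum is then at most \<open>A + 1\<close>, with \<open>A\<close> from the sum
      of \<open>G\<close> and 1 from the normalised sum.\<close>
    define T where "T = enn_powr r (1 / s)"
    have T: "T \<noteq> 0" "T \<noteq> top" "enn_powr T s = r" using r s by (auto simp: T_def enn_powr_inverse)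
    have inv: "T * inverse T = 1" using T by (simp add: less_top divide_ennreal_def[symmetric] ennreal_divide_self)
    define b where "b i = inverse T * a i" for i
    have ab: "a i = T * b i" for i unfolding b_def by (simp add: mult.assoc[symmetric] inv)
    have "r = (\<Sum>\<^sup>+i\<in>I. enn_powr (a i) s * enn_powr (G i) (min 1 s))" by (rule r_def)
    also have "\<dots> = (\<Sum>\<^sup>+i\<in>I. r * (enn_powr (b i) s * enn_powr (G i) (min 1 s)))"
      unfolding ab enn_powr_mult[OF s] T(3) mult.assoc ..
    also have "\<dots> = r * (\<Sum>\<^sup>+i\<in>I. enn_powr (b i) s * enn_powr (G i) (min 1 s))"
      by (simp add: nn_integral_cmult)
    finally have "r * 1 = r * (\<Sum>\<^sup>+i\<in>I. enn_powr (b i) s * enn_powr (G i) (min 1 s))" by simp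
    then have b1: "(\<Sum>\<^sup>+i\<in>I. enn_powr (b i) s * enn_powr (G i) (min 1 s)) = 1"
      using r by (subst (asm) ennreal_mult_cancel_left) auto
    have "(\<Sum>\<^sup>+i\<in>I. b i * G i) \<le> A + 1"
    proof (cases "s \<le> 1")
      case True
      then have e: "enn_powr (b i) s * enn_powr (G i) (min 1 s) = enn_powr (b i * G i) s" for i
        using s by (simp add: enn_powr_mult min_def)
      have "b i * G i \<le> enn_powr (b i * G i) s" if "i \<in> I" for i
      proof -
        have "enn_powr (b i * G i) s \<le> (\<Sum>\<^sup>+j\<in>I. enn_powr (b j * G j) s)"
          by (rule nn_integral_ge_point[OF that])
        then have "enn_powr (b i * G i) s \<le> 1" using b1 e by simp
        then have "b i * G i \<le> 1" using enn_powr_mono[of "enn_powr (b i * G i) s" 1 "1 / s"] s by (simp add: enn_powr_inverse)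
        then obtain x where x: "b i * G i = ennreal x" "0 \<le> x" "x \<le> 1" by (cases "b i * G i") (auto simp: top_unique)
        have "x \<le> x powr s"
          using powr_mono'[of s 1 x] True x by (cases "x = 0") auto
        then show ?thesis using x by (simp add: enn_powr_ennreal ennreal_leI)
      qed
      then have "(\<Sum>\<^sup>+i\<in>I. b i * G i) \<le> 1"
        unfolding b1[unfolded e, symmetric] by (intro nn_integral_mono) auto
      then show ?thesis by (simp add: add_increasing)
    next
      case False
      have "b i * G i \<le> G i + enn_powr (b i) s * G i" for i
      proof (cases "b i \<le> 1")
        case True
        then have "b i * G i \<le> G i" using mult_right_mono[of "b i" 1 "G i"] by simp
        then show ?thesis by (simp add: add_increasing2)
      next
        case gt: False
        have "b i \<le> enn_powr (b i) s"
        proof (cases "b i")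
          case (real x)
          then have "x > 1" using gt by (simp add: ennreal_le_1)
          then have "x powr 1 \<le> x powr s" using False by (intro powr_mono) auto
          then show ?thesis using real \<open>x > 1\<close> by (simp add: enn_powr_ennreal ennreal_leI)
        qed simp
        then have "b i * G i \<le> enn_powr (b i) s * G i" by (rule mult_right_mono) simp
        then show ?thesis by (simp add: add_increasing)
      qed
      then have "(\<Sum>\<^sup>+i\<in>I. b i * G i) \<le> (\<Sum>\<^sup>+i\<in>I. G i + enn_powr (b i) s * G i)"
        by (intro nn_integral_mono) auto
      also have "\<dots> = (\<Sum>\<^sup>+i\<in>I. G i) + (\<Sum>\<^sup>+i\<in>I. enn_powr (b i) s * G i)"
        by (rule nn_integral_add) auto
      also have "\<dots> \<le> A + 1" using A b1 False by (intro add_mono) (auto simp: min_def)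
      finally show ?thesis .
    qed
    moreover have "?L = T * (\<Sum>\<^sup>+i\<in>I. b i * G i)"
      unfolding ab mult.assoc by (rule nn_integral_cmult) simp
    ultimately have "?L \<le> T * (A + 1)" by (simp add: mult_left_mono)
    then have "enn_powr ?L s \<le> enn_powr (T * (A + 1)) s" using s by (intro enn_powr_mono) auto
    then show ?thesis using s by (simp add: enn_powr_mult T(3) mult.commute r_def)
  qed
qed

lemma nn_integral_count_space_Union_disjoint:
  fixes f :: "'i \<Rightarrow> ennreal" and S :: "nat \<Rightarrow> 'i set"
  assumes "disjoint_family S" "countable (\<Union>k. S k)"
  shows "(\<Sum>\<^sup>+i\<in>(\<Union>k. S k). f i) = (\<Sum>\<^sup>+k\<in>UNIV. (\<Sum>\<^sup>+i\<in>S k. f i))"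
proof -
  let ?U = "\<Union>k. S k"
  have "(\<Sum>\<^sup>+i\<in>?U. f i) = (\<Sum>\<^sup>+i\<in>?U. (\<Sum>\<^sup>+k\<in>UNIV. f i * indicator (S k) i))"
  proof (rule nn_integral_cong)
    fix i assume "i \<in> space (count_space ?U)"
    then obtain k0 where k0: "i \<in> S k0" by auto
    have "i \<in> S k \<longleftrightarrow> k = k0" for k using assms(1) k0 unfolding disjoint_family_on_def by blast
    then have "(\<Sum>\<^sup>+k\<in>UNIV. f i * indicator (S k) i) = (\<Sum>\<^sup>+k\<in>UNIV. f i * indicator {k0} k)"
      by (intro nn_integral_cong) (simp add: indicator_def)
    then show "f i = (\<Sum>\<^sup>+k\<in>UNIV. f i * indicator (S k) i)"
      by (simp add: nn_integral_indicator_singleton)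
  qed
  also have "\<dots> = (\<Sum>\<^sup>+k\<in>UNIV. (\<Sum>\<^sup>+i\<in>?U. f i * indicator (S k) i))"
    using assms(2) by (intro nn_integral_count_space_nn_integral) auto
  also have "\<dots> = (\<Sum>\<^sup>+k\<in>UNIV. (\<Sum>\<^sup>+i\<in>S k. f i))"
  proof (rule nn_integral_cong)
    fix k
    have "(\<Sum>\<^sup>+i\<in>?U. f i * indicator (S k) i) = (\<Sum>\<^sup>+i\<in>S k. f i * indicator (S k) i)"
      by (intro nn_integral_count_space_eq) (auto split: split_indicator)
    also have "\<dots> = (\<Sum>\<^sup>+i\<in>S k. f i)" by (intro nn_integral_cong) auto
    finally show "(\<Sum>\<^sup>+i\<in>?U. f i * indicator (S k) i) = (\<Sum>\<^sup>+i\<in>S k. f i)" .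
  qed
  finally show ?thesis .
qed

text \<open>A choice of signs is encoded by the set where the sign is +1, so averaging over all
  signs is summing over \<open>Pow F\<close>.\<close>

definition sgn_on :: "'i set \<Rightarrow> 'i \<Rightarrow> complex" where
  "sgn_on A i = (if i \<in> A then 1 else - 1)"

lemma norm_sgn_on [simp]: "norm (sgn_on A i) = 1"
  by (simp add: sgn_on_def)

text \<open>
  Flipping the sign of one term changes the sum by twice that term, so one of the two
  sums is at least as large as the term. This one-sided estimate replaces Khinchine's inequality.
\<close>

lemma random_sign_bound:
  fixes a :: "'i \<Rightarrow> complex"
  assumes "finite F" "j \<in> F" "s > 0"
  shows "2 ^ card F * norm (a j) powr s \<le> 2 * (\<Sum>A\<in>Pow F. norm (\<Sum>i\<in>F. sgn_on A i * a i) powr s)"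
proof -
  define f where "f A = (\<Sum>i\<in>F. sgn_on A i * a i)" for A
  \<comment> \<open>An involution of \<open>Pow F\<close> that flips the sign at \<open>j\<close>
    only; reindexing by it makes the two halves of the final sum equal.\<close>
  define \<tau> where "\<tau> A = (if j \<in> A then A - {j} else insert j A)" for A
  have f: "f A = sgn_on A j * a j + (\<Sum>i\<in>F - {j}. sgn_on A i * a i)" for A
    unfolding f_def using assms by (intro sum.remove) auto
  have "(\<Sum>i\<in>F - {j}. sgn_on (\<tau> A) i * a i) = (\<Sum>i\<in>F - {j}. sgn_on A i * a i)" for A
    by (intro sum.cong) (auto simp: sgn_on_def \<tau>_def)
  moreover have "sgn_on (\<tau> A) j = - sgn_on A j" for A by (simp add: sgn_on_def \<tau>_def)
  ultimately have diff: "f A - f (\<tau> A) = 2 * (sgn_on A j * a j)" for A by (simp add: f)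
  have "norm (a j) powr s \<le> norm (f A) powr s + norm (f (\<tau> A)) powr s" for A
  proof -
    have "2 * norm (a j) = norm (f A - f (\<tau> A))" by (simp add: diff norm_mult)
    also have "\<dots> \<le> norm (f A) + norm (f (\<tau> A))" by (rule norm_triangle_ineq4)
    finally have "norm (a j) \<le> norm (f A) \<or> norm (a j) \<le> norm (f (\<tau> A))" by linarith
    then have "norm (a j) powr s \<le> norm (f A) powr s \<or> norm (a j) powr s \<le> norm (f (\<tau> A)) powr s"
      using assms(3) by (auto intro: powr_mono2)
    then show ?thesis by (auto intro: add_increasing add_increasing2)
  qed
  then have "(\<Sum>A\<in>Pow F. norm (a j) powr s) \<le> (\<Sum>A\<in>Pow F. norm (f A) powr s + norm (f (\<tau> A)) powr s)"
    by (rule sum_mono)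
  also have "\<dots> = (\<Sum>A\<in>Pow F. norm (f A) powr s) + (\<Sum>A\<in>Pow F. norm (f (\<tau> A)) powr s)"
    by (rule sum.distrib)
  also have "(\<Sum>A\<in>Pow F. norm (f (\<tau> A)) powr s) = (\<Sum>A\<in>Pow F. norm (f A) powr s)"
    using assms(2) by (intro sum.reindex_bij_witness[of _ \<tau> \<tau>]) (auto simp: \<tau>_def)
  finally show ?thesis using assms(1) by (simp add: f_def card_Pow)
qed

subsection \<open>The Schur test on the tiling\<close>

lemma kern_weight_pos: "0 \<le> t \<Longrightarrow> 0 < kern_weight p q t"
  by (simp add: kern_weight_def)

text \<open>On a shell 1 + |\<zeta>| and 1 + k differ by a factor at most 2, so the weight may be
  frozen at the inner circle.\<close>

lemma kern_weight_shell:
  fixes p q :: ennreal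
  assumes "\<zeta> \<in> annulus k"
  defines "D \<equiv> 2 powr \<bar>enn2real (1 / q) - enn2real (1 / p)\<bar>"
  shows "kern_weight p q (norm \<zeta>) \<le> D * kern_weight p q (real k)"
    and "kern_weight p q (real k) \<le> D * kern_weight p q (norm \<zeta>)"
proof -
  define \<tau> where "\<tau> = enn2real (1 / q) - enn2real (1 / p)"
  have t: "real k \<le> norm \<zeta>" "norm \<zeta> < real k + 1" using assms by (auto simp: annulus_def)
  have *: "x powr \<tau> \<le> 2 powr \<bar>\<tau>\<bar> * y powr \<tau>" if "0 < x" "0 < y" "x \<le> 2 * y" "y \<le> 2 * x" for x y :: real
  proof -
    have "x powr \<tau> = (x / y) powr \<tau> * y powr \<tau>" using that by (simp add: powr_divide)
    also have "(x / y) powr \<tau> \<le> 2 powr \<bar>\<tau>\<bar>"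
    proof (cases "\<tau> \<ge> 0")
      case True
      then show ?thesis using that by (auto intro!: powr_mono2 simp: divide_le_eq)
    next
      case False
      have "(x / y) powr \<tau> = (y / x) powr \<bar>\<tau>\<bar>" using that False by (simp add: powr_divide powr_minus field_simps)
      also have "\<dots> \<le> 2 powr \<bar>\<tau>\<bar>" using that by (auto intro!: powr_mono2 simp: divide_le_eq)
      finally show ?thesis .
    qed
    finally show ?thesis by (simp add: mult_right_mono)
  qed
  show "kern_weight p q (norm \<zeta>) \<le> D * kern_weight p q (real k)"
    "kern_weight p q (real k) \<le> D * kern_weight p q (norm \<zeta>)"
    unfolding kern_weight_def D_def \<tau>_def[symmetric] using t by (auto intro!: *)
qed

text \<open>\<open>synth\<close> supplies test functions of controlled norm, and
  \<open>recon\<close> supplies coefficients of nearly minimal norm, both at the fixed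
  \<delta>.\<close>

locale carleson_setting = tiling +
  fixes \<alpha> s c_in C_out R :: real and p q :: ennreal
  assumes \<alpha>: "\<alpha> > 0" and p: "p > 0" and q: "q > 0" and s: "s > 0"
    and pconsts: "pocket_constants c_in C_out" and R: "R > C_out * \<delta>"
    and synth: "\<exists>C::real. \<forall>c\<in>lw_space p q \<delta>. \<exists>f\<in>Fock_space \<alpha> p q.
            synthesizes \<alpha> \<delta> c f \<and> Fock_norm \<alpha> p q f \<le> ennreal C * lw_norm p q \<delta> c"
    and recon: "\<exists>C>0. \<forall>f\<in>Fock_space \<alpha> p q.
            comparable C (Fock_norm \<alpha> p q f)
              (INF c\<in>{c \<in> lw_space p q \<delta>. synthesizes \<alpha> \<delta> c f}. lw_norm p q \<delta> c)"
begin

abbreviation "\<zeta> \<equiv> center \<delta>"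
abbreviation "S \<equiv> shell_pockets \<delta>"
text \<open>Balls of radius \<open>\<rho>\<close> around the centres cover the plane; those of
  radius \<open>\<epsilon>\<close> are pairwise disjoint and stay inside their shells.\<close>

definition "\<rho> = C_out * \<delta>"
definition "\<epsilon> = c_in * \<delta>"
definition wt :: "nat \<Rightarrow> real" where "wt k = kern_weight p q (real k)"
definition \<tau> :: real where "\<tau> = enn2real (1 / q) - enn2real (1 / p)"

abbreviation "seq_norm \<equiv> mix_norm S p q"
abbreviation "dual_norm \<equiv> mix_norm S (star_exp s p) (star_exp s q)"

abbreviation "Fnorm \<equiv> Fock_norm \<alpha> p q"
abbreviation "Fspace \<equiv> Fock_space \<alpha> p q"
abbreviation "lwn \<equiv> lw_norm p q \<delta>"
abbreviation "emb \<mu> \<equiv> enn_powr (embedding_norm \<alpha> p q s \<mu>) s"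
abbreviation "bmass \<mu> \<equiv> ball_mass \<alpha> p q s \<mu> R"
abbreviation "pmass \<mu> \<equiv> pocket_mass \<alpha> p q s \<delta> \<mu> R"

lemmas star_pos = star_exp_pos[OF s, of p] star_exp_pos[OF s, of q]

lemma wt_pos: "wt k > 0"
  by (simp add: wt_def kern_weight_pos)

lemma radii: "0 < \<epsilon>" "\<epsilon> < \<rho>" "\<rho> < R" "0 < R"
  using pconsts \<delta> R by (auto simp: pocket_constants_def \<rho>_def \<epsilon>_def)
     (smt (verit) mult_pos_pos)

lemma ball_in_pocket: "Q \<in> pockets \<delta> \<Longrightarrow> ball (\<zeta> Q) \<epsilon> \<subseteq> pocket \<delta> Q"
  and pocket_in_ball: "Q \<in> pockets \<delta> \<Longrightarrow> pocket \<delta> Q \<subseteq> ball (\<zeta> Q) \<rho>"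
  using pconsts \<delta> unfolding pocket_constants_def \<rho>_def \<epsilon>_def by blast+

lemma disjoint_balls: "disjoint_family_on (\<lambda>Q. ball (\<zeta> Q) \<epsilon>) (pockets \<delta>)"
  using disjoint_pockets ball_in_pocket unfolding disjoint_family_on_def by blast

lemma balls_cover:
  assumes "z \<in> annulus k"
  shows "\<exists>Q\<in>S k. z \<in> ball (\<zeta> Q) \<rho>"
proof -
  obtain Q where Q: "Q \<in> S k" "z \<in> pocket \<delta> Q" using pockets_cover[OF assms] by blast
  then have "Q \<in> pockets \<delta>" by (simp add: shell_pockets_def)
  then show ?thesis using Q pocket_in_ball by blast
qed

lemma shellD:
  assumes "Q \<in> S k"
  shows "Q \<in> pockets \<delta>" "fst Q = k" "\<zeta> Q \<in> annulus k" "real k \<le> norm (\<zeta> Q)" "norm (\<zeta> Q) < real k + 1"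
    "ball (\<zeta> Q) \<epsilon> \<subseteq> annulus k"
proof -
  show Q: "Q \<in> pockets \<delta>" "fst Q = k" using assms by (auto simp: shell_pockets_eq)
  show "\<zeta> Q \<in> annulus k" using pocket_annulus[OF assms center_in_pocket] .
  then show "real k \<le> norm (\<zeta> Q)" "norm (\<zeta> Q) < real k + 1" by (auto simp: annulus_def)
  show "ball (\<zeta> Q) \<epsilon> \<subseteq> annulus k" using ball_in_pocket[OF Q(1)] pocket_annulus[OF assms] by blast
qed

lemma pockets_integral:
  "(\<Sum>\<^sup>+Q\<in>pockets \<delta>. f Q) = (\<Sum>\<^sup>+k\<in>UNIV. (\<Sum>\<^sup>+Q\<in>S k. f Q))"
  using nn_integral_count_space_Union_disjoint[OF disjoint_shell, of f] countable_pockets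
  unfolding Union_shell by blast

lemma Gaussian_sum:
  assumes "b > 0"
  shows "\<exists>A>0. \<forall>z. (\<Sum>\<^sup>+Q\<in>pockets \<delta>. ennreal (gauss b z (\<zeta> Q))) \<le> ennreal A"
  using Gaussian_sum_bound[OF assms radii(1) countable_pockets disjoint_balls] .

definition ratio :: "real \<Rightarrow> pidx \<Rightarrow> pidx \<Rightarrow> real" where
  "ratio \<sigma> Q Q' = ((1 + real (fst Q')) / (1 + real (fst Q))) powr \<sigma>"

text \<open>A Peetre-type inequality: 1 + l is at most (1 + |k - l|) times 1 + k, and the roles of k
  and l are exchanged for negative exponents.\<close>

lemma ratio_le: "ratio \<sigma> Q Q' \<le> (1 + \<bar>real (fst Q) - real (fst Q')\<bar>) powr \<bar>\<sigma>\<bar>"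
proof -
  define k l where "k = real (fst Q)" and "l = real (fst Q')"
  have kl: "k \<ge> 0" "l \<ge> 0" by (auto simp: k_def l_def)
  have b: "1 + l \<le> (1 + \<bar>k - l\<bar>) * (1 + k)" "1 + k \<le> (1 + \<bar>k - l\<bar>) * (1 + l)"
  proof -
    have "1 + x \<le> (1 + \<bar>x - y\<bar>) * (1 + y)" if "y \<ge> 0" for x y :: real
    proof -
      have "(1 + \<bar>x - y\<bar>) * (1 + y) = 1 + \<bar>x - y\<bar> + y + \<bar>x - y\<bar> * y" by (simp add: algebra_simps)
      moreover have "0 \<le> \<bar>x - y\<bar> * y" using that by simp
      ultimately show ?thesis by linarith
    qed
    from this[of k l] this[of l k] kl show "1 + l \<le> (1 + \<bar>k - l\<bar>) * (1 + k)" "1 + k \<le> (1 + \<bar>k - l\<bar>) * (1 + l)"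
      by (auto simp: abs_minus_commute)
  qed
  have "((1 + l) / (1 + k)) powr \<sigma> \<le> (1 + \<bar>k - l\<bar>) powr \<bar>\<sigma>\<bar>"
  proof (cases "\<sigma> \<ge> 0")
    case True
    then show ?thesis using kl b by (auto intro!: powr_mono2 simp: divide_le_eq)
  next
    case False
    have "((1 + l) / (1 + k)) powr \<sigma> = ((1 + k) / (1 + l)) powr \<bar>\<sigma>\<bar>"
      using kl False by (simp add: powr_divide powr_minus field_simps)
    also have "\<dots> \<le> (1 + \<bar>k - l\<bar>) powr \<bar>\<sigma>\<bar>" using kl b by (auto intro!: powr_mono2 simp: divide_le_eq)
    finally show ?thesis .
  qed
  then show ?thesis by (simp add: ratio_def k_def l_def)
qed

text \<open>The Gaussian kernel conjugated by the shell weights: for \<sigma> = \<tau> * s the ratio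
  is that of the s-th powers of the weights, so weighted estimates become unweighted ones.\<close>

definition dist_kernel :: "real \<Rightarrow> real \<Rightarrow> pidx \<Rightarrow> pidx \<Rightarrow> real" where
  "dist_kernel b \<sigma> Q Q' = gauss b (\<zeta> Q) (\<zeta> Q') * ratio \<sigma> Q Q'"

text \<open>Half of the Gaussian is kept for summing over the pockets of a shell. The other half
  decays in |k - l|, because points of the two shells are at distance at least |k - l| - 1; it pays
  for the weight ratio and still leaves decay for summing over shells.\<close>

lemma dist_kernel_le:
  assumes "b > 0" "Q \<in> S k" "Q' \<in> S l"
  shows "dist_kernel b \<sigma> Q Q' \<le> exp (b / 2) * exp (\<bar>\<sigma>\<bar>\<^sup>2 / (4 * (b / 8))) * exp (- (b / 8) * (real k - real l)\<^sup>2)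
     * gauss (b / 2) (\<zeta> Q) (\<zeta> Q')"
proof -
  define d where "d = norm (\<zeta> Q - \<zeta> Q')"
  define n where "n = \<bar>real k - real l\<bar>"
  have "\<bar>norm (\<zeta> Q) - norm (\<zeta> Q')\<bar> \<le> d" unfolding d_def by (rule norm_triangle_ineq3)
  then have "n \<le> d + 1" using shellD(4,5)[OF assms(2)] shellD(4,5)[OF assms(3)] by (auto simp: n_def)
  then have "n\<^sup>2 \<le> (d + 1)\<^sup>2" by (intro power_mono) (auto simp: n_def)
  also have "\<dots> \<le> 2 * d\<^sup>2 + 2" using zero_le_power2[of "d - 1"] by (simp add: power2_eq_square algebra_simps)
  finally have "(b / 2) * (n\<^sup>2 / 2 - 1) \<le> (b / 2) * d\<^sup>2" using assms(1) by (intro mult_left_mono) auto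
  then have "exp (- (b / 2) * d\<^sup>2) \<le> exp (b / 2) * (exp (- (b / 8) * n\<^sup>2) * exp (- (b / 8) * n\<^sup>2))"
    by (simp add: exp_add[symmetric] algebra_simps)
  moreover have "ratio \<sigma> Q Q' \<le> (1 + n) powr \<bar>\<sigma>\<bar>"
    using ratio_le[of \<sigma> Q Q'] shellD(2)[OF assms(2)] shellD(2)[OF assms(3)] by (simp add: n_def)
  ultimately have "exp (- (b / 2) * d\<^sup>2) * ratio \<sigma> Q Q' \<le>
      exp (b / 2) * (exp (- (b / 8) * n\<^sup>2) * exp (- (b / 8) * n\<^sup>2)) * (1 + n) powr \<bar>\<sigma>\<bar>"
    by (intro mult_mono) (auto simp: ratio_def)
  also have "\<dots> = exp (b / 2) * exp (- (b / 8) * n\<^sup>2) * ((1 + n) powr \<bar>\<sigma>\<bar> * exp (- (b / 8) * n\<^sup>2))" by simp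
  also have "\<dots> \<le> exp (b / 2) * exp (- (b / 8) * n\<^sup>2) * exp (\<bar>\<sigma>\<bar>\<^sup>2 / (4 * (b / 8)))"
    using assms(1) by (intro mult_left_mono polynomial_times_Gaussian_bounded) (auto simp: n_def)
  finally have fin: "exp (- (b / 2) * d\<^sup>2) * ratio \<sigma> Q Q' * exp (- (b / 2) * d\<^sup>2) \<le>
     exp (b / 2) * exp (- (b / 8) * n\<^sup>2) * exp (\<bar>\<sigma>\<bar>\<^sup>2 / (4 * (b / 8))) * exp (- (b / 2) * d\<^sup>2)"
    by (rule mult_right_mono) simp
  have "exp (- b * d\<^sup>2) = exp (- (b / 2) * d\<^sup>2) * exp (- (b / 2) * d\<^sup>2)"
    by (simp add: exp_add[symmetric])
  then have eq: "exp (- b * d\<^sup>2) * ratio \<sigma> Q Q' = exp (- (b / 2) * d\<^sup>2) * ratio \<sigma> Q Q' * exp (- (b / 2) * d\<^sup>2)"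
    by (simp only: mult_ac)
  show ?thesis unfolding dist_kernel_def d_def[symmetric] eq
    using fin by (simp only: n_def power2_abs mult_ac)
qed

lemma Schur_pockets:
  assumes "b > 0"
  shows "\<exists>C>0. \<forall>x y. (\<Sum>\<^sup>+Q\<in>pockets \<delta>. (\<Sum>\<^sup>+Q'\<in>pockets \<delta>. enn_powr (x Q) s * y Q' * ennreal (dist_kernel b \<sigma> Q Q')))
     \<le> ennreal C * enn_powr (seq_norm x) s * dual_norm y"
proof -
  obtain A1 where "A1 > 0 \<and> (\<forall>z. (\<Sum>\<^sup>+Q\<in>pockets \<delta>. ennreal (gauss (b / 2) z (\<zeta> Q))) \<le> ennreal A1)"
    using Gaussian_sum[OF half_gt_zero[OF assms]] by (rule exE)
  then have A1: "A1 > 0" "\<And>z. (\<Sum>\<^sup>+Q\<in>pockets \<delta>. ennreal (gauss (b / 2) z (\<zeta> Q))) \<le> ennreal A1"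
    by (rule conjunct1, rule conjunct2[THEN spec])
  \<comment> \<open>The sum over shell numbers comes from the same planar bound, with the natural
    numbers as separated points.\<close>
  have "disjoint_family_on (\<lambda>l :: nat. ball (of_nat l :: complex) (1 / 2)) UNIV"
  proof (unfold disjoint_family_on_def, intro ballI impI)
    fix m n :: nat assume "m \<noteq> n"
    then have "1 \<le> \<bar>int m - int n\<bar>" by linarith
    then have "1 \<le> dist (of_nat m :: complex) (of_nat n)"
      unfolding dist_of_nat by (simp only: of_int_1_le_iff)
    then show "ball (of_nat m :: complex) (1 / 2) \<inter> ball (of_nat n) (1 / 2) = {}"
      by (intro disjoint_ballI) auto
  qed
  then obtain A2 where "A2 > 0 \<and> (\<forall>z :: complex. (\<Sum>\<^sup>+l\<in>(UNIV :: nat set). ennreal (gauss (b / 8) z (of_nat l))) \<le> ennreal A2)"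
    using Gaussian_sum_bound[of "b / 8" "1 / 2" "UNIV :: nat set" of_nat, OF _ _ countableI_type] assms
    by (elim exE[rotated]) simp_all
  then have A2: "A2 > 0" "\<And>z :: complex. (\<Sum>\<^sup>+l\<in>(UNIV :: nat set). ennreal (gauss (b / 8) z (of_nat l))) \<le> ennreal A2"
    by (rule conjunct1, rule conjunct2[THEN spec])
  have A2': "(\<Sum>\<^sup>+l\<in>(UNIV :: nat set). ennreal (exp (- (b / 8) * (real k - real l)\<^sup>2))) \<le> ennreal A2" for k
  proof -
    have "(norm (of_nat k - of_nat l :: complex))\<^sup>2 = (real k - real l)\<^sup>2" for l
      by (metis norm_of_real of_real_diff of_real_of_nat_eq power2_abs)
    then show ?thesis using A2(2)[of "of_nat k"] by simp
  qed
  define D where "D = exp (b / 2) * exp (\<bar>\<sigma>\<bar>\<^sup>2 / (4 * (b / 8)))"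
  have D: "D > 0" by (simp add: D_def)
  \<comment> \<open>\<open>A1\<close> sums over the pockets of one shell, and the exponential is
    left for summing over shells. Symmetry in k and l lets rows and columns share the bound.\<close>
  define B where "B k l = ennreal (D * A1) * ennreal (exp (- (b / 8) * (real k - real l)\<^sup>2))" for k l
  have in_shell: "(\<Sum>\<^sup>+Q'\<in>S l. ennreal (gauss (b / 2) z (\<zeta> Q'))) \<le> ennreal A1" for l z
    using nn_integral_count_space_mono_set A1(2) by (rule order_trans) (auto simp: shell_pockets_eq)
  have K: "ennreal (dist_kernel b \<sigma> Q Q') \<le> ennreal (D * exp (- (b / 8) * (real k - real l)\<^sup>2)) * ennreal (gauss (b / 2) (\<zeta> Q) (\<zeta> Q'))"
    if "Q \<in> S k" "Q' \<in> S l" for Q Q' k l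
    using dist_kernel_le[OF assms that, of \<sigma>] by (simp add: D_def ennreal_mult[symmetric] ennreal_leI)
  have rows: "(\<Sum>\<^sup>+Q'\<in>S l. ennreal (dist_kernel b \<sigma> Q Q')) \<le> B k l" if "Q \<in> S k" for Q k l
  proof -
    have "(\<Sum>\<^sup>+Q'\<in>S l. ennreal (dist_kernel b \<sigma> Q Q')) \<le>
      (\<Sum>\<^sup>+Q'\<in>S l. ennreal (D * exp (- (b / 8) * (real k - real l)\<^sup>2)) * ennreal (gauss (b / 2) (\<zeta> Q) (\<zeta> Q')))"
      using K[OF that] by (intro nn_integral_mono) auto
    also have "\<dots> \<le> ennreal (D * exp (- (b / 8) * (real k - real l)\<^sup>2)) * ennreal A1"
      by (subst nn_integral_cmult, simp) (rule mult_left_mono[OF in_shell], simp)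
    also have "\<dots> = B k l" using D A1(1) by (simp add: B_def ennreal_mult[symmetric] mult_ac)
    finally show ?thesis .
  qed
  have cols: "(\<Sum>\<^sup>+Q\<in>S k. ennreal (dist_kernel b \<sigma> Q Q')) \<le> B k l" if "Q' \<in> S l" for Q' k l
  proof -
    have "(\<Sum>\<^sup>+Q\<in>S k. ennreal (dist_kernel b \<sigma> Q Q')) \<le>
      (\<Sum>\<^sup>+Q\<in>S k. ennreal (D * exp (- (b / 8) * (real k - real l)\<^sup>2)) * ennreal (gauss (b / 2) (\<zeta> Q') (\<zeta> Q)))"
      using K[OF _ that] by (intro nn_integral_mono) (auto simp: norm_minus_commute)
    also have "\<dots> \<le> ennreal (D * exp (- (b / 8) * (real k - real l)\<^sup>2)) * ennreal A1"
      by (subst nn_integral_cmult, simp) (rule mult_left_mono[OF in_shell], simp)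
    also have "\<dots> = B k l" using D A1(1) by (simp add: B_def ennreal_mult[symmetric] mult_ac)
    finally show ?thesis .
  qed
  have sq: "(real k - real l)\<^sup>2 = (real l - real k)\<^sup>2" for k l by (rule power2_commute)
  have Brows: "(\<Sum>\<^sup>+l\<in>UNIV. B k l) \<le> ennreal (D * A1 * A2)" for k
  proof -
    have "(\<Sum>\<^sup>+l\<in>UNIV. B k l) \<le> ennreal (D * A1) * ennreal A2"
      unfolding B_def by (subst nn_integral_cmult, simp) (rule mult_left_mono[OF A2'], simp)
    then show ?thesis using D A1 A2(1) by (simp add: ennreal_mult)
  qed
  have Bcols: "(\<Sum>\<^sup>+k\<in>UNIV. B k l) \<le> ennreal (D * A1 * A2)" for l
    using Brows[of l] unfolding B_def by (subst (asm) sq) simp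
  have pos: "D * A1 > 0" "D * A1 * A2 > 0" using D A1 A2 by auto
  have "(\<Sum>\<^sup>+Q\<in>pockets \<delta>. (\<Sum>\<^sup>+Q'\<in>pockets \<delta>. enn_powr (x Q) s * y Q' * ennreal (dist_kernel b \<sigma> Q Q')))
     \<le> ennreal (4 * (D * A1 * A2)) * enn_powr (seq_norm x) s * dual_norm y" for x y
  proof -
    have "(\<Sum>\<^sup>+Q\<in>pockets \<delta>. (\<Sum>\<^sup>+Q'\<in>pockets \<delta>. enn_powr (x Q) s * y Q' * ennreal (dist_kernel b \<sigma> Q Q'))) =
      (\<Sum>\<^sup>+k\<in>UNIV. (\<Sum>\<^sup>+Q\<in>S k. (\<Sum>\<^sup>+l\<in>UNIV. (\<Sum>\<^sup>+Q'\<in>S l. enn_powr (x Q) s * y Q' * ennreal (dist_kernel b \<sigma> Q Q')))))"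
      unfolding pockets_integral ..
    also have "\<dots> = (\<Sum>\<^sup>+k\<in>UNIV. (\<Sum>\<^sup>+l\<in>UNIV. (\<Sum>\<^sup>+Q\<in>S k. (\<Sum>\<^sup>+Q'\<in>S l. enn_powr (x Q) s * y Q' * ennreal (dist_kernel b \<sigma> Q Q')))))"
      by (intro nn_integral_cong nn_integral_count_space_nn_integral) auto
    also have "\<dots> \<le> 4 * ennreal (D * A1 * A2) * enn_powr (seq_norm x) s * dual_norm y"
      by (rule mixed_Schur[OF p q s countable_finite[OF finite_shell] _ _ rows cols Brows Bcols])
         (use pos in \<open>auto simp: B_def\<close>)
    also have "4 * ennreal (D * A1 * A2) = ennreal (4 * (D * A1 * A2))" using pos by (simp add: ennreal_mult)
    finally show ?thesis .
  qed
  then show ?thesis using pos by (intro exI[of _ "4 * (D * A1 * A2)"]) auto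
qed

text \<open>The weight is constant on a shell, so it moves inside the inner norm and the unweighted
  mixed-norm estimates apply.\<close>

lemma lw_norm_eq: "lwn c = seq_norm (\<lambda>Q. ennreal (wt (fst Q) * norm (c Q)))"
proof -
  have "Lp_norm (count_space (S k)) p (\<lambda>Q. ennreal (wt (fst Q) * norm (c Q))) =
     ennreal ((1 + real k) powr (enn2real (1 / q) - enn2real (1 / p))) *
          Lp_norm (count_space (S k)) p (\<lambda>Q. ennreal (norm (c Q)))" for k
  proof -
    have "Lp_norm (count_space (S k)) p (\<lambda>Q. ennreal (wt (fst Q) * norm (c Q))) =
      Lp_norm (count_space (S k)) p (\<lambda>Q. ennreal (wt k) * ennreal (norm (c Q)))"
      using wt_pos[of k] by (intro lp_norm_cong) (simp add: shellD(2) ennreal_mult)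
    then show ?thesis by (simp add: lp_norm_cmult p wt_def kern_weight_def)
  qed
  then show ?thesis by (simp add: lw_norm_def mix_norm_def)
qed

end

subsection \<open>Embedding and testing\<close>

lemma comparable_sym:
  assumes "C > 0" "comparable C X Y"
  shows "Y \<le> ennreal C * X"
proof -
  have "Y = ennreal C * (ennreal (1 / C) * Y)"
    using assms(1) by (simp add: mult.assoc[symmetric] ennreal_mult[symmetric])
  also have "\<dots> \<le> ennreal C * X" using assms(2) by (intro mult_left_mono) (auto simp: comparable_def)
  finally show ?thesis .
qed

text \<open>The infimum need not be attained, so \<open>N\<close> is divided out. For N = 0 an
  element of \<open>I\<close> is what forces L = 0.\<close>

lemma le_mult_INF:
  fixes N :: ennreal
  assumes "N \<noteq> top" "\<And>c. c \<in> I \<Longrightarrow> L \<le> N * f c"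
  assumes "I \<noteq> {}"
  shows "L \<le> N * (INF c\<in>I. f c)"
proof (cases "N = 0")
  case True
  then show ?thesis using assms by auto
next
  case False
  then have inv: "N * inverse N = 1"
    using assms(1) by (simp add: less_top divide_ennreal_def[symmetric] ennreal_divide_self)
  have "inverse N * L \<le> f c" if "c \<in> I" for c
  proof -
    have "inverse N * L \<le> inverse N * (N * f c)" by (intro mult_left_mono assms(2) that) simp
    also have "\<dots> = (N * inverse N) * f c" by (simp only: mult_ac)
    finally show ?thesis by (simp add: inv)
  qed
  then have "N * (inverse N * L) \<le> N * (INF c\<in>I. f c)" by (intro mult_left_mono INF_greatest) auto
  then show ?thesis by (simp add: mult.assoc[symmetric] inv)
qed

context carleson_setting
begin

text \<open>The ball masses with the kernel norm replaced by its equivalent \<open>wt\<close>,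
  frozen on each shell. The radius is a parameter because both \<open>\<rho>\<close> and
  \<open>R\<close> occur.\<close>

definition wmass :: "complex measure \<Rightarrow> real \<Rightarrow> pidx \<Rightarrow> ennreal" where
  "wmass \<mu> r Q = ennreal (wt (fst Q) powr - s) * emeasure \<mu> (ball (\<zeta> Q) r)"

lemma wt_ratio: "wt (fst Q) powr - s * wt (fst Q) powr s = 1"
  "ratio (\<tau> * s) Q Q' = wt (fst Q') powr s * wt (fst Q) powr - s"
proof -
  show "wt (fst Q) powr - s * wt (fst Q) powr s = 1" using wt_pos[of "fst Q"] by (simp add: powr_minus)
  have w: "wt k powr s = (1 + real k) powr (\<tau> * s)" for k
    by (simp add: wt_def kern_weight_def \<tau>_def powr_powr)
  have w': "wt (fst Q) powr - s = inverse ((1 + real (fst Q)) powr (\<tau> * s))" by (simp add: powr_minus w)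
  show "ratio (\<tau> * s) Q Q' = wt (fst Q') powr s * wt (fst Q) powr - s"
    unfolding ratio_def powr_divide w w' by (simp only: divide_inverse)
qed

definition weighted_power :: "(complex \<Rightarrow> complex) \<Rightarrow> complex \<Rightarrow> ennreal" where
  "weighted_power f z = ennreal (norm (f z) powr s * exp (- (\<alpha> * s / 2) * (norm z)\<^sup>2))"

lemma weighted_power_eq:
  "weighted_power f z = enn_powr (ennreal (norm (f z) * exp (- (\<alpha> / 2) * (norm z)\<^sup>2))) s"
proof -
  have "exp (- (\<alpha> / 2) * (norm z)\<^sup>2) powr s = exp (- (\<alpha> * s / 2) * (norm z)\<^sup>2)"
    by (simp add: powr_def mult_ac)
  then show ?thesis by (simp add: weighted_power_def enn_powr_ennreal powr_mult)
qed

lemma Ls_norm_eq: "Ls_norm \<alpha> s \<mu> f = enn_powr (\<integral>\<^sup>+ z. weighted_power f z \<partial>\<mu>) (1 / s)"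
  by (simp add: Ls_norm_def weighted_power_def)

lemma ex_pocket_ball: "\<exists>Q\<in>pockets \<delta>. z \<in> ball (\<zeta> Q) \<rho>"
  using ex_annulus[of z] balls_cover shellD(1) by blast

lemma synthesis_embedding:
  "\<exists>C>0. \<forall>\<mu> c f. sets \<mu> = sets borel \<longrightarrow> synthesizes \<alpha> \<delta> c f \<longrightarrow>
     (\<integral>\<^sup>+ z. weighted_power f z \<partial>\<mu>) \<le> ennreal C * enn_powr (lwn c) s * dual_norm (wmass \<mu> \<rho>)"
proof -
  \<comment> \<open>The weighted kernel has rate \<alpha> / 2, and \<open>power_of_sum_le\<close>
    raises it to the power min 1 s.\<close>
  define b where "b = \<alpha> / 2 * min 1 s"
  have b: "b > 0" using \<alpha> s by (simp add: b_def)
  obtain C1 where C1: "C1 > 0" and Schur: "\<forall>x y. (\<Sum>\<^sup>+Q\<in>pockets \<delta>. (\<Sum>\<^sup>+Q'\<in>pockets \<delta>. enn_powr (x Q) s * y Q' * ennreal (dist_kernel (b / 2) (\<tau> * s) Q Q'))) \<le> ennreal C1 * enn_powr (seq_norm x) s * dual_norm y"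
    using Schur_pockets[OF half_gt_zero[OF b], of "\<tau> * s"] by (elim exE conjE) (rule that)
  obtain A where A: "A > 0" and sumA: "\<forall>z. (\<Sum>\<^sup>+Q\<in>pockets \<delta>. ennreal (gauss (\<alpha> / 2) z (\<zeta> Q))) \<le> ennreal A"
    using Gaussian_sum[OF half_gt_zero[OF \<alpha>]] by (elim exE conjE) (rule that)
  define D where "D = (A + 1) powr s"
  define E where "E = exp (b * \<rho>\<^sup>2)"
  have pos: "D > 0" "E > 0" using A by (auto simp: D_def E_def)
  have main: "(\<integral>\<^sup>+ z. weighted_power f z \<partial>\<mu>) \<le> ennreal (D * E * C1) * enn_powr (lwn c) s * dual_norm (wmass \<mu> \<rho>)"
    if \<mu>: "sets \<mu> = sets borel" and f: "synthesizes \<alpha> \<delta> c f" for \<mu> c f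
  proof -
    define a where "a Q = ennreal (norm (c Q))" for Q
    define h where "h Q' = (\<Sum>\<^sup>+Q\<in>pockets \<delta>. enn_powr (a Q) s * ennreal (gauss (b / 2) (\<zeta> Q) (\<zeta> Q')))" for Q'
    have pointwise: "weighted_power f z \<le> (\<Sum>\<^sup>+Q'\<in>pockets \<delta>. ennreal (D * E) * h Q' * indicator (ball (\<zeta> Q') \<rho>) z)" for z
    proof -
      define G where "G Q = ennreal (gauss (\<alpha> / 2) z (\<zeta> Q))" for Q
      have Gm: "enn_powr (G Q) (min 1 s) = ennreal (gauss b z (\<zeta> Q))" for Q
        by (simp add: G_def enn_powr_ennreal powr_def b_def mult_ac)
      have "((\<lambda>Q. c Q * kern \<alpha> (\<zeta> Q) z) has_sum f z) (pockets \<delta>)" using f by (simp add: synthesizes_def)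
      from has_sum_norm_le[OF this]
      have "ennreal (norm (f z) * exp (- (\<alpha> / 2) * (norm z)\<^sup>2)) \<le>
         (\<Sum>\<^sup>+Q\<in>pockets \<delta>. ennreal (norm (c Q * kern \<alpha> (\<zeta> Q) z))) * ennreal (exp (- (\<alpha> / 2) * (norm z)\<^sup>2))"
        by (simp add: ennreal_mult mult_right_mono)
      also have "\<dots> = (\<Sum>\<^sup>+Q\<in>pockets \<delta>. ennreal (norm (c Q * kern \<alpha> (\<zeta> Q) z)) * ennreal (exp (- (\<alpha> / 2) * (norm z)\<^sup>2)))"
        by (rule nn_integral_multc[symmetric]) simp
      also have "\<dots> = (\<Sum>\<^sup>+Q\<in>pockets \<delta>. a Q * G Q)"
      proof (rule nn_integral_cong)
        fix Q
        have "ennreal (norm (c Q * kern \<alpha> (\<zeta> Q) z)) * ennreal (exp (- (\<alpha> / 2) * (norm z)\<^sup>2)) =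
           ennreal (norm (c Q) * (norm (kern \<alpha> (\<zeta> Q) z) * exp (- (\<alpha> / 2) * (norm z)\<^sup>2)))"
          by (simp only: norm_mult ennreal_mult[symmetric] mult.assoc norm_ge_zero mult_nonneg_nonneg exp_ge_zero)
        then show "ennreal (norm (c Q * kern \<alpha> (\<zeta> Q) z)) * ennreal (exp (- (\<alpha> / 2) * (norm z)\<^sup>2)) = a Q * G Q"
          unfolding norm_kern_weighted a_def G_def by (simp only: ennreal_mult norm_ge_zero exp_ge_zero)
      qed
      finally have "weighted_power f z \<le> enn_powr (\<Sum>\<^sup>+Q\<in>pockets \<delta>. a Q * G Q) s"
        unfolding weighted_power_eq using s by (intro enn_powr_mono) auto
      also have "\<dots> \<le> enn_powr (ennreal A + 1) s * (\<Sum>\<^sup>+Q\<in>pockets \<delta>. enn_powr (a Q) s * enn_powr (G Q) (min 1 s))"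
        unfolding G_def by (rule power_of_sum_le[OF s sumA[rule_format]])
      also have "enn_powr (ennreal A + 1) s = ennreal D"
      proof -
        have "ennreal A + 1 = ennreal (A + 1)" using A by simp
        then show ?thesis using A by (simp add: D_def enn_powr_ennreal del: ennreal_plus)
      qed
      finally have 1: "weighted_power f z \<le> ennreal D * (\<Sum>\<^sup>+Q\<in>pockets \<delta>. enn_powr (a Q) s * ennreal (gauss b z (\<zeta> Q)))"
        by (simp only: Gm)
      \<comment> \<open>One ball containing \<open>z\<close> is enough: passing from
        \<open>z\<close> to its centre halves the rate and costs \<open>E\<close>, and afterwards
        \<open>z\<close> enters only through an indicator.\<close>
      obtain Q0 where Q0: "Q0 \<in> pockets \<delta>" "z \<in> ball (\<zeta> Q0) \<rho>" using ex_pocket_ball by blast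
      have "(\<Sum>\<^sup>+Q\<in>pockets \<delta>. enn_powr (a Q) s * ennreal (gauss b z (\<zeta> Q))) \<le>
         (\<Sum>\<^sup>+Q\<in>pockets \<delta>. ennreal E * (enn_powr (a Q) s * ennreal (gauss (b / 2) (\<zeta> Q) (\<zeta> Q0))))"
      proof (rule nn_integral_mono)
        fix Q
        have "gauss b z (\<zeta> Q) \<le> E * gauss (b / 2) (\<zeta> Q) (\<zeta> Q0)"
          using exp_norm_square_shift[of b "\<zeta> Q0" z \<rho> "\<zeta> Q"] b Q0(2)
          by (simp add: E_def norm_minus_commute dist_norm)
        then have "ennreal (gauss b z (\<zeta> Q)) \<le> ennreal E * ennreal (gauss (b / 2) (\<zeta> Q) (\<zeta> Q0))"
          using pos by (simp only: ennreal_mult[symmetric] less_imp_le exp_ge_zero ennreal_leI)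
        then have "enn_powr (a Q) s * ennreal (gauss b z (\<zeta> Q)) \<le>
          enn_powr (a Q) s * (ennreal E * ennreal (gauss (b / 2) (\<zeta> Q) (\<zeta> Q0)))" by (rule mult_left_mono) simp
        then show "enn_powr (a Q) s * ennreal (gauss b z (\<zeta> Q)) \<le>
          ennreal E * (enn_powr (a Q) s * ennreal (gauss (b / 2) (\<zeta> Q) (\<zeta> Q0)))" by (simp only: mult_ac)
      qed
      also have "\<dots> = ennreal E * h Q0" unfolding h_def by (rule nn_integral_cmult) simp
      finally have "weighted_power f z \<le> ennreal D * (ennreal E * h Q0)"
        using 1 by (meson mult_left_mono order_trans zero_le)
      also have "\<dots> = ennreal (D * E) * h Q0" using pos by (simp add: ennreal_mult mult.assoc)
      also have "\<dots> = ennreal (D * E) * h Q0 * indicator (ball (\<zeta> Q0) \<rho>) z" using Q0 by simp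
      also have "\<dots> \<le> (\<Sum>\<^sup>+Q'\<in>pockets \<delta>. ennreal (D * E) * h Q' * indicator (ball (\<zeta> Q') \<rho>) z)"
        by (rule nn_integral_ge_point[OF Q0(1)])
      finally show ?thesis .
    qed
    \<comment> \<open>Tonelli is applied between \<mu> and a countable sum, where it amounts to
      monotone convergence and holds for every Borel \<mu>.\<close>
    have meas: "ball w r \<in> sets \<mu>" for w r unfolding \<mu> by simp
    have "(\<integral>\<^sup>+ z. weighted_power f z \<partial>\<mu>) \<le>
       (\<integral>\<^sup>+ z. (\<Sum>\<^sup>+Q'\<in>pockets \<delta>. ennreal (D * E) * h Q' * indicator (ball (\<zeta> Q') \<rho>) z) \<partial>\<mu>)"
      by (intro nn_integral_mono pointwise)
    also have "\<dots> = (\<Sum>\<^sup>+Q'\<in>pockets \<delta>. \<integral>\<^sup>+ z. ennreal (D * E) * h Q' * indicator (ball (\<zeta> Q') \<rho>) z \<partial>\<mu>)"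
      using countable_pockets meas
      by (intro nn_integral_count_space_nn_integral borel_measurable_times_ennreal borel_measurable_const borel_measurable_indicator)
    also have "\<dots> = (\<Sum>\<^sup>+Q'\<in>pockets \<delta>. ennreal (D * E) * (h Q' * emeasure \<mu> (ball (\<zeta> Q') \<rho>)))"
      using meas by (intro nn_integral_cong) (simp add: nn_integral_cmult_indicator mult.assoc[symmetric])
    also have "\<dots> = ennreal (D * E) * (\<Sum>\<^sup>+Q'\<in>pockets \<delta>. h Q' * emeasure \<mu> (ball (\<zeta> Q') \<rho>))"
      by (rule nn_integral_cmult) simp
    also have "(\<Sum>\<^sup>+Q'\<in>pockets \<delta>. h Q' * emeasure \<mu> (ball (\<zeta> Q') \<rho>)) =
       (\<Sum>\<^sup>+Q'\<in>pockets \<delta>. (\<Sum>\<^sup>+Q\<in>pockets \<delta>. enn_powr (ennreal (wt (fst Q) * norm (c Q))) s * wmass \<mu> \<rho> Q' * ennreal (dist_kernel (b / 2) (\<tau> * s) Q Q')))"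
    \<comment> \<open>The weights are inserted in pairs: the power s on the coefficients and the
      power - s in \<open>wmass\<close> cancel against \<open>ratio\<close>.\<close>
    proof (rule nn_integral_cong)
      fix Q'
      have "h Q' * emeasure \<mu> (ball (\<zeta> Q') \<rho>) = (\<Sum>\<^sup>+Q\<in>pockets \<delta>. enn_powr (a Q) s * ennreal (gauss (b / 2) (\<zeta> Q) (\<zeta> Q')) * emeasure \<mu> (ball (\<zeta> Q') \<rho>))"
        unfolding h_def by (rule nn_integral_multc[symmetric]) simp
      also have "\<dots> = (\<Sum>\<^sup>+Q\<in>pockets \<delta>. enn_powr (ennreal (wt (fst Q) * norm (c Q))) s * wmass \<mu> \<rho> Q' * ennreal (dist_kernel (b / 2) (\<tau> * s) Q Q'))"
      proof (rule nn_integral_cong)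
        fix Q
        define e where "e = gauss (b / 2) (\<zeta> Q) (\<zeta> Q')"
        define m where "m = emeasure \<mu> (ball (\<zeta> Q') \<rho>)"
        have "enn_powr (ennreal (wt (fst Q) * norm (c Q))) s * wmass \<mu> \<rho> Q' * ennreal (dist_kernel (b / 2) (\<tau> * s) Q Q') =
          ennreal (wt (fst Q) powr s * norm (c Q) powr s) * ennreal (wt (fst Q') powr - s) * ennreal (e * (wt (fst Q') powr s * wt (fst Q) powr - s)) * m"
          unfolding dist_kernel_def wt_ratio(2)
          using wt_pos[of "fst Q"] by (simp add: enn_powr_ennreal powr_mult wmass_def e_def m_def mult_ac)
        also have "ennreal (wt (fst Q) powr s * norm (c Q) powr s) * ennreal (wt (fst Q') powr - s) * ennreal (e * (wt (fst Q') powr s * wt (fst Q) powr - s))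
            = ennreal ((wt (fst Q) powr - s * wt (fst Q) powr s) * (wt (fst Q') powr - s * wt (fst Q') powr s) * (norm (c Q) powr s * e))"
          by (subst ennreal_mult[symmetric], simp, simp, subst ennreal_mult[symmetric], simp, simp add: e_def) (simp only: mult_ac)
        also have "\<dots> = enn_powr (a Q) s * ennreal e" unfolding wt_ratio(1) by (simp add: a_def enn_powr_ennreal ennreal_mult e_def)
        finally show "enn_powr (a Q) s * ennreal (gauss (b / 2) (\<zeta> Q) (\<zeta> Q')) * emeasure \<mu> (ball (\<zeta> Q') \<rho>) =
           enn_powr (ennreal (wt (fst Q) * norm (c Q))) s * wmass \<mu> \<rho> Q' * ennreal (dist_kernel (b / 2) (\<tau> * s) Q Q')"
          by (simp only: e_def m_def)
      qed
      finally show "h Q' * emeasure \<mu> (ball (\<zeta> Q') \<rho>) = \<dots>" .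
    qed
    also have "\<dots> = (\<Sum>\<^sup>+Q\<in>pockets \<delta>. (\<Sum>\<^sup>+Q'\<in>pockets \<delta>. enn_powr (ennreal (wt (fst Q) * norm (c Q))) s * wmass \<mu> \<rho> Q' * ennreal (dist_kernel (b / 2) (\<tau> * s) Q Q')))"
      using countable_pockets by (intro nn_integral_count_space_nn_integral) auto
    also have "\<dots> \<le> ennreal C1 * enn_powr (lwn c) s * dual_norm (wmass \<mu> \<rho>)"
      unfolding lw_norm_eq by (rule Schur[rule_format])
    finally have "(\<integral>\<^sup>+ z. weighted_power f z \<partial>\<mu>) \<le> ennreal (D * E) * (ennreal C1 * enn_powr (lwn c) s * dual_norm (wmass \<mu> \<rho>))"
      by (simp add: mult_left_mono)
    then show ?thesis using pos C1 by (simp add: ennreal_mult mult_ac)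
  qed
  have "D * E * C1 > 0" using pos C1 by simp
  with main show ?thesis by blast
qed

text \<open>The bound for one representation is minimised over all of them. Finiteness of the dual
  norm keeps the factor in front of the infimum finite.\<close>

lemma embedding_bound:
  "\<exists>C>0. \<forall>\<mu>. \<forall>f\<in>Fspace. sets \<mu> = sets borel \<longrightarrow> dual_norm (wmass \<mu> \<rho>) < top \<longrightarrow>
     Ls_norm \<alpha> s \<mu> f \<le> ennreal C * enn_powr (dual_norm (wmass \<mu> \<rho>)) (1 / s) * Fnorm f"
proof -
  obtain C where C: "C > 0" and emb_le: "\<forall>\<mu> c f. sets \<mu> = sets borel \<longrightarrow> synthesizes \<alpha> \<delta> c f \<longrightarrow>
     (\<integral>\<^sup>+ z. weighted_power f z \<partial>\<mu>) \<le> ennreal C * enn_powr (lwn c) s * dual_norm (wmass \<mu> \<rho>)"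
    using synthesis_embedding by (elim exE conjE) (rule that)
  obtain C' where C': "C' > 0" and rec: "\<forall>f\<in>Fspace. comparable C' (Fnorm f)
              (INF c\<in>{c \<in> lw_space p q \<delta>. synthesizes \<alpha> \<delta> c f}. lwn c)"
    using recon by (elim exE conjE) (rule that)
  have "Ls_norm \<alpha> s \<mu> f \<le> ennreal (C powr (1 / s) * C') * enn_powr (dual_norm (wmass \<mu> \<rho>)) (1 / s) * Fnorm f"
    if f: "f \<in> Fspace" and \<mu>: "sets \<mu> = sets borel" and fin: "dual_norm (wmass \<mu> \<rho>) < top" for f \<mu>
  proof -
    define N where "N = ennreal (C powr (1 / s)) * enn_powr (dual_norm (wmass \<mu> \<rho>)) (1 / s)"
    have N: "N \<noteq> top" using fin unfolding N_def by (simp add: ennreal_mult_eq_top_iff)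
    define A where "A = {c \<in> lw_space p q \<delta>. synthesizes \<alpha> \<delta> c f}"
    have INF: "(INF c\<in>A. lwn c) \<le> ennreal C' * Fnorm f"
      unfolding A_def by (rule comparable_sym[OF C' rec[rule_format, OF f]])
    \<comment> \<open>An empty infimum would be \<open>top\<close>, but \<open>recon\<close> bounds
      it by a multiple of the finite Fock norm.\<close>
    have "A \<noteq> {}"
    proof
      assume "A = {}"
      then have "ennreal C' * Fnorm f = top" using INF by (simp add: top_unique)
      then show False using f by (auto simp: Fock_space_def ennreal_mult_eq_top_iff)
    qed
    have "Ls_norm \<alpha> s \<mu> f \<le> N * lwn c" if "c \<in> A" for c
    proof -
      have "synthesizes \<alpha> \<delta> c f" using that by (simp add: A_def)
      then have "Ls_norm \<alpha> s \<mu> f \<le> enn_powr (ennreal C * enn_powr (lwn c) s * dual_norm (wmass \<mu> \<rho>)) (1 / s)"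
        unfolding Ls_norm_eq using emb_le[rule_format, OF \<mu>] s by (intro enn_powr_mono) auto
      also have "\<dots> = N * lwn c"
        using s C by (simp add: N_def enn_powr_mult enn_powr_inverse enn_powr_ennreal mult_ac)
      finally show ?thesis .
    qed
    then have "Ls_norm \<alpha> s \<mu> f \<le> N * (INF c\<in>A. lwn c)"
      by (intro le_mult_INF N \<open>A \<noteq> {}\<close>)
    also have "\<dots> \<le> N * (ennreal C' * Fnorm f)" by (intro mult_left_mono INF) simp
    finally show ?thesis using C C' by (simp add: N_def ennreal_mult mult_ac)
  qed
  moreover have "C powr (1 / s) * C' > 0" using C C' by simp
  ultimately show ?thesis by blast
qed

text \<open>By duality only finite families of norm at most 1 are tested. After rescaling, all their
  signed sums lie in the unit ball of the Fock space. The sign average isolates a single kernel on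
  its own ball, where its weighted modulus is at least exp (- \<alpha> * R^2 / 2).\<close>

lemma testing_bound:
  "\<exists>C>0. \<forall>\<mu>. sets \<mu> = sets borel \<longrightarrow>
     dual_norm (wmass \<mu> R) \<le> ennreal C * emb \<mu>"
proof -
  let ?e = "exp (- (\<alpha> * s / 2) * R\<^sup>2)" and ?e' = "exp (\<alpha> * s / 2 * R\<^sup>2)"
  let ?g = "\<lambda>z :: complex. exp (- (\<alpha> * s / 2) * (norm z)\<^sup>2)" and ?B = "\<lambda>Q. ball (\<zeta> Q) R"
  obtain C1 where syn1: "\<forall>c\<in>lw_space p q \<delta>. \<exists>f\<in>Fspace.
            synthesizes \<alpha> \<delta> c f \<and> Fnorm f \<le> ennreal C1 * lwn c"
    using synth by (rule exE)
  \<comment> \<open>\<open>C1\<close> is only known to be real; the maximum makes division by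
    \<open>C0\<close> legitimate.\<close>
  define C0 where "C0 = max 1 C1"
  have C0: "C0 > 0" "C1 \<le> C0" by (auto simp: C0_def)
  obtain A where A: "A > 0" and sumA: "\<forall>z. (\<Sum>\<^sup>+Q\<in>pockets \<delta>. ennreal (gauss 1 z (\<zeta> Q))) \<le> ennreal A"
    using Gaussian_sum[OF zero_less_one] by (elim exE conjE) (rule that)
  \<comment> \<open>Bounds how many balls of radius \<open>R\<close> contain a given point: each
    indicator is at most exp (R^2) times a Gaussian of rate 1.\<close>
  define N where "N = exp (R\<^sup>2) * A"
  have N: "N > 0" using A by (simp add: N_def)
  \<comment> \<open>\<open>C0 powr s\<close> comes from rescaling the coefficients,
    \<open>?e'\<close> from the lower bound of the kernel on its ball, 2 from the sign average and
    \<open>N\<close> from the overlap.\<close>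
  define K where "K = C0 powr s * ?e' * (2 * N)"
  have K: "K > 0" using C0 N by (simp add: K_def)
  have "dual_norm (wmass \<mu> R) \<le> ennreal K * emb \<mu>" if \<mu>: "sets \<mu> = sets borel" for \<mu>
  proof (rule mixed_dual_bound[OF p q s finite_shell disjoint_shell])
    fix n X
    assume X0: "\<And>Q. 0 \<le> X Q" and Xsupp: "\<And>Q. Q \<notin> (\<Union>k<n. S k) \<Longrightarrow> X Q = 0"
      and Xnorm: "seq_norm (\<lambda>Q. ennreal (X Q)) \<le> 1"
    define F where "F = (\<Union>k<n. S k)"
    have F: "finite F" "F \<subseteq> pockets \<delta>" using finite_shell by (auto simp: F_def shell_pockets_eq)
    \<comment> \<open>Scaled so that the weighted coefficient norm is at most 1 / C0 and the
      synthesised function has norm at most 1.\<close>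
    define c where "c Q = X Q / (C0 * wt (fst Q))" for Q
    have c0: "c Q \<ge> 0" "Q \<notin> F \<Longrightarrow> c Q = 0" for Q
      using X0 C0 wt_pos[of "fst Q"] Xsupp[of Q] by (auto simp: c_def F_def)
    define f where "f B z = (\<Sum>Q\<in>F. sgn_on B Q * (of_real (c Q) * kern \<alpha> (\<zeta> Q) z))" for B z
    have emb_le: "(\<integral>\<^sup>+ z. weighted_power (f B) z \<partial>\<mu>) \<le> emb \<mu>" for B
    proof -
      define d where "d Q = sgn_on B Q * of_real (c Q)" for Q
      have "lwn d = seq_norm (\<lambda>Q. ennreal (1 / C0) * ennreal (X Q))"
      proof -
        have "ennreal (wt (fst Q) * norm (d Q)) = ennreal (1 / C0) * ennreal (X Q)" for Q
        proof -
          have "norm (d Q) = c Q" using c0(1)[of Q] by (simp add: d_def norm_mult)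
          then show ?thesis using wt_pos[of "fst Q"] C0 X0[of Q] by (simp add: c_def ennreal_mult[symmetric])
        qed
        then show ?thesis by (simp only: lw_norm_eq)
      qed
      also have "\<dots> = ennreal (1 / C0) * seq_norm (\<lambda>Q. ennreal (X Q))" by (rule mix_norm_cmult[OF p q])
      also have "\<dots> \<le> ennreal (1 / C0) * 1" by (rule mult_left_mono[OF Xnorm]) simp
      finally have lw: "lwn d \<le> ennreal (1 / C0)" by simp
      then have "d \<in> lw_space p q \<delta>" by (auto simp: lw_space_def intro: le_less_trans)
      then obtain g where g: "g \<in> Fspace" "synthesizes \<alpha> \<delta> d g" "Fnorm g \<le> ennreal C1 * lwn d"
        using syn1 by blast
      \<comment> \<open>\<open>synth\<close> yields some function with the norm bound. Pointwise
        sums are unique and the coefficients vanish off \<open>F\<close>, so it is the finite sum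
        \<open>f B\<close>.\<close>
      have "g = f B"
      proof
        fix z
        have "((\<lambda>Q. d Q * kern \<alpha> (\<zeta> Q) z) has_sum g z) (pockets \<delta>)" using g(2) by (simp add: synthesizes_def)
        moreover have "((\<lambda>Q. d Q * kern \<alpha> (\<zeta> Q) z) has_sum g z) (pockets \<delta>) \<longleftrightarrow> ((\<lambda>Q. d Q * kern \<alpha> (\<zeta> Q) z) has_sum g z) F"
          using F(2) by (intro has_sum_cong_neutral) (auto simp: d_def c0(2))
        moreover have "((\<lambda>Q. d Q * kern \<alpha> (\<zeta> Q) z) has_sum (\<Sum>Q\<in>F. d Q * kern \<alpha> (\<zeta> Q) z)) F"
          by (rule has_sum_finite[OF F(1)])
        ultimately have "g z = (\<Sum>Q\<in>F. d Q * kern \<alpha> (\<zeta> Q) z)" using has_sum_unique by blast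
        then show "g z = f B z" by (simp add: f_def d_def mult.assoc)
      qed
      have "ennreal C1 * lwn d \<le> ennreal C0 * ennreal (1 / C0)"
        using lw C0 by (intro mult_mono ennreal_leI) auto
      also have "\<dots> = 1" using C0 by (simp add: ennreal_mult[symmetric])
      finally have "Fnorm g \<le> 1" using g(3) by (meson order_trans)
      then have "Ls_norm \<alpha> s \<mu> g \<le> embedding_norm \<alpha> p q s \<mu>"
        unfolding embedding_norm_def using g(1) by (intro SUP_upper) auto
      then show ?thesis using s unfolding Ls_norm_eq \<open>g = f B\<close> by (simp add: enn_powr_le_iff)
    qed
    define M where "M z = (\<Sum>B\<in>Pow F. weighted_power (f B) z)" for z
    have fcont: "f B \<in> borel_measurable \<mu>" for B
    proof -
      have "continuous_on UNIV (f B)" unfolding f_def kern_def by (intro continuous_intros)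
      then have "f B \<in> borel_measurable borel" by (rule borel_measurable_continuous_onI)
      then show ?thesis using measurable_cong_sets[OF \<mu> refl] by blast
    qed
    have [measurable]: "f B \<in> borel_measurable \<mu>" for B by (rule fcont)
    have [measurable]: "(\<lambda>z. z) \<in> borel_measurable \<mu>"
      using measurable_cong_sets[OF \<mu> refl] measurable_ident by (metis measurable_ident_sets \<mu>)
    have wmeas: "weighted_power (f B) \<in> borel_measurable \<mu>" for B
      unfolding weighted_power_def by measurable
    have meas: "ball w r \<in> sets \<mu>" for w r unfolding \<mu> by simp
    \<comment> \<open>The sign average dominates each summand separately. Keeping the indicator on
      the right means that summing over \<open>Q\<close> costs only the overlap \<open>N\<close>,
      not the size of \<open>F\<close>.\<close>
    have single: "ennreal (c Q powr s * ?e) * indicator (?B Q) z * ennreal (2 ^ card F)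
        \<le> 2 * M z * indicator (?B Q) z" if "Q \<in> F" for Q z
    proof (cases "z \<in> ?B Q")
      case True
      have "2 ^ card F * norm (of_real (c Q) * kern \<alpha> (\<zeta> Q) z) powr s \<le> 2 * (\<Sum>B\<in>Pow F. norm (f B z) powr s)"
        unfolding f_def by (rule random_sign_bound[OF F(1) that s])
      from mult_right_mono[OF this, of "?g z"]
      have "2 ^ card F * (norm (of_real (c Q) * kern \<alpha> (\<zeta> Q) z) powr s * ?g z) \<le>
          2 * (\<Sum>B\<in>Pow F. norm (f B z) powr s * ?g z)"
        by (simp only: sum_distrib_right mult.assoc exp_ge_zero)
      moreover have "c Q powr s * ?e \<le> norm (of_real (c Q) * kern \<alpha> (\<zeta> Q) z) powr s * ?g z"
      proof -
        have "?g z = exp (- (\<alpha> / 2) * (norm z)\<^sup>2) powr s" by (simp add: powr_def mult_ac)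
        then have "norm (of_real (c Q) * kern \<alpha> (\<zeta> Q) z) powr s * ?g z =
           c Q powr s * (norm (kern \<alpha> (\<zeta> Q) z) * exp (- (\<alpha> / 2) * (norm z)\<^sup>2)) powr s"
          using c0(1)[of Q] by (simp add: norm_mult powr_mult mult.assoc)
        also have "\<dots> = c Q powr s * exp (- (\<alpha> * s / 2) * (norm (z - \<zeta> Q))\<^sup>2)"
          unfolding norm_kern_weighted by (simp add: powr_def mult_ac)
        also have "\<dots> \<ge> c Q powr s * ?e"
        proof (intro mult_left_mono)
          have "(norm (z - \<zeta> Q))\<^sup>2 \<le> R\<^sup>2" using True by (intro power_mono) (auto simp: dist_norm norm_minus_commute)
          then have "\<alpha> * s / 2 * (norm (z - \<zeta> Q))\<^sup>2 \<le> \<alpha> * s / 2 * R\<^sup>2" using \<alpha> s by (intro mult_left_mono) auto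
          then show "?e \<le> exp (- (\<alpha> * s / 2) * (norm (z - \<zeta> Q))\<^sup>2)" by simp
        qed simp
        finally show ?thesis .
      qed
      ultimately have "2 ^ card F * (c Q powr s * ?e) \<le>
          2 * (\<Sum>B\<in>Pow F. norm (f B z) powr s * ?g z)"
        by (meson mult_left_mono order_trans zero_le_numeral zero_le_power)
      then have "ennreal (2 ^ card F * (c Q powr s * ?e)) \<le>
          ennreal (2 * (\<Sum>B\<in>Pow F. norm (f B z) powr s * ?g z))" by (rule ennreal_leI)
      also have "\<dots> = 2 * M z" unfolding M_def weighted_power_def
        by (subst sum_ennreal) (auto simp: ennreal_mult sum_nonneg)
      finally show ?thesis using True by (simp add: ennreal_mult mult_ac)
    qed simp
    have overlap: "(\<Sum>Q\<in>F. indicator (?B Q) z) \<le> ennreal N" for z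
    proof -
      have "(\<Sum>Q\<in>F. indicator (?B Q) z) = (\<Sum>\<^sup>+Q\<in>F. indicator (?B Q) z)"
        using F(1) by (simp add: nn_integral_count_space_finite)
      also have "\<dots> \<le> (\<Sum>\<^sup>+Q\<in>pockets \<delta>. indicator (?B Q) z)"
        by (rule nn_integral_count_space_mono_set[OF F(2)])
      also have "\<dots> \<le> (\<Sum>\<^sup>+Q\<in>pockets \<delta>. ennreal (exp (R\<^sup>2)) * ennreal (gauss 1 z (\<zeta> Q)))"
      proof (rule nn_integral_mono)
        fix Q
        have "1 \<le> exp (R\<^sup>2) * gauss 1 z (\<zeta> Q)" if "z \<in> ?B Q"
        proof -
          have "(norm (z - \<zeta> Q))\<^sup>2 \<le> R\<^sup>2" using that by (intro power_mono) (auto simp: dist_norm norm_minus_commute)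
          then show ?thesis by (simp add: exp_add[symmetric])
        qed
        then show "indicator (?B Q) z \<le> ennreal (exp (R\<^sup>2)) * ennreal (gauss 1 z (\<zeta> Q))"
          by (auto simp: ennreal_mult[symmetric] simp del: mem_ball split: split_indicator)
      qed
      also have "\<dots> = ennreal (exp (R\<^sup>2)) * (\<Sum>\<^sup>+Q\<in>pockets \<delta>. ennreal (gauss 1 z (\<zeta> Q)))"
        by (rule nn_integral_cmult) simp
      also have "\<dots> \<le> ennreal (exp (R\<^sup>2)) * ennreal A" by (rule mult_left_mono[OF sumA[rule_format]]) simp
      also have "\<dots> = ennreal N" using A by (simp add: N_def ennreal_mult)
      finally show ?thesis .
    qed
    define T where "T = (\<Sum>Q\<in>F. ennreal (c Q powr s * ?e) * emeasure \<mu> (?B Q))"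
    have "T * ennreal (2 ^ card F) = (\<integral>\<^sup>+ z. (\<Sum>Q\<in>F. ennreal (c Q powr s * ?e) * indicator (?B Q) z * ennreal (2 ^ card F)) \<partial>\<mu>)"
    proof -
      have "(\<integral>\<^sup>+ z. ennreal (c Q powr s * ?e) * indicator (?B Q) z * ennreal (2 ^ card F) \<partial>\<mu>) =
         ennreal (c Q powr s * ?e) * emeasure \<mu> (?B Q) * ennreal (2 ^ card F)" for Q
        using meas by (subst nn_integral_multc) (auto simp: nn_integral_cmult_indicator intro!: borel_measurable_times_ennreal borel_measurable_indicator)
      then show ?thesis unfolding T_def sum_distrib_right using meas
        by (subst nn_integral_sum) (auto intro!: borel_measurable_times_ennreal borel_measurable_indicator)
    qed
    also have "\<dots> \<le> (\<integral>\<^sup>+ z. ennreal (2 * N) * M z \<partial>\<mu>)"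
    proof (rule nn_integral_mono)
      fix z
      have "(\<Sum>Q\<in>F. ennreal (c Q powr s * ?e) * indicator (?B Q) z * ennreal (2 ^ card F)) \<le>
         (\<Sum>Q\<in>F. 2 * M z * indicator (?B Q) z)" by (intro sum_mono single)
      also have "\<dots> = 2 * M z * (\<Sum>Q\<in>F. indicator (?B Q) z)" by (simp only: sum_distrib_left)
      also have "\<dots> \<le> 2 * M z * ennreal N" by (rule mult_left_mono[OF overlap]) simp
      also have "\<dots> = ennreal (2 * N) * M z" using N by (simp add: ennreal_mult mult_ac)
      finally show "(\<Sum>Q\<in>F. ennreal (c Q powr s * ?e) * indicator (?B Q) z * ennreal (2 ^ card F)) \<le> ennreal (2 * N) * M z" .
    qed
    also have "\<dots> = ennreal (2 * N) * (\<Sum>B\<in>Pow F. \<integral>\<^sup>+ z. weighted_power (f B) z \<partial>\<mu>)"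
      unfolding M_def using wmeas by (subst nn_integral_cmult) (auto simp: nn_integral_sum)
    also have "\<dots> \<le> ennreal (2 * N) * (\<Sum>B\<in>Pow F. emb \<mu>)"
      by (intro mult_left_mono sum_mono emb_le) simp
    also have "(\<Sum>B\<in>Pow F. emb \<mu>) = ennreal (2 ^ card F) * emb \<mu>"
      using F(1) by (simp add: card_Pow ennreal_power[symmetric])
    finally have "ennreal (2 ^ card F) * T \<le> ennreal (2 ^ card F) * (ennreal (2 * N) * emb \<mu>)"
      by (simp only: mult_ac)
    \<comment> \<open>The number of sign choices is positive and finite, so it cancels and leaves a
      bound independent of \<open>F\<close>.\<close>
    then have T: "T \<le> ennreal (2 * N) * emb \<mu>"
      by (subst (asm) ennreal_mult_le_mult_iff) auto
    have "(\<Sum>Q\<in>F. ennreal (X Q powr s) * wmass \<mu> R Q) = ennreal (C0 powr s * ?e') * T"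
      unfolding T_def sum_distrib_left
    proof (rule sum.cong[OF refl])
      fix Q
      define m where "m = emeasure \<mu> (?B Q)"
      have e: "?e' * ?e = 1" by (simp add: exp_add[symmetric])
      have "X Q = c Q * (C0 * wt (fst Q))" using C0 wt_pos[of "fst Q"] by (simp add: c_def)
      then have "X Q powr s = C0 powr s * (c Q powr s * wt (fst Q) powr s)"
        by (simp add: powr_mult)
      then have "X Q powr s * wt (fst Q) powr - s = C0 powr s * (c Q powr s * (wt (fst Q) powr - s * wt (fst Q) powr s))"
        by (simp only: mult_ac)
      also have "\<dots> = (C0 powr s * c Q powr s) * (?e' * ?e)"
        unfolding wt_ratio(1) e by simp
      finally have eq: "X Q powr s * wt (fst Q) powr - s = (C0 powr s * ?e') * (c Q powr s * ?e)"
        by (simp only: mult_ac)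
      have "ennreal (X Q powr s) * wmass \<mu> R Q = ennreal (X Q powr s * wt (fst Q) powr - s) * m"
        by (simp add: wmass_def m_def ennreal_mult mult.assoc)
      also have "\<dots> = ennreal (C0 powr s * ?e') * (ennreal (c Q powr s * ?e) * m)"
        unfolding eq by (subst ennreal_mult) (auto simp: mult.assoc)
      finally show "ennreal (X Q powr s) * wmass \<mu> R Q = ennreal (C0 powr s * ?e') *
         (ennreal (c Q powr s * ?e) * emeasure \<mu> (?B Q))"
        by (simp only: m_def)
    qed
    also have "\<dots> \<le> ennreal (C0 powr s * ?e') * (ennreal (2 * N) * emb \<mu>)"
      by (rule mult_left_mono[OF T]) simp
    also have "\<dots> = ennreal K * emb \<mu>"
    proof -
      have "ennreal K = ennreal (C0 powr s * ?e') * ennreal (2 * N)"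
        unfolding K_def using N by (intro ennreal_mult) auto
      then show ?thesis by (simp only: mult.assoc)
    qed
    finally show "(\<Sum>Q\<in>(\<Union>k<n. S k). ennreal (X Q powr s) * wmass \<mu> R Q) \<le> ennreal K * emb \<mu>"
      by (simp only: F_def)
  qed
  with K show ?thesis by blast
qed

end

subsection \<open>Averages over shells\<close>

lemma annulus_borel: "annulus k \<in> sets borel"
proof -
  have "annulus k = {z. real k \<le> norm z} \<inter> {z. norm z < real k + 1}" by (auto simp: annulus_def)
  moreover have "closed {z :: complex. real k \<le> norm z}" "open {z :: complex. norm z < real k + 1}"
    by (auto intro!: closed_Collect_le open_Collect_less continuous_intros)
  ultimately show ?thesis by (simp add: borel_closed borel_open)
qed

lemma annulus_lebesgue: "annulus k \<in> sets lebesgue"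
  using annulus_borel[of k] by simp

lemma lebesgue_integral_annulus:
  "(\<integral>\<^sup>+ z. g z \<partial>lebesgue_on (annulus k)) = (\<integral>\<^sup>+ z. g z * indicator (annulus k) z \<partial>lebesgue)"
  using annulus_lebesgue[of k] by (simp add: nn_integral_restrict_space)

lemma emeasure_lebesgue_ball: "r \<ge> 0 \<Longrightarrow> emeasure lebesgue (ball (w :: complex) r) = ennreal (pi * r\<^sup>2)"
  by (simp add: emeasure_ball unit_ball_vol_2)

lemma ball_lebesgue: "ball (w :: complex) r \<in> sets lebesgue"
  by simp

context carleson_setting
begin

text \<open>Combines the size of the Fock norm of a kernel with the freezing of the weight on a
  shell, uniformly in \<mu>.\<close>

lemma ball_mass_bounds:
  "\<exists>C>0. \<forall>\<mu> k. \<forall>z\<in>annulus k.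
     bmass \<mu> z \<le> ennreal C * (ennreal (wt k powr - s) * emeasure \<mu> (ball z R)) \<and>
     ennreal (wt k powr - s) * emeasure \<mu> (ball z R) \<le> ennreal C * bmass \<mu> z"
proof -
  obtain C where C: "C > 0" and cmp: "\<forall>w. comparable C (Fock_norm \<alpha> p q (kern \<alpha> w)) (ennreal (kern_weight p q (norm w)))"
    using Fock_norm_kern[OF \<alpha> p q] by (elim exE conjE) (rule that)
  define D where "D = 2 powr \<bar>\<tau>\<bar>"
  have D: "D > 0" by (simp add: D_def)
  have "bmass \<mu> z \<le> ennreal ((C * D) powr s) * (ennreal (wt k powr - s) * emeasure \<mu> (ball z R)) \<and>
     ennreal (wt k powr - s) * emeasure \<mu> (ball z R) \<le> ennreal ((C * D) powr s) * bmass \<mu> z"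
    if z: "z \<in> annulus k" for \<mu> k z
  proof -
    define W where "W = kern_weight p q (norm z)"
    have W: "W > 0" by (simp add: W_def kern_weight_pos)
    have WD: "W \<le> D * wt k" "wt k \<le> D * W"
      using kern_weight_shell[OF z, of p q] by (auto simp: W_def wt_def D_def \<tau>_def)
    define m where "m = emeasure \<mu> (ball z R)"
    define \<Phi> where "\<Phi> = Fock_norm \<alpha> p q (kern \<alpha> z)"
    have \<Phi>b: "ennreal (1 / C) * ennreal W \<le> \<Phi>" "\<Phi> \<le> ennreal C * ennreal W"
      using cmp by (auto simp: comparable_def \<Phi>_def W_def)
    then obtain F where F: "\<Phi> = ennreal F" "F \<ge> 0"
      by (cases \<Phi>) (auto simp: top_unique ennreal_mult_eq_top_iff)
    have "1 / C * W \<le> F" "F \<le> C * W" using \<Phi>b F C W by (auto simp: ennreal_mult[symmetric] ennreal_le_iff)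
    then have F2: "wt k \<le> (C * D) * F" "F \<le> (C * D) * wt k"
    proof -
      assume a: "1 / C * W \<le> F" "F \<le> C * W"
      have "W \<le> C * F" using a(1) C by (simp add: field_simps)
      then have "D * W \<le> D * (C * F)" using D by (intro mult_left_mono) auto
      then show "wt k \<le> (C * D) * F" using WD(2) by (simp add: mult_ac)
      have "C * W \<le> C * (D * wt k)" using WD(1) C by (intro mult_left_mono) auto
      then show "F \<le> (C * D) * wt k" using a(2) by (simp add: mult_ac)
    qed
    \<comment> \<open>The kernel norm is a positive real, so dividing by its power in
      \<open>ball_mass\<close> is multiplication by a positive real.\<close>
    have Fpos: "F > 0" using F2(1) wt_pos[of k] C D F(2) by (metis less_eq_real_def mult_zero_right not_le)
    have bm: "bmass \<mu> z = m * ennreal (F powr - s)"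
    proof -
      have "bmass \<mu> z = m / ennreal (F powr s)"
        unfolding ball_mass_def m_def[symmetric] \<Phi>_def[symmetric] F(1) using F(2) by (simp add: enn_powr_ennreal)
      also have "\<dots> = m * ennreal (inverse (F powr s))"
        unfolding divide_ennreal_def using Fpos by (subst inverse_ennreal) auto
      finally show ?thesis by (simp add: powr_minus)
    qed
    have i1: "F powr - s \<le> (C * D) powr s * wt k powr - s"
    proof -
      have "wt k powr s \<le> ((C * D) * F) powr s" using F2(1) wt_pos[of k] s by (intro powr_mono2) auto
      then have "wt k powr s \<le> (C * D) powr s * F powr s" by (simp add: powr_mult)
      then show ?thesis using Fpos wt_pos[of k] by (simp add: powr_minus field_simps)
    qed
    have i2: "wt k powr - s \<le> (C * D) powr s * F powr - s"
    proof -
      have "F powr s \<le> ((C * D) * wt k) powr s" using F2(2) F(2) s by (intro powr_mono2) auto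
      then have "F powr s \<le> (C * D) powr s * wt k powr s" by (simp add: powr_mult)
      then show ?thesis using Fpos wt_pos[of k] by (simp add: powr_minus field_simps)
    qed
    have "m * ennreal (F powr - s) \<le> m * ennreal ((C * D) powr s * wt k powr - s)"
      using i1 by (intro mult_left_mono ennreal_leI) auto
    moreover have "m * ennreal (wt k powr - s) \<le> m * ennreal ((C * D) powr s * F powr - s)"
      using i2 by (intro mult_left_mono ennreal_leI) auto
    ultimately show ?thesis unfolding bm m_def[symmetric]
      by (simp add: ennreal_mult mult_ac)
  qed
  moreover have "(C * D) powr s > 0" using C D by simp
  ultimately show ?thesis by blast
qed

text \<open>The balls of radius r are disjoint and lie in the shell, so lower bounds on the balls
  integrate to a bound for the sum. For a = \<infinity>, a ball has positive area and cannot lie in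
  the null set where \<open>F\<close> exceeds its essential supremum.\<close>

lemma lp_le_shell_integral:
  assumes a: "a > 0" and r: "0 < r" "r \<le> \<epsilon>"
  shows "\<exists>C>0. \<forall>F v k. F \<in> borel_measurable borel \<longrightarrow> (\<forall>Q\<in>S k. \<forall>z\<in>ball (\<zeta> Q) r. v Q \<le> F z) \<longrightarrow>
     Lp_norm (count_space (S k)) a v \<le> ennreal C * Lp_norm (lebesgue_on (annulus k)) a F"
proof -
  define m where "m = pi * r\<^sup>2"
  have m: "m > 0" using r by (simp add: m_def)
  \<comment> \<open>The exponent 1 / a, with value 0 for a = \<infinity>, where the constant is then
    1.\<close>
  define e where "e = (if a = \<infinity> then 0 else 1 / enn2real a)"
  have "Lp_norm (count_space (S k)) a v \<le> ennreal ((1 / m) powr e) * Lp_norm (lebesgue_on (annulus k)) a F"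
    if F: "F \<in> borel_measurable borel" and le: "\<forall>Q\<in>S k. \<forall>z\<in>ball (\<zeta> Q) r. v Q \<le> F z" for F v k
  proof -
    have Fleb: "F \<in> borel_measurable lebesgue"
      using F by (intro measurable_completion) simp
    have sub: "ball (\<zeta> Q) r \<subseteq> annulus k" if "Q \<in> S k" for Q
      using shellD(6)[OF that] subset_ball[OF r(2)] by blast
    show ?thesis
    proof (cases "a = \<infinity>")
      case True
      define N where "N = esssup (lebesgue_on (annulus k)) F"
      have "v Q \<le> N" if Q: "Q \<in> S k" for Q
      proof (rule ccontr)
        assume "\<not> v Q \<le> N"
        then have gt: "N < F z" if "z \<in> ball (\<zeta> Q) r" for z using le Q that by (meson less_le_trans not_le)
        have "AE z in lebesgue_on (annulus k). F z \<le> N" unfolding N_def by (rule esssup_AE)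
        then have "AE z in lebesgue. z \<in> annulus k \<longrightarrow> F z \<le> N"
          using annulus_lebesgue[of k] by (subst (asm) AE_restrict_space_iff) auto
        then have "AE z in lebesgue. z \<notin> ball (\<zeta> Q) r"
          by (rule AE_mp) (use gt sub[OF Q] in \<open>force intro!: AE_I2\<close>)
        then have "emeasure lebesgue (ball (\<zeta> Q) r) = 0"
          by (subst (asm) AE_iff_measurable[OF ball_lebesgue[of "\<zeta> Q" r]]) auto
        then show False using emeasure_lebesgue_ball[of r "\<zeta> Q"] r m by (simp add: m_def)
      qed
      then have "(SUP Q\<in>S k. v Q) \<le> N" by (intro SUP_least)
      then show ?thesis using True m by (simp add: Lp_norm_def esssup_count_space N_def[symmetric] e_def)
    next
      case False
      define A where "A = enn2real a"
      have A: "A > 0" using finite_exponent[OF a False] by (simp add: A_def)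
      have "(\<Sum>\<^sup>+Q\<in>S k. enn_powr (v Q) A) * ennreal m = (\<Sum>Q\<in>S k. enn_powr (v Q) A * ennreal m)"
        using finite_shell[of k] by (simp add: nn_integral_count_space_finite sum_distrib_right)
      also have "\<dots> = (\<Sum>Q\<in>S k. \<integral>\<^sup>+ z. enn_powr (v Q) A * indicator (ball (\<zeta> Q) r) z \<partial>lebesgue)"
        using r emeasure_lebesgue_ball[of r] by (intro sum.cong refl) (simp add: nn_integral_cmult_indicator m_def)
      also have "\<dots> \<le> (\<Sum>Q\<in>S k. \<integral>\<^sup>+ z. enn_powr (F z) A * indicator (ball (\<zeta> Q) r) z \<partial>lebesgue)"
        using le A by (intro sum_mono nn_integral_mono) (auto intro!: enn_powr_mono split: split_indicator)
      also have "\<dots> = (\<integral>\<^sup>+ z. (\<Sum>Q\<in>S k. enn_powr (F z) A * indicator (ball (\<zeta> Q) r) z) \<partial>lebesgue)"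
        using Fleb by (intro nn_integral_sum[symmetric] borel_measurable_times_ennreal enn_powr_measurable borel_measurable_indicator ball_lebesgue)
      also have "\<dots> \<le> (\<integral>\<^sup>+ z. enn_powr (F z) A * indicator (annulus k) z \<partial>lebesgue)"
      proof (rule nn_integral_mono)
        fix z
        show "(\<Sum>Q\<in>S k. enn_powr (F z) A * indicator (ball (\<zeta> Q) r) z) \<le> enn_powr (F z) A * indicator (annulus k) z"
        proof (cases "\<exists>Q0\<in>S k. z \<in> ball (\<zeta> Q0) r")
          case True
          then obtain Q0 where Q0: "Q0 \<in> S k" "z \<in> ball (\<zeta> Q0) r" by blast
          have "z \<notin> ball (\<zeta> Q) r" if "Q \<in> S k" "Q \<noteq> Q0" for Q
          proof
            assume "z \<in> ball (\<zeta> Q) r"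
            then have "z \<in> ball (\<zeta> Q) \<epsilon> \<inter> ball (\<zeta> Q0) \<epsilon>" using Q0(2) subset_ball[OF r(2)] by blast
            then show False using disjoint_balls that shellD(1)[OF that(1)] shellD(1)[OF Q0(1)]
              unfolding disjoint_family_on_def by blast
          qed
          then have "(\<Sum>Q\<in>S k. enn_powr (F z) A * indicator (ball (\<zeta> Q) r) z) = (\<Sum>Q\<in>S k. if Q = Q0 then enn_powr (F z) A else 0)"
            using Q0 by (intro sum.cong) (auto simp del: mem_ball split: split_indicator)
          also have "\<dots> = enn_powr (F z) A" using Q0 finite_shell[of k] by simp
          finally show ?thesis using sub[OF Q0(1)] Q0(2) by (simp add: subsetD)
        next
          case False
          then have "(\<Sum>Q\<in>S k. enn_powr (F z) A * indicator (ball (\<zeta> Q) r) z) = 0"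
            by (intro sum.neutral) (auto simp del: mem_ball split: split_indicator)
          then show ?thesis by simp
        qed
      qed
      finally have *: "(\<Sum>\<^sup>+Q\<in>S k. enn_powr (v Q) A) * ennreal m \<le> (\<integral>\<^sup>+ z. enn_powr (F z) A \<partial>lebesgue_on (annulus k))"
        unfolding lebesgue_integral_annulus .
      have "(\<Sum>\<^sup>+Q\<in>S k. enn_powr (v Q) A) = ennreal (1 / m) * ((\<Sum>\<^sup>+Q\<in>S k. enn_powr (v Q) A) * ennreal m)"
        using m by (subst mult.left_commute) (simp add: ennreal_mult[symmetric])
      also have "\<dots> \<le> ennreal (1 / m) * (\<integral>\<^sup>+ z. enn_powr (F z) A \<partial>lebesgue_on (annulus k))"
        by (rule mult_left_mono[OF *]) simp
      finally have "enn_powr (\<Sum>\<^sup>+Q\<in>S k. enn_powr (v Q) A) (1 / A) \<le> enn_powr \<dots> (1 / A)"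
        using A by (intro enn_powr_mono) auto
      also have "\<dots> = ennreal ((1 / m) powr e) * enn_powr (\<integral>\<^sup>+ z. enn_powr (F z) A \<partial>lebesgue_on (annulus k)) (1 / A)"
        using A m False by (simp add: enn_powr_mult enn_powr_ennreal e_def A_def[symmetric])
      finally show ?thesis using False by (simp add: Lp_norm_def A_def)
    qed
  qed
  moreover have "(1 / m) powr e > 0" using m by simp
  ultimately show ?thesis by blast
qed

text \<open>The counterpart in the other direction: the balls of radius \<open>\<rho>\<close> cover
  the shell, so the integral is at most the sum over these balls.\<close>

lemma shell_integral_le_lp:
  assumes a: "a > 0"
  shows "\<exists>C>0. \<forall>F v k. F \<in> borel_measurable borel \<longrightarrow> (\<forall>Q\<in>S k. \<forall>z\<in>ball (\<zeta> Q) \<rho> \<inter> annulus k. F z \<le> v Q) \<longrightarrow>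
     Lp_norm (lebesgue_on (annulus k)) a F \<le> ennreal C * Lp_norm (count_space (S k)) a v"
proof -
  define m where "m = pi * \<rho>\<^sup>2"
  have \<rho>: "\<rho> > 0" using radii by linarith
  then have m: "m > 0" by (simp add: m_def)
  define e where "e = (if a = \<infinity> then 0 else 1 / enn2real a)"
  have "Lp_norm (lebesgue_on (annulus k)) a F \<le> ennreal (m powr e) * Lp_norm (count_space (S k)) a v"
    if F: "F \<in> borel_measurable borel" and le: "\<forall>Q\<in>S k. \<forall>z\<in>ball (\<zeta> Q) \<rho> \<inter> annulus k. F z \<le> v Q" for F v k
  proof -
    have Fleb: "F \<in> borel_measurable lebesgue"
      using F by (intro measurable_completion) simp
    show ?thesis
    proof (cases "a = \<infinity>")
      case True
      have "F z \<le> (SUP Q\<in>S k. v Q)" if "z \<in> annulus k" for z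
      proof -
        obtain Q where "Q \<in> S k" "z \<in> ball (\<zeta> Q) \<rho>" using balls_cover[OF \<open>z \<in> annulus k\<close>] by blast
        then have "F z \<le> v Q" using le \<open>z \<in> annulus k\<close> by blast
        also have "v Q \<le> (SUP Q\<in>S k. v Q)" using \<open>Q \<in> S k\<close> by (rule SUP_upper)
        finally show ?thesis .
      qed
      then have "esssup (lebesgue_on (annulus k)) F \<le> (SUP Q\<in>S k. v Q)"
        using Fleb by (intro esssup_I measurable_restrict_space1 AE_I2) (auto simp: space_restrict_space)
      then show ?thesis using True m by (simp add: Lp_norm_def esssup_count_space e_def)
    next
      case False
      define A where "A = enn2real a"
      have A: "A > 0" using finite_exponent[OF a False] by (simp add: A_def)
      have "(\<integral>\<^sup>+ z. enn_powr (F z) A * indicator (annulus k) z \<partial>lebesgue) \<le>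
          (\<integral>\<^sup>+ z. (\<Sum>Q\<in>S k. enn_powr (v Q) A * indicator (ball (\<zeta> Q) \<rho>) z) \<partial>lebesgue)"
      proof (rule nn_integral_mono)
        fix z
        show "enn_powr (F z) A * indicator (annulus k) z \<le> (\<Sum>Q\<in>S k. enn_powr (v Q) A * indicator (ball (\<zeta> Q) \<rho>) z)"
        proof (cases "z \<in> annulus k")
          case True
          obtain Q where Q: "Q \<in> S k" "z \<in> ball (\<zeta> Q) \<rho>" using balls_cover[OF True] by blast
          then have "F z \<le> v Q" using le True by blast
          then have "enn_powr (F z) A \<le> enn_powr (v Q) A * indicator (ball (\<zeta> Q) \<rho>) z"
            using A Q(2) by (simp add: enn_powr_mono)
          also have "\<dots> \<le> (\<Sum>Q\<in>S k. enn_powr (v Q) A * indicator (ball (\<zeta> Q) \<rho>) z)"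
            using Q(1) finite_shell[of k] by (intro member_le_sum) auto
          finally show ?thesis using True by simp
        qed simp
      qed
      also have "\<dots> = (\<Sum>Q\<in>S k. \<integral>\<^sup>+ z. enn_powr (v Q) A * indicator (ball (\<zeta> Q) \<rho>) z \<partial>lebesgue)"
        by (intro nn_integral_sum borel_measurable_times_ennreal borel_measurable_const borel_measurable_indicator ball_lebesgue)
      also have "\<dots> = (\<Sum>Q\<in>S k. enn_powr (v Q) A * ennreal m)"
        using \<rho> emeasure_lebesgue_ball[of \<rho>] by (intro sum.cong refl) (simp add: nn_integral_cmult_indicator m_def)
      also have "\<dots> = ennreal m * (\<Sum>\<^sup>+Q\<in>S k. enn_powr (v Q) A)"
        using finite_shell[of k] by (simp add: nn_integral_count_space_finite sum_distrib_left mult.commute)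
      finally have "enn_powr (\<integral>\<^sup>+ z. enn_powr (F z) A \<partial>lebesgue_on (annulus k)) (1 / A) \<le>
          enn_powr (ennreal m * (\<Sum>\<^sup>+Q\<in>S k. enn_powr (v Q) A)) (1 / A)"
        unfolding lebesgue_integral_annulus using A by (intro enn_powr_mono) auto
      also have "\<dots> = ennreal (m powr e) * enn_powr (\<Sum>\<^sup>+Q\<in>S k. enn_powr (v Q) A) (1 / A)"
        using A m False by (simp add: enn_powr_mult enn_powr_ennreal e_def A_def[symmetric])
      finally show ?thesis using False by (simp add: Lp_norm_def A_def)
    qed
  qed
  moreover have "m powr e > 0" using m by simp
  ultimately show ?thesis by blast
qed

abbreviation "fun_norm \<equiv> shell_fun_norm (star_exp s p) (star_exp s q)"

lemma wmass_le_pocket_mass: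
  "\<exists>C>0. \<forall>\<mu>. sets \<mu> = sets borel \<longrightarrow> dual_norm (wmass \<mu> \<rho>) \<le> ennreal C * dual_norm (pmass \<mu>) \<and>
     dual_norm (pmass \<mu>) \<le> ennreal C * dual_norm (wmass \<mu> R)"
proof -
  obtain C where C: "C > 0" and bm: "\<forall>\<mu> k. \<forall>z\<in>annulus k.
     bmass \<mu> z \<le> ennreal C * (ennreal (wt k powr - s) * emeasure \<mu> (ball z R)) \<and>
     ennreal (wt k powr - s) * emeasure \<mu> (ball z R) \<le> ennreal C * bmass \<mu> z"
    using ball_mass_bounds by (elim exE conjE) (rule that)
  have "dual_norm (wmass \<mu> \<rho>) \<le> ennreal C * dual_norm (pmass \<mu>) \<and>
     dual_norm (pmass \<mu>) \<le> ennreal C * dual_norm (wmass \<mu> R)" if \<mu>: "sets \<mu> = sets borel" for \<mu>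
  proof -
    have b: "pmass \<mu> Q \<le> ennreal C * wmass \<mu> R Q \<and> wmass \<mu> R Q \<le> ennreal C * pmass \<mu> Q"
      if "Q \<in> S k" for Q k
      using bm[rule_format, OF shellD(3)[OF that], of \<mu>] shellD(2)[OF that] by (simp add: pocket_mass_def wmass_def)
    have "wmass \<mu> \<rho> Q \<le> wmass \<mu> R Q" for Q
      unfolding wmass_def using \<mu> radii by (intro mult_left_mono emeasure_mono subset_ball) auto
    then have "dual_norm (wmass \<mu> \<rho>) \<le> dual_norm (\<lambda>Q. ennreal C * pmass \<mu> Q)"
      using b by (intro mix_norm_mono star_pos) (meson order_trans)
    moreover have "dual_norm (pmass \<mu>) \<le> dual_norm (\<lambda>Q. ennreal C * wmass \<mu> R Q)"
      using b by (intro mix_norm_mono star_pos) blast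
    ultimately show ?thesis by (simp only: mix_norm_cmult[OF star_pos])
  qed
  with C show ?thesis by blast
qed

lemma wmass_le_fun_norm:
  "\<exists>C>0. \<forall>\<mu>. sets \<mu> = sets borel \<longrightarrow> dual_norm (wmass \<mu> \<rho>) \<le> ennreal C * fun_norm (bmass \<mu>)"
proof -
  obtain C where C: "C > 0" and bm: "\<forall>\<mu> k. \<forall>z\<in>annulus k.
     bmass \<mu> z \<le> ennreal C * (ennreal (wt k powr - s) * emeasure \<mu> (ball z R)) \<and>
     ennreal (wt k powr - s) * emeasure \<mu> (ball z R) \<le> ennreal C * bmass \<mu> z"
    using ball_mass_bounds by (elim exE conjE) (rule that)
  \<comment> \<open>For z within r of a centre, the R-ball about \<open>z\<close> still contains the
    \<rho>-ball about the centre, and \<open>z\<close> stays in the same shell. Positivity of r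
    rests on \<rho> < R.\<close>
  define r where "r = min \<epsilon> (R - \<rho>)"
  have r: "0 < r" "r \<le> \<epsilon>" using radii by (auto simp: r_def)
  obtain D where D: "D > 0" and lp: "\<forall>F v k. F \<in> borel_measurable borel \<longrightarrow> (\<forall>Q\<in>S k. \<forall>z\<in>ball (\<zeta> Q) r. v Q \<le> F z) \<longrightarrow>
     Lp_norm (count_space (S k)) (star_exp s p) v \<le> ennreal D * Lp_norm (lebesgue_on (annulus k)) (star_exp s p) F"
    using lp_le_shell_integral[OF star_pos(1) r] by (elim exE conjE) (rule that)
  have "dual_norm (wmass \<mu> \<rho>) \<le> ennreal (C * D) * fun_norm (bmass \<mu>)" if \<mu>: "sets \<mu> = sets borel" for \<mu>
  proof -
    define U where "U = bmass \<mu>"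
    define v where "v Q = ennreal (1 / C) * wmass \<mu> \<rho> Q" for Q
    have U: "U \<in> borel_measurable borel" unfolding U_def by (rule ball_mass_measurable[OF \<alpha> p q \<mu>])
    have "v Q \<le> U z" if Q: "Q \<in> S k" and z: "z \<in> ball (\<zeta> Q) r" for Q z k
    proof -
      have "z \<in> annulus k" using shellD(6)[OF Q] subset_ball[OF r(2)] z by blast
      have "ball (\<zeta> Q) \<rho> \<subseteq> ball z R"
      proof
        fix y assume "y \<in> ball (\<zeta> Q) \<rho>"
        then show "y \<in> ball z R" using z dist_triangle[of z y "\<zeta> Q"] by (simp add: r_def dist_commute)
      qed
      then have "wmass \<mu> \<rho> Q \<le> ennreal (wt k powr - s) * emeasure \<mu> (ball z R)"
        unfolding wmass_def shellD(2)[OF Q] using \<mu> by (intro mult_left_mono emeasure_mono) auto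
      also have "\<dots> \<le> ennreal C * U z" using bm \<open>z \<in> annulus k\<close> unfolding U_def by blast
      finally have "v Q \<le> ennreal (1 / C) * (ennreal C * U z)" unfolding v_def by (rule mult_left_mono) simp
      also have "\<dots> = U z" using C by (simp add: mult.assoc[symmetric] ennreal_mult[symmetric])
      finally show ?thesis .
    qed
    then have "Lp_norm (count_space (S k)) (star_exp s p) v \<le> ennreal D * Lp_norm (lebesgue_on (annulus k)) (star_exp s p) U" for k
      using lp[rule_format, OF U, of k v] by blast
    then have "dual_norm v \<le> ennreal D * fun_norm U"
      unfolding mix_norm_def shell_fun_norm_def lp_norm_cmult[OF star_pos(2), symmetric]
      by (intro lp_norm_mono star_pos)
    moreover have "dual_norm v = ennreal (1 / C) * dual_norm (wmass \<mu> \<rho>)" unfolding v_def by (rule mix_norm_cmult[OF star_pos])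
    ultimately have "ennreal C * (ennreal (1 / C) * dual_norm (wmass \<mu> \<rho>)) \<le> ennreal C * (ennreal D * fun_norm U)"
      by (intro mult_left_mono) auto
    moreover have "ennreal C * (ennreal (1 / C) * dual_norm (wmass \<mu> \<rho>)) = dual_norm (wmass \<mu> \<rho>)"
      using C by (simp add: mult.assoc[symmetric] ennreal_mult[symmetric])
    ultimately show ?thesis using C D by (simp add: U_def ennreal_mult mult.assoc)
  qed
  moreover have "C * D > 0" using C D by simp
  ultimately show ?thesis by blast
qed

text \<open>A ball of radius \<open>R\<close> is covered by the \<rho>-balls of pockets at bounded
  distance. These may lie in other shells, so the weights are compared through \<open>ratio\<close>,
  and the resulting operator is bounded by the Schur test.\<close>

lemma fun_norm_le_wmass:
  "\<exists>C>0. \<forall>\<mu>. sets \<mu> = sets borel \<longrightarrow> fun_norm (bmass \<mu>) \<le> ennreal C * dual_norm (wmass \<mu> \<rho>)"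
proof -
  obtain C where C: "C > 0" and bm: "\<forall>\<mu> k. \<forall>z\<in>annulus k.
     bmass \<mu> z \<le> ennreal C * (ennreal (wt k powr - s) * emeasure \<mu> (ball z R)) \<and>
     ennreal (wt k powr - s) * emeasure \<mu> (ball z R) \<le> ennreal C * bmass \<mu> z"
    using ball_mass_bounds by (elim exE conjE) (rule that)
  obtain D where D: "D > 0" and lp: "\<forall>F v k. F \<in> borel_measurable borel \<longrightarrow> (\<forall>Q\<in>S k. \<forall>z\<in>ball (\<zeta> Q) \<rho> \<inter> annulus k. F z \<le> v Q) \<longrightarrow>
     Lp_norm (lebesgue_on (annulus k)) (star_exp s p) F \<le> ennreal D * Lp_norm (count_space (S k)) (star_exp s p) v"
    using shell_integral_le_lp[OF star_pos(1)] by (elim exE conjE) (rule that)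
  obtain C1 where C1: "C1 > 0" and Schur: "\<forall>x y. (\<Sum>\<^sup>+Q\<in>pockets \<delta>. (\<Sum>\<^sup>+Q'\<in>pockets \<delta>. enn_powr (x Q) s * y Q' * ennreal (dist_kernel 1 (\<tau> * s) Q Q'))) \<le> ennreal C1 * enn_powr (seq_norm x) s * dual_norm y"
    using Schur_pockets[OF zero_less_one, of "\<tau> * s"] by (elim exE conjE) (rule that)
  \<comment> \<open>For z within \<rho> of a centre, every centre whose \<rho>-ball meets the R-ball
    about \<open>z\<close> lies at distance less than R + 2 * \<rho> from the first one. There
    \<open>H\<close> times the Gaussian of rate 1 is at least 1.\<close>
  define H where "H = exp ((R + 2 * \<rho>)\<^sup>2)"
  have H: "H > 0" by (simp add: H_def)
  have "fun_norm (bmass \<mu>) \<le> ennreal (D * (C * H) * C1) * dual_norm (wmass \<mu> \<rho>)" if \<mu>: "sets \<mu> = sets borel" for \<mu>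
  proof -
    define U where "U = bmass \<mu>"
    have U: "U \<in> borel_measurable borel" unfolding U_def by (rule ball_mass_measurable[OF \<alpha> p q \<mu>])
    define t where "t Q = (\<Sum>\<^sup>+Q'\<in>pockets \<delta>. wmass \<mu> \<rho> Q' * ennreal (dist_kernel 1 (\<tau> * s) Q Q'))" for Q
    have Ut: "U z \<le> ennreal (C * H) * t Q" if Q: "Q \<in> S k" and z: "z \<in> ball (\<zeta> Q) \<rho> \<inter> annulus k" for Q z k
    proof -
      define J where "J = {Q' \<in> pockets \<delta>. norm (\<zeta> Q - \<zeta> Q') < R + 2 * \<rho>}"
      have J: "countable J" by (rule countable_subset[OF _ countable_pockets]) (auto simp: J_def)
      have "ball z R \<subseteq> (\<Union>Q'\<in>J. ball (\<zeta> Q') \<rho>)"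
      proof
        fix y assume y: "y \<in> ball z R"
        obtain Q' where Q': "Q' \<in> pockets \<delta>" "y \<in> ball (\<zeta> Q') \<rho>" using ex_pocket_ball by blast
        have "dist (\<zeta> Q) (\<zeta> Q') \<le> dist (\<zeta> Q) z + dist z y + dist y (\<zeta> Q')"
          using dist_triangle[of "\<zeta> Q" "\<zeta> Q'" z] dist_triangle[of z "\<zeta> Q'" y] by linarith
        also have "\<dots> < R + 2 * \<rho>" using y Q'(2) z by (simp add: dist_commute)
        finally have "Q' \<in> J" using Q'(1) by (simp add: J_def dist_norm del: center.simps)
        then show "y \<in> (\<Union>Q'\<in>J. ball (\<zeta> Q') \<rho>)" using Q'(2) by blast
      qed
      then have "emeasure \<mu> (ball z R) \<le> emeasure \<mu> (\<Union>Q'\<in>J. ball (\<zeta> Q') \<rho>)"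
        using \<mu> by (intro emeasure_mono) auto
      also have "\<dots> \<le> (\<Sum>\<^sup>+Q'\<in>J. emeasure \<mu> (ball (\<zeta> Q') \<rho>))"
      proof -
        \<comment> \<open>Countable subadditivity over an arbitrary countable index set, through
          indicators and Tonelli.\<close>
        have "emeasure \<mu> (\<Union>Q'\<in>J. ball (\<zeta> Q') \<rho>) = (\<integral>\<^sup>+ y. indicator (\<Union>Q'\<in>J. ball (\<zeta> Q') \<rho>) y \<partial>\<mu>)"
          using \<mu> by (intro nn_integral_indicator[symmetric]) auto
        also have "\<dots> \<le> (\<integral>\<^sup>+ y. (\<Sum>\<^sup>+Q'\<in>J. indicator (ball (\<zeta> Q') \<rho>) y) \<partial>\<mu>)"
        proof (rule nn_integral_mono)
          fix y
          show "indicator (\<Union>Q'\<in>J. ball (\<zeta> Q') \<rho>) y \<le> (\<Sum>\<^sup>+Q'\<in>J. indicator (ball (\<zeta> Q') \<rho>) y)"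
          proof (cases "\<exists>Q0\<in>J. y \<in> ball (\<zeta> Q0) \<rho>")
            case True
            then obtain Q0 where Q0: "Q0 \<in> J" "y \<in> ball (\<zeta> Q0) \<rho>" by blast
            have "1 \<le> (\<Sum>\<^sup>+Q'\<in>J. indicator (ball (\<zeta> Q') \<rho>) y)"
              using nn_integral_ge_point[OF Q0(1), of "\<lambda>Q'. indicator (ball (\<zeta> Q') \<rho>) y"] Q0(2) by simp
            moreover have "indicator (\<Union>Q'\<in>J. ball (\<zeta> Q') \<rho>) y \<le> (1 :: ennreal)"
              by (simp only: indicator_def split: if_split) simp
            ultimately show ?thesis by (meson order_trans)
          next
            case False
            then show ?thesis by (auto simp del: mem_ball split: split_indicator)
          qed
        qed
        also have "\<dots> = (\<Sum>\<^sup>+Q'\<in>J. \<integral>\<^sup>+ y. indicator (ball (\<zeta> Q') \<rho>) y \<partial>\<mu>)"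
          using J \<mu> by (intro nn_integral_count_space_nn_integral borel_measurable_indicator) auto
        also have "\<dots> = (\<Sum>\<^sup>+Q'\<in>J. emeasure \<mu> (ball (\<zeta> Q') \<rho>))"
          using \<mu> by (intro nn_integral_cong nn_integral_indicator) auto
        finally show ?thesis .
      qed
      finally have "ennreal (wt k powr - s) * emeasure \<mu> (ball z R) \<le>
          ennreal (wt k powr - s) * (\<Sum>\<^sup>+Q'\<in>J. emeasure \<mu> (ball (\<zeta> Q') \<rho>))" by (rule mult_left_mono) simp
      also have "\<dots> = (\<Sum>\<^sup>+Q'\<in>J. ennreal (wt k powr - s) * emeasure \<mu> (ball (\<zeta> Q') \<rho>))"
        by (rule nn_integral_cmult[symmetric]) simp
      also have "\<dots> \<le> (\<Sum>\<^sup>+Q'\<in>J. ennreal H * (wmass \<mu> \<rho> Q' * ennreal (dist_kernel 1 (\<tau> * s) Q Q')))"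
      proof (rule nn_integral_mono)
        fix Q' assume "Q' \<in> space (count_space J)"
        then have "norm (\<zeta> Q - \<zeta> Q') < R + 2 * \<rho>" by (simp add: J_def)
        then have "(norm (\<zeta> Q - \<zeta> Q'))\<^sup>2 \<le> (R + 2 * \<rho>)\<^sup>2" by (intro power_mono) auto
        then have ge1: "1 \<le> H * gauss 1 (\<zeta> Q) (\<zeta> Q')" by (simp add: H_def exp_add[symmetric])
        have "wt k powr - s = wt k powr - s * (wt (fst Q') powr - s * wt (fst Q') powr s)" unfolding wt_ratio(1) by simp
        also have "\<dots> = 1 * (wt (fst Q') powr - s * ratio (\<tau> * s) Q Q')"
          unfolding wt_ratio(2) shellD(2)[OF Q] by (simp only: mult_ac mult_1_left mult_1_right)
        also have "\<dots> \<le> (H * gauss 1 (\<zeta> Q) (\<zeta> Q')) * (wt (fst Q') powr - s * ratio (\<tau> * s) Q Q')"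
          using ge1 by (rule mult_right_mono) (simp add: ratio_def)
        also have "\<dots> = H * (wt (fst Q') powr - s * dist_kernel 1 (\<tau> * s) Q Q')"
          unfolding dist_kernel_def by (simp only: mult_ac)
        finally have "ennreal (wt k powr - s) \<le> ennreal H * (ennreal (wt (fst Q') powr - s) * ennreal (dist_kernel 1 (\<tau> * s) Q Q'))"
          using H by (simp add: ennreal_mult[symmetric] ennreal_leI dist_kernel_def ratio_def)
        then have "ennreal (wt k powr - s) * emeasure \<mu> (ball (\<zeta> Q') \<rho>) \<le>
          (ennreal H * (ennreal (wt (fst Q') powr - s) * ennreal (dist_kernel 1 (\<tau> * s) Q Q'))) * emeasure \<mu> (ball (\<zeta> Q') \<rho>)"
          by (rule mult_right_mono) simp
        then show "ennreal (wt k powr - s) * emeasure \<mu> (ball (\<zeta> Q') \<rho>) \<le> ennreal H * (wmass \<mu> \<rho> Q' * ennreal (dist_kernel 1 (\<tau> * s) Q Q'))"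
          by (simp only: wmass_def mult_ac)
      qed
      also have "\<dots> = ennreal H * (\<Sum>\<^sup>+Q'\<in>J. (wmass \<mu> \<rho> Q' * ennreal (dist_kernel 1 (\<tau> * s) Q Q')))"
        by (rule nn_integral_cmult) simp
      also have "\<dots> \<le> ennreal H * t Q"
        unfolding t_def by (intro mult_left_mono nn_integral_count_space_mono_set) (auto simp: J_def)
      finally have "ennreal C * (ennreal (wt k powr - s) * emeasure \<mu> (ball z R)) \<le> ennreal C * (ennreal H * t Q)"
        by (rule mult_left_mono) simp
      moreover have "U z \<le> ennreal C * (ennreal (wt k powr - s) * emeasure \<mu> (ball z R))"
        using bm z unfolding U_def by blast
      ultimately show ?thesis using C H by (simp add: ennreal_mult mult.assoc)
    qed
    define T where "T Q = ennreal (C * H) * t Q" for Q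
    have "Lp_norm (lebesgue_on (annulus k)) (star_exp s p) U \<le> ennreal D * Lp_norm (count_space (S k)) (star_exp s p) T" for k
      using lp[rule_format, OF U, of k T] Ut unfolding T_def by blast
    then have "fun_norm U \<le> ennreal D * dual_norm T"
      unfolding mix_norm_def shell_fun_norm_def lp_norm_cmult[OF star_pos(2), symmetric]
      by (intro lp_norm_mono star_pos)
    also have "dual_norm T = ennreal (C * H) * dual_norm t" unfolding T_def by (rule mix_norm_cmult[OF star_pos])
    also have "dual_norm t \<le> ennreal C1 * dual_norm (wmass \<mu> \<rho>)"
    \<comment> \<open>The Schur bound is a bilinear estimate; duality turns it into a norm bound for
      \<open>t\<close>.\<close>
    proof (rule mixed_dual_bound[OF p q s finite_shell disjoint_shell])
      fix n X
      assume X: "\<And>Q. 0 \<le> X Q" "seq_norm (\<lambda>Q. ennreal (X Q)) \<le> 1"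
      define F where "F = (\<Union>k<n. S k)"
      have F: "finite F" "F \<subseteq> pockets \<delta>" using finite_shell by (auto simp: F_def shell_pockets_eq)
      have "(\<Sum>Q\<in>F. ennreal (X Q powr s) * t Q) = (\<Sum>\<^sup>+Q\<in>F. enn_powr (ennreal (X Q)) s * t Q)"
        using F(1) X(1) by (simp add: nn_integral_count_space_finite enn_powr_ennreal)
      also have "\<dots> \<le> (\<Sum>\<^sup>+Q\<in>pockets \<delta>. enn_powr (ennreal (X Q)) s * t Q)"
        by (rule nn_integral_count_space_mono_set[OF F(2)])
      also have "\<dots> = (\<Sum>\<^sup>+Q\<in>pockets \<delta>. (\<Sum>\<^sup>+Q'\<in>pockets \<delta>. enn_powr (ennreal (X Q)) s * wmass \<mu> \<rho> Q' * ennreal (dist_kernel 1 (\<tau> * s) Q Q')))"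
        unfolding t_def mult.assoc by (intro nn_integral_cong nn_integral_cmult[symmetric]) simp
      also have "\<dots> \<le> ennreal C1 * enn_powr (seq_norm (\<lambda>Q. ennreal (X Q))) s * dual_norm (wmass \<mu> \<rho>)"
        by (rule Schur[rule_format])
      also have "\<dots> \<le> ennreal C1 * 1 * dual_norm (wmass \<mu> \<rho>)"
        using enn_powr_mono[OF X(2), of s] s by (intro mult_right_mono mult_left_mono) auto
      finally show "(\<Sum>Q\<in>(\<Union>k<n. S k). ennreal (X Q powr s) * t Q) \<le> ennreal C1 * dual_norm (wmass \<mu> \<rho>)"
        by (simp add: F_def)
    qed
    finally have "fun_norm U \<le> ennreal D * (ennreal (C * H) * (ennreal C1 * dual_norm (wmass \<mu> \<rho>)))"
      by (simp add: mult_left_mono)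
    then show ?thesis using C C1 D H by (simp add: U_def ennreal_mult mult_ac)
  qed
  moreover have "D * (C * H) * C1 > 0" using C C1 D H by simp
  ultimately show ?thesis by blast
qed

end

section \<open>Closing the chain of inequalities\<close>

lemma comparableI:
  assumes "C > 0" "X \<le> ennreal C * Y" "Y \<le> ennreal C * X"
  shows "comparable C X Y"
proof -
  have "ennreal (1 / C) * Y \<le> ennreal (1 / C) * (ennreal C * X)" by (rule mult_left_mono[OF assms(3)]) simp
  also have "\<dots> = X" using assms(1) by (simp add: mult.assoc[symmetric] ennreal_mult[symmetric])
  finally show ?thesis using assms(2) by (simp add: comparable_def)
qed

lemma ennreal_bound_trans:
  assumes "X \<le> ennreal C * Y" "Y \<le> ennreal D * Z" "C > 0" "D > 0" "C * D \<le> K"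
  shows "X \<le> ennreal K * Z"
proof -
  have "X \<le> ennreal C * (ennreal D * Z)" using assms(1,2) by (meson mult_left_mono order_trans zero_le)
  also have "\<dots> = ennreal (C * D) * Z" using assms(3,4) by (simp add: ennreal_mult mult.assoc)
  also have "\<dots> \<le> ennreal K * Z" using assms(5) by (intro mult_right_mono ennreal_leI) auto
  finally show ?thesis .
qed

context carleson_setting
begin

lemma carleson_characterization:
  "\<exists>C>0. \<forall>\<mu>. sets \<mu> = sets borel \<longrightarrow>
    (Carleson \<alpha> p q s \<mu> \<longleftrightarrow>
       pocket_mass \<alpha> p q s \<delta> \<mu> R \<in> shell_seq_space (star_exp s p) (star_exp s q) \<delta>) \<and>
    (pocket_mass \<alpha> p q s \<delta> \<mu> R \<in> shell_seq_space (star_exp s p) (star_exp s q) \<delta> \<longleftrightarrow>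
       ball_mass \<alpha> p q s \<mu> R \<in> shell_fun_space (star_exp s p) (star_exp s q)) \<and>
    comparable C (enn_powr (embedding_norm \<alpha> p q s \<mu>) s)
      (shell_seq_norm (star_exp s p) (star_exp s q) \<delta> (pocket_mass \<alpha> p q s \<delta> \<mu> R)) \<and>
    comparable C
      (shell_seq_norm (star_exp s p) (star_exp s q) \<delta> (pocket_mass \<alpha> p q s \<delta> \<mu> R))
      (shell_fun_norm (star_exp s p) (star_exp s q) (ball_mass \<alpha> p q s \<mu> R))"
    (is "\<exists>C>0. \<forall>\<mu>. sets \<mu> = sets borel \<longrightarrow> ?P C \<mu>")
proof -
  obtain C1 where C1: "C1 > 0" and emb_le: "\<forall>\<mu>. \<forall>f\<in>Fspace. sets \<mu> = sets borel \<longrightarrow> dual_norm (wmass \<mu> \<rho>) < top \<longrightarrow>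
     Ls_norm \<alpha> s \<mu> f \<le> ennreal C1 * enn_powr (dual_norm (wmass \<mu> \<rho>)) (1 / s) * Fnorm f"
    using embedding_bound by (elim exE conjE) (rule that)
  obtain C2 where C2: "C2 > 0" and test: "\<forall>\<mu>. sets \<mu> = sets borel \<longrightarrow>
     dual_norm (wmass \<mu> R) \<le> ennreal C2 * emb \<mu>"
    using testing_bound by (elim exE conjE) (rule that)
  obtain C3 where C3: "C3 > 0" and pm: "\<forall>\<mu>. sets \<mu> = sets borel \<longrightarrow>
     dual_norm (wmass \<mu> \<rho>) \<le> ennreal C3 * dual_norm (pmass \<mu>) \<and>
     dual_norm (pmass \<mu>) \<le> ennreal C3 * dual_norm (wmass \<mu> R)"
    using wmass_le_pocket_mass by (elim exE conjE) (rule that)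
  obtain C4 where C4: "C4 > 0" and vU: "\<forall>\<mu>. sets \<mu> = sets borel \<longrightarrow> dual_norm (wmass \<mu> \<rho>) \<le> ennreal C4 * fun_norm (bmass \<mu>)"
    using wmass_le_fun_norm by (elim exE conjE) (rule that)
  obtain C5 where C5: "C5 > 0" and Uv: "\<forall>\<mu>. sets \<mu> = sets borel \<longrightarrow> fun_norm (bmass \<mu>) \<le> ennreal C5 * dual_norm (wmass \<mu> \<rho>)"
    using fun_norm_le_wmass by (elim exE conjE) (rule that)
  define D1 where "D1 = C1 powr s"
  have D1: "D1 > 0" using C1 by (simp add: D1_def)
  \<comment> \<open>The four summands are the constants of the four composite inequalities behind
    the two comparisons, so each is at most \<open>K\<close>.\<close>
  define K where "K = D1 * C3 + C3 * C2 + (C3 * C2) * (D1 * C4) + C5 * C3"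
  have pos: "D1 * C3 > 0" "C3 * C2 > 0" "D1 * C4 > 0" "(C3 * C2) * (D1 * C4) > 0" "C5 * C3 > 0"
    using C1 C2 C3 C4 C5 D1 by (auto intro!: mult_pos_pos)
  have K: "D1 * C3 \<le> K" "C3 * C2 \<le> K" "(C3 * C2) * (D1 * C4) \<le> K" "C5 * C3 \<le> K" "K > 0"
    using pos unfolding K_def by linarith+
  have "?P K \<mu>" if \<mu>: "sets \<mu> = sets borel" for \<mu>
  proof -
    define v where "v = dual_norm (wmass \<mu> \<rho>)"
    define w where "w = dual_norm (wmass \<mu> R)"
    define u where "u = dual_norm (pmass \<mu>)"
    define U where "U = fun_norm (bmass \<mu>)"
    define E where "E = emb \<mu>"
    have seq: "shell_seq_norm (star_exp s p) (star_exp s q) \<delta> (pmass \<mu>) = u"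
      by (simp add: u_def shell_seq_norm_def mix_norm_def)
    have vu: "v \<le> ennreal C3 * u" and uw: "u \<le> ennreal C3 * w"
      using pm \<mu> by (auto simp: v_def u_def w_def)
    have wE: "w \<le> ennreal C2 * E" using test \<mu> by (simp add: w_def E_def)
    have vU': "v \<le> ennreal C4 * U" and Uv': "U \<le> ennreal C5 * v"
      using vU Uv \<mu> by (auto simp: v_def U_def)
    have Ls: "Ls_norm \<alpha> s \<mu> f \<le> ennreal C1 * enn_powr v (1 / s) * Fnorm f" if "f \<in> Fspace" "v < top" for f
      using emb_le \<mu> that by (simp add: v_def)
    \<comment> \<open>The embedding bound concerns norms; raising it to the power s gives
      \<open>D1\<close>. For infinite \<open>v\<close> the right side is \<open>top\<close>.\<close>
    have Ev: "E \<le> ennreal D1 * v"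
    proof (cases "v < top")
      case True
      have "Ls_norm \<alpha> s \<mu> f \<le> ennreal C1 * enn_powr v (1 / s)" if "f \<in> Fspace" "Fnorm f \<le> 1" for f
        using Ls[OF that(1) True] mult_left_mono[OF that(2), of "ennreal C1 * enn_powr v (1 / s)"] by simp
      then have "embedding_norm \<alpha> p q s \<mu> \<le> ennreal C1 * enn_powr v (1 / s)"
        unfolding embedding_norm_def by (intro SUP_least) auto
      then have "E \<le> enn_powr (ennreal C1 * enn_powr v (1 / s)) s" unfolding E_def using s by (intro enn_powr_mono) auto
      also have "\<dots> = ennreal D1 * v" using s C1 by (simp add: enn_powr_mult enn_powr_inverse enn_powr_ennreal D1_def)
      finally show ?thesis .
    next
      case False
      then show ?thesis using D1 by (simp add: less_top[symmetric] ennreal_mult_top)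
    qed
    have uE: "u \<le> ennreal (C3 * C2) * E" using ennreal_bound_trans[OF uw wE C3 C2 order_refl] .
    have EU: "E \<le> ennreal (D1 * C4) * U" using ennreal_bound_trans[OF Ev vU' D1 C4 order_refl] .
    have cmpE: "comparable K E u"
      using ennreal_bound_trans[OF Ev vu D1 C3 K(1)] ennreal_bound_trans[OF uw wE C3 C2 K(2)] by (rule comparableI[OF K(5)])
    have cmpU: "comparable K u U"
      using ennreal_bound_trans[OF uE EU pos(2,3) K(3)] ennreal_bound_trans[OF Uv' vu C5 C3 K(4)] by (rule comparableI[OF K(5)])
    have fin: "X < top" if "Y < top" "X \<le> ennreal c * Y" for X Y c
      using that by (auto simp: ennreal_mult_less_top intro: le_less_trans)
    have Uu: "U < top \<longleftrightarrow> u < top"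
      using cmpU fin[of U u K] comparable_sym[OF K(5) cmpU] fin[of u U K] by (auto simp: comparable_def)
    \<comment> \<open>Boundedness makes the supremum over the unit ball finite. Conversely, the
      estimate for every \<open>f\<close> comes directly from the embedding bound, which avoids a
      homogeneity argument for that supremum.\<close>
    have carl: "Carleson \<alpha> p q s \<mu> \<longleftrightarrow> u < top"
    proof
      assume "Carleson \<alpha> p q s \<mu>"
      then obtain c where c: "\<forall>f\<in>Fspace. Ls_norm \<alpha> s \<mu> f \<le> ennreal c * Fnorm f"
        unfolding Carleson_def by blast
      have "Ls_norm \<alpha> s \<mu> f \<le> ennreal c" if "f \<in> Fspace" "Fnorm f \<le> 1" for f
        using c[rule_format, OF that(1)] mult_left_mono[OF that(2), of "ennreal c"] by simp
      then have "embedding_norm \<alpha> p q s \<mu> \<le> ennreal c"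
        unfolding embedding_norm_def by (intro SUP_least) auto
      then have "E < top" by (auto simp: E_def intro: le_less_trans)
      then show "u < top" using uE by (rule fin)
    next
      assume "u < top"
      then have "v < top" using vu by (rule fin)
      then have N: "ennreal C1 * enn_powr v (1 / s) < top" by (simp add: ennreal_mult_less_top)
      define c where "c = enn2real (ennreal C1 * enn_powr v (1 / s))"
      have c: "ennreal C1 * enn_powr v (1 / s) = ennreal c" using N by (simp add: c_def)
      have "f \<in> Ls_space \<alpha> s \<mu> \<and> Ls_norm \<alpha> s \<mu> f \<le> ennreal c * Fnorm f" if f: "f \<in> Fspace" for f
      proof
        show le: "Ls_norm \<alpha> s \<mu> f \<le> ennreal c * Fnorm f"
          using Ls[OF f \<open>v < top\<close>] by (simp only: c)
        have "f holomorphic_on UNIV" "Fnorm f < top" using f by (auto simp: Fock_space_def)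
        then have "f \<in> borel_measurable borel"
          by (intro borel_measurable_continuous_onI holomorphic_on_imp_continuous_on)
        then have "f \<in> borel_measurable \<mu>" using measurable_cong_sets[OF \<mu> refl] by blast
        moreover have "Ls_norm \<alpha> s \<mu> f < top" using \<open>Fnorm f < top\<close> le by (rule fin)
        ultimately show "f \<in> Ls_space \<alpha> s \<mu>" by (simp add: Ls_space_def)
      qed
      then show "Carleson \<alpha> p q s \<mu>" unfolding Carleson_def by blast
    qed
    have "bmass \<mu> \<in> borel_measurable lebesgue"
      using ball_mass_measurable[OF \<alpha> p q \<mu>, of s R] by (intro measurable_completion) simp
    then have "bmass \<mu> \<in> shell_fun_space (star_exp s p) (star_exp s q) \<longleftrightarrow> U < top"
      by (simp add: shell_fun_space_def U_def)
    moreover have "pmass \<mu> \<in> shell_seq_space (star_exp s p) (star_exp s q) \<delta> \<longleftrightarrow> u < top"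
      by (simp add: shell_seq_space_def seq)
    ultimately show ?thesis using cmpE cmpU Uu carl unfolding seq E_def U_def by simp
  qed
  with K(5) show ?thesis by blast
qed

end

theorem theorem1p4:
  fixes \<alpha> s \<delta>0 \<delta> c_in C_out R :: real and p q :: ennreal
  assumes "\<alpha> > 0" and "p > 0" and "q > 0" and "s > 0"
    and "pocket_constants c_in C_out"
    and "0 < \<delta>0" and "\<delta>0 \<le> 1 / 2" and "atomic_decomposition \<alpha> p q \<delta>0"
    and "0 < \<delta>" and "\<delta> < \<delta>0"
    and "R > C_out * \<delta>"
  shows "\<exists>C>0. \<forall>\<mu> :: complex measure. sets \<mu> = sets borel \<longrightarrow>
    (Carleson \<alpha> p q s \<mu> \<longleftrightarrow>
       pocket_mass \<alpha> p q s \<delta> \<mu> R \<in> shell_seq_space (star_exp s p) (star_exp s q) \<delta>) \<and>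
    (pocket_mass \<alpha> p q s \<delta> \<mu> R \<in> shell_seq_space (star_exp s p) (star_exp s q) \<delta> \<longleftrightarrow>
       ball_mass \<alpha> p q s \<mu> R \<in> shell_fun_space (star_exp s p) (star_exp s q)) \<and>
    comparable C (enn_powr (embedding_norm \<alpha> p q s \<mu>) s)
      (shell_seq_norm (star_exp s p) (star_exp s q) \<delta> (pocket_mass \<alpha> p q s \<delta> \<mu> R)) \<and>
    comparable C
      (shell_seq_norm (star_exp s p) (star_exp s q) \<delta> (pocket_mass \<alpha> p q s \<delta> \<mu> R))
      (shell_fun_norm (star_exp s p) (star_exp s q) (ball_mass \<alpha> p q s \<mu> R))"
proof -
  have "carleson_setting \<delta> \<alpha> s c_in C_out R p q"
  proof unfold_locales
    have d: "0 < \<delta> \<and> \<delta> < \<delta>0" using assms by simp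
    note ad = assms(8)[unfolded atomic_decomposition_def, rule_format, OF d]
    show "\<exists>C. \<forall>c\<in>lw_space p q \<delta>. \<exists>f\<in>Fock_space \<alpha> p q.
            synthesizes \<alpha> \<delta> c f \<and> Fock_norm \<alpha> p q f \<le> ennreal C * lw_norm p q \<delta> c"
      using ad by (rule conjunct1)
    show "\<exists>C>0. \<forall>f\<in>Fock_space \<alpha> p q.
            comparable C (Fock_norm \<alpha> p q f)
              (INF c\<in>{c \<in> lw_space p q \<delta>. synthesizes \<alpha> \<delta> c f}. lw_norm p q \<delta> c)"
      using ad by (elim conjE)
  qed (use assms in auto)
  then show ?thesis by (rule carleson_setting.carleson_characterization)
qed

end
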